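(* Let $d,s\in\mathbb{N}$, let $(X(t))_{t\in\mathbb{R}^d}$ be a stationary, measurable $\mathbb{R}$-valued random field and let $f_1,\dots, f_s:\mathbb{R} \to \mathbb{R}$ be functions. Let $(W_n)_{n\in \mathbb{N}}$ be a VH-growing sequence of subsets of $\mathbb{R}^d$. Assume that one of the following conditions holds: (i) The field $(X(t))_{t\in\mathbb{R}^d}$ is $BL(\theta)$-dependent for a monotonically decreasing sequence $\theta=(\theta_r)_{r\in \mathbb{N}}$ with $\lim_{r\to\infty}\theta_r=0$, the maps $f_1,\dots, f_s$ are Lipschitz continuous and \[ \int_{\mathbb{R}^d} \big|\operatorname{Cov}\big(f_i(X(0)), f_j(X(t))\big)\big|\, dt < \infty, \quad i,j=1, \dots, s.\] (ii) The field $(X(t))_{t\in\mathbb{R}^d}$ is QA and there are $c>0$ and $\epsilon>0$ with \[ \operatorname{Cov}( X(0), X(t) ) \le c \cdot \|t\|^{-d-\epsilon}_\infty, \quad t\in\mathbb{R}^d.\] The maps $f_1, \dots, f_s$ are Lipschitz continuous. (iii) The field $(X(t))_{t\in\mathbb{R}^d}$ is PA with $\mathbb{E}[X(0)^2]<\infty$. The maps $f_1,\dots, f_s$ are of locally bounded variation with $\mathbb{E}[h_{f_i}(X(0))^2]<\infty$, $i=1,\dots,s,$ and there are $c>0$ and $\epsilon>0$ with \[ \operatorname{Cov}\big( h_{f_i}(X(0)), h_{f_j}(X(t)) \big) \le c \cdot \|t\|^{-d-\epsilon}_\infty, \qquad t\in \mathbb{R}^d, \ i,j=1,\dots, s.\]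 Then \[\Big(\frac{ \int_{W_n} f_1(X(t))\, dt - \mathbb{E}[f_1(X(0))]\, \lambda_d(W_n)}{\sqrt{\lambda_d(W_n)}}, \dots, \frac{ \int_{W_n} f_s(X(t))\, dt - \mathbb{E}[f_s(X(0))]\, \lambda_d(W_n)}{\sqrt{\lambda_d(W_n)}} \Big)\to \mathcal{N}(0,\Sigma)\] as $n\to\infty$ in distribution, where $\Sigma$ is the $s\times s$ matrix with entries \[ \int_{\mathbb{R}^d} \operatorname{Cov}\big(f_i(X(0)), f_j(X(t))\big)\, dt , \quad i,j=1, \dots, s.\]
   Context: $\lambda_d$ denotes Lebesgue measure on $\mathbb{R}^d$; $\|\cdot\|_\infty$ is the maximum norm and $\|0\|_\infty^{-d-\epsilon}$ is read as $+\infty$ (so the decay bounds are conditions for $t\neq 0$). VH-growing: a sequence $(W_n)_{n\in\mathbb{N}}$ of compact subsets of $\mathbb{R}^d$ (with $\lambda_d(W_n)>0$, so that the ratio below is defined) grows in Van Hove-sense (is VH-growing) if $\lim_{n\to\infty} \lambda_d((\operatorname{bd} W_n)+B^d)/\lambda_d(W_n)=0$, where $\operatorname{bd} W$ is the boundary of $W$, $A+B=\{a+b\mid a\in A, b\in B\}$, and $B^d$ is the closed Euclidean unit ball. Random fields: a random field $(X(t))_{t\in\mathbb{R}^d}$ is a family of random variables on a common probability space; it is measurable if $(\omega,t)\mapsto X(t)(\omega)$ is jointly measurable, and stationary if its finite-dimensional distributions are invariant under translations of $\mathbb{R}^d$. In (i), the use of the covariances $\operatorname{Cov}(f_i(X(0)),f_j(X(t)))$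 for all $t$ (including $t=0$, $i=j$) presupposes $\mathbb{E}[f_i(X(0))^2]<\infty$. For a finite set $I=\{t_1,\dots,t_n\}$ with $n=\#I$ elements, $f(X_I):=f(X(t_1),\dots,X(t_n))$ (for a fixed enumeration of $I$). $BL(\theta)$-dependence: for finite $I,J\subseteq\mathbb{R}^d$ put $\operatorname{dist}(I,J)=\min\{\|x-y\|_1: x\in I, y\in J\}$, with $\|\cdot\|_1$ the $\ell_1$-norm. For a Lipschitz function $f:\mathbb{R}^n\to\mathbb{R}$ let $\operatorname{Lip}(f)=\sup\{|f(x)-f(y)|/\|x-y\|_1 : x\neq y\}$. For $\Delta>0$ let $T(\Delta)=\{(j_1/\Delta,\dots,j_d/\Delta)\mid (j_1,\dots,j_d)\in\mathbb{Z}^d\}$. The field $(X(t))_{t\in\mathbb{R}^d}$ is $BL(\theta)$-dependent if for every $r\in\mathbb{N}$, every real $\Delta>1$, all disjoint finite sets $I,J\subseteq T(\Delta)$ with $\operatorname{dist}(I,J)\ge r$ and all bounded Lipschitz functions $f:\mathbb{R}^{\#I}\to\mathbb{R}$, $g:\mathbb{R}^{\#J}\to\mathbb{R}$, \[\operatorname{Cov}(f(X_I),g(X_J))\le \min\{\#I,\#J\}\operatorname{Lip}(f)\operatorname{Lip}(g)\,\Delta^d\,\theta_r.\] PA (positively associated): $\operatorname{Cov}(f(X_I),g(X_J))\ge 0$ for any finite sets $I,J\subseteq\mathbb{R}^d$ and all functions $f:\mathbb{R}^{\#I}\to\mathbb{R}$, $g:\mathbb{R}^{\#J}\to\mathbb{R}$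 that are bounded and monotonically increasing in every coordinate. QA (quasi-associated): $\mathbb{E}[X(t)^2]<\infty$ for all $t$ and \[|\operatorname{Cov}(f(X_I),g(X_J))|\le\sum_{t\in I}\sum_{u\in J}\operatorname{Lip}_t(f)\operatorname{Lip}_u(g)\,|\operatorname{Cov}(X(t),X(u))|\] for any finite $I,J\subseteq\mathbb{R}^d$ and all Lipschitz continuous $f:\mathbb{R}^{\#I}\to\mathbb{R}$, $g:\mathbb{R}^{\#J}\to\mathbb{R}$, where $\operatorname{Lip}_t(f)$ is the Lipschitz constant of $f$ with respect to the coordinate into which $X(t)$ is inserted: the supremum of $|f(x)-f(y)|/|x_k-y_k|$ over all $x,y$ that differ exactly in this coordinate $k$. Locally bounded variation and $h_f$: $f:\mathbb{R}\to\mathbb{R}$ is of locally bounded variation if $f=\alpha+\beta$ with $\alpha:\mathbb{R}\to\mathbb{R}$ monotonically increasing and $\beta:\mathbb{R}\to\mathbb{R}$ monotonically decreasing. Let $A$ be the set of all monotonically increasing $\alpha:\mathbb{R}\to\mathbb{R}$ such that $f-\alpha$ is monotonically decreasing. Put $f^+(x)=\inf\{\alpha(x)\mid\alpha\in A,\ \alpha(0)=f(0)\}$ for $x>0$, $f^+(0)=f(0)$, $f^+(x)=\sup\{\alpha(x)\mid\alpha\in A,\ \alpha(0)=f(0)\}$ for $x<0$; $f^-:=f-f^+$; and $h_f:=f^+-f^-$. $\mathcal{N}(0,\Sigma)$ is the (possibly degenerate) centered multivariate normal distribution with covariance matrix $\Sigma$. *)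

theory Defs
  imports "HOL-Probability.Probability"
begin

section \<open>Random fields\<close>

definition cov :: "'w measure \<Rightarrow> ('w \<Rightarrow> real) \<Rightarrow> ('w \<Rightarrow> real) \<Rightarrow> real" where
  "cov M Y Z = (\<integral>\<omega>. (Y \<omega> - (\<integral>\<omega>'. Y \<omega>' \<partial>M)) * (Z \<omega> - (\<integral>\<omega>'. Z \<omega>' \<partial>M)) \<partial>M)"

definition measurable_field :: "'w measure \<Rightarrow> (real^'d \<Rightarrow> 'w \<Rightarrow> real) \<Rightarrow> bool" where
  "measurable_field M X \<longleftrightarrow> (\<lambda>(\<omega>, t). X t \<omega>) \<in> borel_measurable (M \<Otimes>\<^sub>M borel)"

text \<open>
  For a finite index set \<open>I\<close> the space of real vectors with \<open>#I\<close> coordinates is represented by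
  the extensional functions \<open>I \<rightarrow>\<^sub>E UNIV\<close>, i.e. the coordinates are indexed by the points of
  \<open>I\<close> themselves rather than by their positions in an enumeration of \<open>I\<close>.
\<close>

definition field_at :: "('t \<Rightarrow> 'w \<Rightarrow> real) \<Rightarrow> 't set \<Rightarrow> 'w \<Rightarrow> ('t \<Rightarrow> real)" where
  "field_at X I \<omega> = (\<lambda>t\<in>I. X t \<omega>)"

definition stationary_field :: "'w measure \<Rightarrow> (real^'d \<Rightarrow> 'w \<Rightarrow> real) \<Rightarrow> bool" where
  "stationary_field M X \<longleftrightarrow>
     (\<forall>I h. finite I \<longrightarrow>
        distr M (\<Pi>\<^sub>M t\<in>I. borel) (field_at (\<lambda>t. X (t + h)) I) =
        distr M (\<Pi>\<^sub>M t\<in>I. borel) (field_at X I))"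


section \<open>Lipschitz constants\<close>

definition l1_dist :: "'t set \<Rightarrow> ('t \<Rightarrow> real) \<Rightarrow> ('t \<Rightarrow> real) \<Rightarrow> real" where
  "l1_dist I x y = (\<Sum>t\<in>I. \<bar>x t - y t\<bar>)"

definition is_lipschitz :: "'t set \<Rightarrow> (('t \<Rightarrow> real) \<Rightarrow> real) \<Rightarrow> bool" where
  "is_lipschitz I f \<longleftrightarrow>
     (\<exists>L. \<forall>x\<in>I \<rightarrow>\<^sub>E UNIV. \<forall>y\<in>I \<rightarrow>\<^sub>E UNIV. \<bar>f x - f y\<bar> \<le> L * l1_dist I x y)"

definition lip_const :: "'t set \<Rightarrow> (('t \<Rightarrow> real) \<Rightarrow> real) \<Rightarrow> real" where
  "lip_const I f =
     Sup {\<bar>f x - f y\<bar> / l1_dist I x y | x y. x \<in> I \<rightarrow>\<^sub>E UNIV \<and> y \<in> I \<rightarrow>\<^sub>E UNIV \<and> x \<noteq> y}"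

definition lip_coord :: "'t set \<Rightarrow> 't \<Rightarrow> (('t \<Rightarrow> real) \<Rightarrow> real) \<Rightarrow> real" where
  "lip_coord I k f =
     Sup {\<bar>f x - f y\<bar> / \<bar>x k - y k\<bar> | x y. x \<in> I \<rightarrow>\<^sub>E UNIV \<and> y \<in> I \<rightarrow>\<^sub>E UNIV \<and>
            x k \<noteq> y k \<and> (\<forall>t\<in>I - {k}. x t = y t)}"


section \<open>Dependence conditions\<close>

definition lattice_pts :: "real \<Rightarrow> (real^'d) set" where
  "lattice_pts \<Delta> = {(\<chi> k. of_int (j k) / \<Delta>) | j :: 'd \<Rightarrow> int. True}"

definition l1_setdist :: "(real^'d) set \<Rightarrow> (real^'d) set \<Rightarrow> real" where
  "l1_setdist I J = Min {\<Sum>k\<in>UNIV. \<bar>x $ k - y $ k\<bar> | x y. x \<in> I \<and> y \<in> J}"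

text \<open>
  The sequence \<open>\<theta>\<close> is indexed by the positive integers; its value at \<open>0\<close> plays no role.
\<close>

definition BL_dependent ::
    "'w measure \<Rightarrow> (real^'d \<Rightarrow> 'w \<Rightarrow> real) \<Rightarrow> (nat \<Rightarrow> real) \<Rightarrow> bool" where
  "BL_dependent M X \<theta> \<longleftrightarrow>
     (\<forall>r\<ge>1. \<forall>\<Delta>>1. \<forall>I J f g.
        finite I \<and> finite J \<and> I \<noteq> {} \<and> J \<noteq> {} \<and> I \<inter> J = {} \<and>
        I \<subseteq> lattice_pts \<Delta> \<and> J \<subseteq> lattice_pts \<Delta> \<and> l1_setdist I J \<ge> real r \<and>
        is_lipschitz I f \<and> bounded (f ` (I \<rightarrow>\<^sub>E UNIV)) \<and>
        is_lipschitz J g \<and> bounded (g ` (J \<rightarrow>\<^sub>E UNIV)) \<longrightarrow>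
        cov M (\<lambda>\<omega>. f (field_at X I \<omega>)) (\<lambda>\<omega>. g (field_at X J \<omega>))
          \<le> real (min (card I) (card J)) * lip_const I f * lip_const J g * \<Delta> ^ CARD('d) * \<theta> r)"

text \<open>
  A function of several variables that is increasing in every coordinate need not be Borel
  measurable, so measurability of the test functions is required explicitly.
\<close>

definition PA :: "'w measure \<Rightarrow> (real^'d \<Rightarrow> 'w \<Rightarrow> real) \<Rightarrow> bool" where
  "PA M X \<longleftrightarrow>
     (\<forall>I J f g.
        finite I \<and> finite J \<and>
        f \<in> borel_measurable (\<Pi>\<^sub>M t\<in>I. borel) \<and> g \<in> borel_measurable (\<Pi>\<^sub>M t\<in>J. borel) \<and>
        bounded (f ` (I \<rightarrow>\<^sub>E UNIV)) \<and> bounded (g ` (J \<rightarrow>\<^sub>E UNIV)) \<and>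
        (\<forall>x\<in>I \<rightarrow>\<^sub>E UNIV. \<forall>k\<in>I. mono (\<lambda>a. f (x(k := a)))) \<and>
        (\<forall>x\<in>J \<rightarrow>\<^sub>E UNIV. \<forall>k\<in>J. mono (\<lambda>a. g (x(k := a)))) \<longrightarrow>
        cov M (\<lambda>\<omega>. f (field_at X I \<omega>)) (\<lambda>\<omega>. g (field_at X J \<omega>)) \<ge> 0)"

definition QA :: "'w measure \<Rightarrow> (real^'d \<Rightarrow> 'w \<Rightarrow> real) \<Rightarrow> bool" where
  "QA M X \<longleftrightarrow>
     (\<forall>t. integrable M (\<lambda>\<omega>. (X t \<omega>)\<^sup>2)) \<and>
     (\<forall>I J f g.
        finite I \<and> finite J \<and> is_lipschitz I f \<and> is_lipschitz J g \<longrightarrow>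
        \<bar>cov M (\<lambda>\<omega>. f (field_at X I \<omega>)) (\<lambda>\<omega>. g (field_at X J \<omega>))\<bar>
          \<le> (\<Sum>t\<in>I. \<Sum>u\<in>J. lip_coord I t f * lip_coord J u g * \<bar>cov M (X t) (X u)\<bar>))"


section \<open>Functions of locally bounded variation\<close>

definition locally_bv :: "(real \<Rightarrow> real) \<Rightarrow> bool" where
  "locally_bv f \<longleftrightarrow> (\<exists>\<alpha> \<beta>. mono \<alpha> \<and> antimono \<beta> \<and> (\<forall>x. f x = \<alpha> x + \<beta> x))"

definition incr_parts :: "(real \<Rightarrow> real) \<Rightarrow> (real \<Rightarrow> real) set" where
  "incr_parts f = {\<alpha>. mono \<alpha> \<and> antimono (\<lambda>x. f x - \<alpha> x)}"

definition pos_var :: "(real \<Rightarrow> real) \<Rightarrow> real \<Rightarrow> real" where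
  "pos_var f x =
     (if x > 0 then Inf {\<alpha> x | \<alpha>. \<alpha> \<in> incr_parts f \<and> \<alpha> 0 = f 0}
      else if x = 0 then f 0
      else Sup {\<alpha> x | \<alpha>. \<alpha> \<in> incr_parts f \<and> \<alpha> 0 = f 0})"

definition neg_var :: "(real \<Rightarrow> real) \<Rightarrow> real \<Rightarrow> real" where
  "neg_var f x = f x - pos_var f x"

definition h_fun :: "(real \<Rightarrow> real) \<Rightarrow> real \<Rightarrow> real" where
  "h_fun f x = pos_var f x - neg_var f x"


section \<open>Van Hove growth\<close>

definition VH_growing :: "(nat \<Rightarrow> (real^'d) set) \<Rightarrow> bool" where
  "VH_growing W \<longleftrightarrow>
     (\<forall>n. compact (W n) \<and> measure lborel (W n) > 0) \<and>
     (\<lambda>n. measure lborel {a + b | a b. a \<in> frontier (W n) \<and> b \<in> cball 0 1} / measure lborel (W n))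
        \<longlonglongrightarrow> 0"


section \<open>Multivariate normal limits\<close>

definition std_normal_vec :: "(real^'s) measure" where
  "std_normal_vec = density lborel (\<lambda>x. ennreal (\<Prod>i\<in>UNIV. std_normal_density (x $ i)))"

text \<open>
  The law of \<open>A Z\<close>, for a standard normal vector \<open>Z\<close>, depends on \<open>A\<close> only through the covariance
  matrix \<open>A A\<^sup>T\<close>, and every covariance matrix is of this form with \<open>A\<close> square.  Hence for given
  \<open>C\<close> at most one \<open>N\<close> satisfies the following; singular \<open>C\<close> are included.
\<close>

definition is_centered_normal :: "real^'s^'s \<Rightarrow> (real^'s) measure \<Rightarrow> bool" where
  "is_centered_normal C N \<longleftrightarrow>
     (\<exists>A :: real^'s^'s. A ** transpose A = C \<and> N = distr std_normal_vec borel (\<lambda>z. A *v z))"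

definition converges_in_distribution ::
    "'w measure \<Rightarrow> (nat \<Rightarrow> 'w \<Rightarrow> real^'s) \<Rightarrow> (real^'s) measure \<Rightarrow> bool" where
  "converges_in_distribution M Y N \<longleftrightarrow>
     (\<forall>n. Y n \<in> borel_measurable M) \<and>
     (\<forall>g :: real^'s \<Rightarrow> real. continuous_on UNIV g \<and> bounded (range g) \<longrightarrow>
        (\<lambda>n. \<integral>\<omega>. g (Y n \<omega>) \<partial>M) \<longlonglongrightarrow> (\<integral>x. g x \<partial>N))"

end

theory Submission
  imports Defs
begin

text \<open>
  The proof is Bernstein's block method. Write \<open>Z = a\<^sub>1 f\<^sub>1(X) + \<dots> + a\<^sub>s f\<^sub>s(X)\<close> for fixed real
  coefficients. This is again a stationary measurable field with finite second moments, and its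
  covariance function \<open>C\<close> is integrable. Fill \<open>W\<^sub>n\<close> with cubes of side \<open>m = r\<^sup>2\<close> that are separated by
  corridors of width \<open>r\<close>. Three things then have to be controlled.

  \<^item> The part of \<open>W\<^sub>n\<close> outside the cubes. The variance of the integral of \<open>Z\<close> over a set \<open>A\<close> is at
    most the volume of \<open>A\<close> times the integral of \<open>\<bar>C\<bar>\<close>. Van Hove growth makes the boundary layer
    negligible as \<open>n\<close> grows, and the corridors have relative volume \<open>1 - (m / (m + r))\<^sup>d\<close>, which
    vanishes as \<open>r\<close> grows (\<open>block_approximation\<close>, \<open>cells_volume_ratio\<close>).

  \<^item> The dependence between the cubes. Splitting off one cube after the other changes the
    characteristic function of the sum by at most a multiple of the volume of the single cube times
    a mixing coefficient \<open>\<theta>\<^sub>r\<close>, divided by the volume of \<open>W\<^sub>n\<close>. Summed over all cubes the error is a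
    multiple of \<open>\<theta>\<^sub>r\<close> (\<open>blocks_factorize\<close>).

  \<^item> The independent sum that is left. The classical second order expansion of the
    characteristic function applies (\<open>block_char_expansion\<close>), and the variance of a block divided
    by its volume tends to the integral of \<open>C\<close> (\<open>block_variance_lim\<close>).

  Letting first \<open>n\<close> and then \<open>r\<close> tend to infinity gives the limit of the characteristic function of
  every linear combination (\<open>mixing_CLT\<close>). Since second moments stay bounded, this implies
  convergence in distribution of the vectors (\<open>converges_of_char\<close>).

  The three dependence conditions enter only through the mixing bound. They speak about finitely many
  points, so integrals over cubes are replaced by Riemann sums; these converge because a measurable
  stationary field with finite second moments is continuous in mean square
  (\<open>mean_square_continuous\<close>). Under \<open>BL_dependent\<close> the bound for Riemann sums is immediate. Under \<open>QA\<close>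
  and \<open>PA\<close> it is a double sum of covariances whose limit is controlled by the tail of an integrable
  covariance function (\<open>double_riemann\<close>). Positive association is brought into this form by the
  functions \<open>h_fun\<close>: their sums dominate the increments of \<open>Z\<close>, so that adding or subtracting a
  function of \<open>Z\<close> from a large enough multiple of them leaves an increasing function
  (\<open>PA_cov_bound\<close>).

  Under \<open>QA\<close> the decay hypothesis bounds the covariance only from above. Its negative part is integrable
  as well, because variances of integrals over large cubes are nonnegative
  (\<open>integrable_C_of_upper_bound\<close>).
\<close>

section \<open>Covariances and square integrable fields\<close>

lemma abs_mult_le_sum_squares: "\<bar>a * b\<bar> \<le> a\<^sup>2 + b\<^sup>2" for a b :: real
proof -
  have "0 \<le> a\<^sup>2" "0 \<le> b\<^sup>2" by simp_all
  then show ?thesis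
    using sum_squares_bound[of "\<bar>a\<bar>" "\<bar>b\<bar>"] abs_ge_zero[of "a * b"]
    by (simp only: abs_mult mult.assoc power2_abs)
qed

lemma integrable_mult_L2:
  fixes f g :: "'a \<Rightarrow> real"
  assumes [measurable]: "f \<in> borel_measurable M" "g \<in> borel_measurable M"
    and "integrable M (\<lambda>x. (f x)\<^sup>2)" "integrable M (\<lambda>x. (g x)\<^sup>2)"
  shows "integrable M (\<lambda>x. f x * g x)"
proof (rule Bochner_Integration.integrable_bound[where f="\<lambda>x. (f x)\<^sup>2 + (g x)\<^sup>2"])
  show "AE x in M. norm (f x * g x) \<le> norm ((f x)\<^sup>2 + (g x)\<^sup>2)"
    using abs_mult_le_sum_squares by (simp add: abs_of_nonneg)
qed (use assms in auto)

text \<open>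
  The integral of \<open>(s f + t g)\<^sup>2\<close> is a nonnegative quadratic form in \<open>(s, t)\<close>.
\<close>

lemma Cauchy_Schwarz_integral:
  fixes f g :: "'a \<Rightarrow> real"
  assumes [measurable]: "f \<in> borel_measurable M" "g \<in> borel_measurable M"
    and f: "integrable M (\<lambda>x. (f x)\<^sup>2)" and g: "integrable M (\<lambda>x. (g x)\<^sup>2)"
  shows "(\<integral>x. f x * g x \<partial>M)\<^sup>2 \<le> (\<integral>x. (f x)\<^sup>2 \<partial>M) * (\<integral>x. (g x)\<^sup>2 \<partial>M)"
proof -
  define a b c where "a = (\<integral>x. (f x)\<^sup>2 \<partial>M)" "b = (\<integral>x. f x * g x \<partial>M)" "c = (\<integral>x. (g x)\<^sup>2 \<partial>M)"
  note fg = integrable_mult_L2[OF assms]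
  have q: "0 \<le> s\<^sup>2 * a + 2 * s * t * b + t\<^sup>2 * c" for s t :: real
  proof -
    have "0 \<le> (\<integral>x. (s * f x + t * g x)\<^sup>2 \<partial>M)" by simp
    also have "\<dots> = (\<integral>x. s\<^sup>2 * (f x)\<^sup>2 + 2 * s * t * (f x * g x) + t\<^sup>2 * (g x)\<^sup>2 \<partial>M)"
      by (rule Bochner_Integration.integral_cong) (auto simp: power2_eq_square algebra_simps)
    also have "\<dots> = s\<^sup>2 * a + 2 * s * t * b + t\<^sup>2 * c"
      using f g fg by (simp add: a_b_c_def)
    finally show ?thesis .
  qed
  have "0 \<le> a" by (simp add: a_b_c_def)
  have "b\<^sup>2 \<le> a * c"
  proof (cases "a = 0")
    case True
    have "b = 0"
    proof (rule ccontr)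
      assume "b \<noteq> 0"
      \<comment> \<open>for \<open>a = 0\<close> and \<open>t = 1\<close> the form is affine in \<open>s\<close>; this \<open>s\<close> makes it equal to \<open>-1\<close>\<close>
      then show False using q[of "-(c+1)/(2*b)" 1] True by (simp add: field_simps)
    qed
    then show ?thesis using True by simp
  next
    case False
    \<comment> \<open>for fixed \<open>t\<close> the form is smallest at \<open>s = - t b / a\<close>\<close>
    have "0 \<le> a * (a * c - b\<^sup>2)" using q[of b "-a"] by (simp add: power2_eq_square algebra_simps)
    with False \<open>0 \<le> a\<close> show ?thesis by (simp add: zero_le_mult_iff)
  qed
  then show ?thesis by (simp add: a_b_c_def)
qed

context prob_space begin

lemma integrable_of_L2:
  fixes f :: "'a \<Rightarrow> real"
  assumes [measurable]: "f \<in> borel_measurable M" and "integrable M (\<lambda>x. (f x)\<^sup>2)"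
  shows "integrable M f"
  using integrable_mult_L2[of f M "\<lambda>_. 1"] assms by simp

lemma expectation_abs_le_L2:
  fixes f :: "'a \<Rightarrow> real"
  assumes [measurable]: "f \<in> borel_measurable M" and "integrable M (\<lambda>x. (f x)\<^sup>2)"
  shows "expectation (\<lambda>x. \<bar>f x\<bar>) \<le> sqrt (expectation (\<lambda>x. (f x)\<^sup>2))"
  using Cauchy_Schwarz_integral[of "\<lambda>x. \<bar>f x\<bar>" M "\<lambda>_. 1"] assms
  by (auto simp: prob_space intro!: real_le_rsqrt)

lemma cov_eq:
  assumes [measurable]: "Y \<in> borel_measurable M" "Z \<in> borel_measurable M"
    and Y: "integrable M (\<lambda>x. (Y x)\<^sup>2)" and Z: "integrable M (\<lambda>x. (Z x)\<^sup>2)"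
  shows "cov M Y Z = expectation (\<lambda>x. Y x * Z x) - expectation Y * expectation Z"
proof -
  note i = integrable_of_L2[OF _ Y] integrable_of_L2[OF _ Z] integrable_mult_L2[OF _ _ Y Z]
  have "cov M Y Z = (\<integral>x. Y x * Z x - expectation Z * Y x - expectation Y * Z x
      + expectation Y * expectation Z \<partial>M)"
    unfolding cov_def by (rule Bochner_Integration.integral_cong) (auto simp: algebra_simps)
  also have "\<dots> = expectation (\<lambda>x. Y x * Z x) - expectation Y * expectation Z"
    using i by (simp add: prob_space)
  finally show ?thesis .
qed

lemma L2_bounded:
  fixes Y :: "'a \<Rightarrow> real"
  assumes [measurable]: "Y \<in> borel_measurable M" and "\<And>x. \<bar>Y x\<bar> \<le> B"
  shows "integrable M (\<lambda>x. (Y x)\<^sup>2)"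
proof (rule integrable_const_bound[where B="B\<^sup>2"])
  show "AE x in M. norm ((Y x)\<^sup>2) \<le> B\<^sup>2"
    using power_mono[OF assms(2) abs_ge_zero, of _ 2] by simp
qed simp

lemma L2_add:
  fixes Y Z :: "'a \<Rightarrow> real"
  assumes [measurable]: "Y \<in> borel_measurable M" "Z \<in> borel_measurable M"
    and Y: "integrable M (\<lambda>x. (Y x)\<^sup>2)" and Z: "integrable M (\<lambda>x. (Z x)\<^sup>2)"
  shows "integrable M (\<lambda>x. (Y x + Z x)\<^sup>2)"
proof -
  have "(\<lambda>x. (Y x + Z x)\<^sup>2) = (\<lambda>x. (Y x)\<^sup>2 + (Z x)\<^sup>2 + 2 * (Y x * Z x))"
    by (auto simp: power2_eq_square algebra_simps)
  then show ?thesis using Y Z integrable_mult_L2[OF _ _ Y Z] by simp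
qed

lemma L2_cmult:
  fixes Y :: "'a \<Rightarrow> real"
  assumes "integrable M (\<lambda>x. (Y x)\<^sup>2)"
  shows "integrable M (\<lambda>x. (c * Y x)\<^sup>2)"
  using assms by (simp add: power_mult_distrib)

lemma L2_diff:
  fixes Y Z :: "'a \<Rightarrow> real"
  assumes [measurable]: "Y \<in> borel_measurable M" "Z \<in> borel_measurable M"
    and Y: "integrable M (\<lambda>x. (Y x)\<^sup>2)" and Z: "integrable M (\<lambda>x. (Z x)\<^sup>2)"
  shows "integrable M (\<lambda>x. (Y x - Z x)\<^sup>2)"
  using L2_add[of Y "\<lambda>x. - Z x"] assms by simp

lemma L2_sum:
  fixes Y :: "'i \<Rightarrow> 'a \<Rightarrow> real"
  assumes "\<And>i. i \<in> A \<Longrightarrow> Y i \<in> borel_measurable M" "\<And>i. i \<in> A \<Longrightarrow> integrable M (\<lambda>x. (Y i x)\<^sup>2)"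
  shows "integrable M (\<lambda>x. (\<Sum>i\<in>A. Y i x)\<^sup>2)"
  using assms
proof (induction A rule: infinite_finite_induct)
  case (insert i A)
  then have [measurable]: "Y j \<in> borel_measurable M" if "j \<in> insert i A" for j using that by auto
  show ?case using insert by (auto intro!: L2_add)
qed auto

lemma L2_dominated:
  fixes Y Z :: "'a \<Rightarrow> real"
  assumes [measurable]: "Y \<in> borel_measurable M" "Z \<in> borel_measurable M"
    and Z: "integrable M (\<lambda>x. (Z x)\<^sup>2)" and le: "\<And>x. \<bar>Y x\<bar> \<le> a + b * \<bar>Z x\<bar>"
  shows "integrable M (\<lambda>x. (Y x)\<^sup>2)"
proof (rule Bochner_Integration.integrable_bound)
  show "integrable M (\<lambda>x. (a + b * \<bar>Z x\<bar>)\<^sup>2)"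
    by (rule L2_add) (use L2_cmult[of "\<lambda>x. \<bar>Z x\<bar>" b] Z in simp_all)
  show "AE x in M. norm ((Y x)\<^sup>2) \<le> norm ((a + b * \<bar>Z x\<bar>)\<^sup>2)"
    using power_mono[OF le abs_ge_zero, of _ 2] by simp
qed simp

lemma cov_sum_sum:
  assumes "finite A" "finite B"
    and [measurable]: "\<And>i. i \<in> A \<Longrightarrow> Y i \<in> borel_measurable M" "\<And>j. j \<in> B \<Longrightarrow> Z j \<in> borel_measurable M"
    and Y: "\<And>i. i \<in> A \<Longrightarrow> integrable M (\<lambda>x. (Y i x)\<^sup>2)"
    and Z: "\<And>j. j \<in> B \<Longrightarrow> integrable M (\<lambda>x. (Z j x)\<^sup>2)"
  shows "cov M (\<lambda>x. \<Sum>i\<in>A. a i * Y i x) (\<lambda>x. \<Sum>j\<in>B. b j * Z j x)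
       = (\<Sum>i\<in>A. \<Sum>j\<in>B. a i * b j * cov M (Y i) (Z j))"
proof -
  have iY: "integrable M (Y i)" if "i \<in> A" for i using integrable_of_L2 Y that assms(3) by blast
  have iZ: "integrable M (Z i)" if "i \<in> B" for i using integrable_of_L2 Z that assms(4) by blast
  have iYZ: "integrable M (\<lambda>x. Y i x * Z j x)" if "i \<in> A" "j \<in> B" for i j
    using integrable_mult_L2 Y Z that assms(3,4) by blast
  have "expectation (\<lambda>x. (\<Sum>i\<in>A. a i * Y i x) * (\<Sum>j\<in>B. b j * Z j x))
      = expectation (\<lambda>x. \<Sum>i\<in>A. \<Sum>j\<in>B. a i * b j * (Y i x * Z j x))"
    by (simp add: sum_product algebra_simps)
  also have "\<dots> = (\<Sum>i\<in>A. \<Sum>j\<in>B. a i * b j * expectation (\<lambda>x. Y i x * Z j x))"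
    using iYZ by (subst Bochner_Integration.integral_sum; simp)+
  finally have 1: "expectation (\<lambda>x. (\<Sum>i\<in>A. a i * Y i x) * (\<Sum>j\<in>B. b j * Z j x)) = \<dots>" .
  have "cov M (\<lambda>x. \<Sum>i\<in>A. a i * Y i x) (\<lambda>x. \<Sum>j\<in>B. b j * Z j x) =
     (\<Sum>i\<in>A. \<Sum>j\<in>B. a i * b j * expectation (\<lambda>x. Y i x * Z j x)) -
     (\<Sum>i\<in>A. a i * expectation (Y i)) * (\<Sum>j\<in>B. b j * expectation (Z j))"
  proof (subst cov_eq)
    show "integrable M (\<lambda>x. (\<Sum>i\<in>A. a i * Y i x)\<^sup>2)" "integrable M (\<lambda>x. (\<Sum>j\<in>B. b j * Z j x)\<^sup>2)"
      by (rule L2_sum, measurable, rule L2_cmult, use Y Z in simp)+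
  qed (use iY iZ 1 in simp_all)
  also have "\<dots> = (\<Sum>i\<in>A. \<Sum>j\<in>B. a i * b j * cov M (Y i) (Z j))"
    using assms by (simp add: cov_eq sum_product sum_subtractf[symmetric] algebra_simps)
  finally show ?thesis .
qed

lemma cov_le_sqrt:
  assumes [measurable]: "Y \<in> borel_measurable M" "Z \<in> borel_measurable M"
    and Y: "integrable M (\<lambda>x. (Y x)\<^sup>2)" and Z: "integrable M (\<lambda>x. (Z x)\<^sup>2)"
  shows "\<bar>cov M Y Z\<bar> \<le> sqrt (cov M Y Y) * sqrt (cov M Z Z)"
proof -
  have "(cov M Y Z)\<^sup>2 \<le> cov M Y Y * cov M Z Z"
    unfolding cov_def power2_eq_square[symmetric]
    by (rule Cauchy_Schwarz_integral) (use Y Z in \<open>auto intro!: L2_diff\<close>)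
  then show ?thesis
    by (metis real_sqrt_abs real_sqrt_le_mono real_sqrt_mult)
qed

lemma cov_self_nonneg: "0 \<le> cov M Y Y"
  by (simp add: cov_def power2_eq_square[symmetric])

lemma cov_self_le:
  assumes [measurable]: "Y \<in> borel_measurable M" and "integrable M (\<lambda>x. (Y x)\<^sup>2)"
  shows "cov M Y Y \<le> expectation (\<lambda>x. (Y x)\<^sup>2)"
  using assms by (subst cov_eq) (auto simp: power2_eq_square)

end

text \<open>
  Integrating a square integrable process over its parameter: this is Fubini's theorem, with the
  uniform second moment bound supplying integrability on the product spaces.
\<close>

locale L2_process = prob_space M + finite_measure \<nu>
  for M :: "'w measure" and \<nu> :: "'t measure" and Y :: "'t \<Rightarrow> 'w \<Rightarrow> real" and K :: real +
  assumes joint: "(\<lambda>(\<omega>, t). Y t \<omega>) \<in> borel_measurable (M \<Otimes>\<^sub>M \<nu>)"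
    and L2: "\<And>t. t \<in> space \<nu> \<Longrightarrow> integrable M (\<lambda>\<omega>. (Y t \<omega>)\<^sup>2)"
    and L2_le: "\<And>t. t \<in> space \<nu> \<Longrightarrow> (\<integral>\<omega>. (Y t \<omega>)\<^sup>2 \<partial>M) \<le> K"
begin

lemma joint'[measurable]: "(\<lambda>(t, \<omega>). Y t \<omega>) \<in> borel_measurable (\<nu> \<Otimes>\<^sub>M M)"
  using measurable_pair_swap[OF joint] by simp

lemma joint_compose[measurable (raw)]:
  assumes "a \<in> N \<rightarrow>\<^sub>M \<nu>" "b \<in> N \<rightarrow>\<^sub>M M"
  shows "(\<lambda>x. Y (a x) (b x)) \<in> borel_measurable N"
proof -
  have "(\<lambda>x. (\<lambda>(t, \<omega>). Y t \<omega>) (a x, b x)) \<in> borel_measurable N"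
    using assms by measurable
  then show ?thesis by simp
qed

lemma Y_measurable: "t \<in> space \<nu> \<Longrightarrow> Y t \<in> borel_measurable M"
  using joint_compose[of "\<lambda>_. t" M "\<lambda>x. x"] by simp

sublocale pair: pair_sigma_finite \<nu> M ..
sublocale nn: finite_measure "\<nu> \<Otimes>\<^sub>M \<nu>"
  using finite_measure_pair_measure[OF finite_measure_axioms finite_measure_axioms] .
sublocale nn_M: pair_sigma_finite "\<nu> \<Otimes>\<^sub>M \<nu>" M ..
sublocale nu_nu: pair_sigma_finite \<nu> \<nu> ..

lemma integrable_joint_sq: "integrable (\<nu> \<Otimes>\<^sub>M M) (\<lambda>(t, \<omega>). (Y t \<omega>)\<^sup>2)"
proof (rule pair.Fubini_integrable)
  have "integrable \<nu> (\<lambda>t. \<integral>\<omega>. (Y t \<omega>)\<^sup>2 \<partial>M)"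
    by (rule integrable_const_bound[where B=K]) (use L2_le in auto)
  then show "integrable \<nu> (\<lambda>x. \<integral>y. norm (case (x, y) of (t, \<omega>) \<Rightarrow> (Y t \<omega>)\<^sup>2) \<partial>M)"
    by simp
qed (use L2 in auto)

text \<open>
  On a finite measure space, domination by \<open>1 + y\<^sup>2\<close> turns second moments into first moments.
\<close>

lemma integrable_joint: "integrable (\<nu> \<Otimes>\<^sub>M M) (\<lambda>(t, \<omega>). Y t \<omega>)"
proof -
  have fin: "finite_measure M" "finite_measure \<nu>"
    using L2_process_axioms prob_space.axioms(1) by (auto simp: L2_process_def)
  interpret nM: finite_measure "\<nu> \<Otimes>\<^sub>M M"
    by (rule finite_measure_pair_measure) (rule fin)+
  show ?thesis
  proof (rule Bochner_Integration.integrable_bound)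
    show "integrable (\<nu> \<Otimes>\<^sub>M M) (\<lambda>x. 1 + (case x of (t, \<omega>) \<Rightarrow> (Y t \<omega>)\<^sup>2))"
      using integrable_joint_sq by simp
    have "\<bar>y\<bar> \<le> 1 + y\<^sup>2" for y :: real
    proof -
      have "0 \<le> (\<bar>y\<bar> - 1)\<^sup>2" by simp
      then have "2 * \<bar>y\<bar> \<le> 1 + y\<^sup>2" by (simp add: power2_diff)
      then show ?thesis by (smt (verit))
    qed
    then show "AE x in \<nu> \<Otimes>\<^sub>M M. norm (case x of (t, \<omega>) \<Rightarrow> Y t \<omega>)
        \<le> norm (1 + (case x of (t, \<omega>) \<Rightarrow> (Y t \<omega>)\<^sup>2))"
      by (auto simp: split_beta)
  qed simp
qed

lemma AE_integrable: "AE \<omega> in M. integrable \<nu> (\<lambda>t. Y t \<omega>)"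
  using pair.AE_integrable_snd[OF integrable_joint] .

lemma expectation_integral: "(\<integral>\<omega>. (\<integral>t. Y t \<omega> \<partial>\<nu>) \<partial>M) = (\<integral>t. (\<integral>\<omega>. Y t \<omega> \<partial>M) \<partial>\<nu>)"
  using pair.Fubini_integral[OF integrable_joint] by simp

lemma integrable_integral: "integrable M (\<lambda>\<omega>. \<integral>t. Y t \<omega> \<partial>\<nu>)"
  using pair.integrable_snd[OF integrable_joint] .

lemma expectation_abs_integral_le:
  "(\<integral>\<omega>. \<bar>\<integral>t. Y t \<omega> \<partial>\<nu>\<bar> \<partial>M) \<le> (\<integral>t. (\<integral>\<omega>. \<bar>Y t \<omega>\<bar> \<partial>M) \<partial>\<nu>)"
proof -
  have i: "integrable (\<nu> \<Otimes>\<^sub>M M) (\<lambda>(t, \<omega>). \<bar>Y t \<omega>\<bar>)"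
    using integrable_abs[OF integrable_joint] by (simp add: split_beta')
  have "(\<integral>\<omega>. \<bar>\<integral>t. Y t \<omega> \<partial>\<nu>\<bar> \<partial>M) \<le> (\<integral>\<omega>. (\<integral>t. \<bar>Y t \<omega>\<bar> \<partial>\<nu>) \<partial>M)"
    by (rule integral_mono) (use integrable_integral pair.integrable_snd[OF i] in auto)
  also have "\<dots> = (\<integral>t. (\<integral>\<omega>. \<bar>Y t \<omega>\<bar> \<partial>M) \<partial>\<nu>)"
    using pair.Fubini_integral[OF i] by simp
  finally show ?thesis .
qed

lemma
  shows integrable_integral_sq: "integrable M (\<lambda>\<omega>. (\<integral>t. Y t \<omega> \<partial>\<nu>)\<^sup>2)"
    and expectation_integral_sq:
      "(\<integral>\<omega>. (\<integral>t. Y t \<omega> \<partial>\<nu>)\<^sup>2 \<partial>M) = (\<integral>t. (\<integral>s. (\<integral>\<omega>. Y t \<omega> * Y s \<omega> \<partial>M) \<partial>\<nu>) \<partial>\<nu>)"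
    and integrable_second_moment: "integrable (\<nu> \<Otimes>\<^sub>M \<nu>) (\<lambda>x. \<integral>\<omega>. Y (fst x) \<omega> * Y (snd x) \<omega> \<partial>M)"
proof -
  have sq: "integrable (\<nu> \<Otimes>\<^sub>M \<nu> \<Otimes>\<^sub>M M) (\<lambda>(s, t, \<omega>). (Y t \<omega>)\<^sup>2)"
  proof -
    interpret t: pair_sigma_finite \<nu> "\<nu> \<Otimes>\<^sub>M M" ..
    show ?thesis
      by (rule t.Fubini_integrable) (use integrable_joint_sq in auto)
  qed
  have bd: "\<bar>\<integral>\<omega>. Y t \<omega> * Y s \<omega> \<partial>M\<bar> \<le> 2 * K" "integrable M (\<lambda>\<omega>. Y t \<omega> * Y s \<omega>)"
     "(\<integral>\<omega>. \<bar>Y t \<omega> * Y s \<omega>\<bar> \<partial>M) \<le> 2 * K"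
    if "t \<in> space \<nu>" "s \<in> space \<nu>" for t s
  proof -
    show i: "integrable M (\<lambda>\<omega>. Y t \<omega> * Y s \<omega>)"
      using that by (intro integrable_mult_L2 L2 Y_measurable)
    have "(\<integral>\<omega>. \<bar>Y t \<omega> * Y s \<omega>\<bar> \<partial>M) \<le> (\<integral>\<omega>. (Y t \<omega>)\<^sup>2 + (Y s \<omega>)\<^sup>2 \<partial>M)"
      by (rule integral_mono) (use i that L2 abs_mult_le_sum_squares in auto)
    also have "\<dots> \<le> 2 * K" using that L2 L2_le[of t] L2_le[of s] by simp
    finally show "(\<integral>\<omega>. \<bar>Y t \<omega> * Y s \<omega>\<bar> \<partial>M) \<le> 2 * K" .
    then show "\<bar>\<integral>\<omega>. Y t \<omega> * Y s \<omega> \<partial>M\<bar> \<le> 2 * K"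
      using integral_abs_bound[of M "\<lambda>\<omega>. Y t \<omega> * Y s \<omega>"] by linarith
  qed
  have i3: "integrable ((\<nu> \<Otimes>\<^sub>M \<nu>) \<Otimes>\<^sub>M M) (\<lambda>(x, \<omega>). Y (fst x) \<omega> * Y (snd x) \<omega>)"
  proof (rule nn_M.Fubini_integrable)
    have "integrable (\<nu> \<Otimes>\<^sub>M \<nu>) (\<lambda>x. \<integral>\<omega>. \<bar>Y (fst x) \<omega> * Y (snd x) \<omega>\<bar> \<partial>M)"
      by (rule nn.integrable_const_bound[where B="2*K"])
         (auto simp: space_pair_measure bd intro!: AE_I2)
    then show "integrable (\<nu> \<Otimes>\<^sub>M \<nu>) (\<lambda>x. \<integral>y. norm (case (x, y) of (x, \<omega>) \<Rightarrow> Y (fst x) \<omega> * Y (snd x) \<omega>) \<partial>M)"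
      by simp
    show "AE x in \<nu> \<Otimes>\<^sub>M \<nu>. integrable M (\<lambda>y. case (x, y) of (x, \<omega>) \<Rightarrow> Y (fst x) \<omega> * Y (snd x) \<omega>)"
      by (auto simp: space_pair_measure bd intro!: AE_I2)
  qed simp
  show i2: "integrable (\<nu> \<Otimes>\<^sub>M \<nu>) (\<lambda>x. \<integral>\<omega>. Y (fst x) \<omega> * Y (snd x) \<omega> \<partial>M)"
    using nn_M.integrable_fst[OF i3] .
  have AE: "AE \<omega> in M. (\<integral>x. Y (fst x) \<omega> * Y (snd x) \<omega> \<partial>(\<nu> \<Otimes>\<^sub>M \<nu>)) = (\<integral>t. Y t \<omega> \<partial>\<nu>)\<^sup>2"
    using AE_integrable
  proof eventually_elim
    fix \<omega> assume i: "integrable \<nu> (\<lambda>t. Y t \<omega>)"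
    have "integrable (\<nu> \<Otimes>\<^sub>M \<nu>) (\<lambda>(t, s). Y t \<omega> * Y s \<omega>)"
      using i by (intro nu_nu.Fubini_integrable) (auto simp: abs_mult)
    from nu_nu.integral_fst[OF this]
    show "(\<integral>x. Y (fst x) \<omega> * Y (snd x) \<omega> \<partial>(\<nu> \<Otimes>\<^sub>M \<nu>)) = (\<integral>t. Y t \<omega> \<partial>\<nu>)\<^sup>2"
      by (simp add: split_beta' power2_eq_square)
  qed
  have "integrable M (\<lambda>\<omega>. (\<integral>x. Y (fst x) \<omega> * Y (snd x) \<omega> \<partial>(\<nu> \<Otimes>\<^sub>M \<nu>)))"
    using nn_M.integrable_snd[OF i3] .
  then show "integrable M (\<lambda>\<omega>. (\<integral>t. Y t \<omega> \<partial>\<nu>)\<^sup>2)"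
    by (rule Bochner_Integration.integrable_cong_AE_imp) (use AE in auto)
  have "(\<integral>\<omega>. (\<integral>t. Y t \<omega> \<partial>\<nu>)\<^sup>2 \<partial>M) = (\<integral>\<omega>. (\<integral>x. Y (fst x) \<omega> * Y (snd x) \<omega> \<partial>(\<nu> \<Otimes>\<^sub>M \<nu>)) \<partial>M)"
    by (rule integral_cong_AE) (use AE in auto)
  also have "\<dots> = (\<integral>x. (\<integral>\<omega>. Y (fst x) \<omega> * Y (snd x) \<omega> \<partial>M) \<partial>(\<nu> \<Otimes>\<^sub>M \<nu>))"
    using nn_M.Fubini_integral[OF i3] by simp
  also have "\<dots> = (\<integral>t. (\<integral>s. (\<integral>\<omega>. Y t \<omega> * Y s \<omega> \<partial>M) \<partial>\<nu>) \<partial>\<nu>)"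
    using nu_nu.integral_fst[of "\<lambda>t s. \<integral>\<omega>. Y t \<omega> * Y s \<omega> \<partial>M"] i2 by (simp add: split_beta')
  finally show "(\<integral>\<omega>. (\<integral>t. Y t \<omega> \<partial>\<nu>)\<^sup>2 \<partial>M) = (\<integral>t. (\<integral>s. (\<integral>\<omega>. Y t \<omega> * Y s \<omega> \<partial>M) \<partial>\<nu>) \<partial>\<nu>)" .
qed

end

lemma abs_diff_le_twice: "\<bar>x\<bar> \<le> N \<Longrightarrow> \<bar>y\<bar> \<le> N \<Longrightarrow> \<bar>x - y\<bar> \<le> 2 * N" for x y N :: real
  by linarith

text \<open>
  The sets on which some coordinate is large measure the tail of a covariance function as well as
  the mass that a sequence of distributions may lose at infinity.
\<close>

lemma outside_box_borel[measurable]: "{v. \<exists>i. r < \<bar>v $ i\<bar>} \<in> sets (borel :: (real^'d) measure)"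
proof -
  have "{v \<in> space borel. \<exists>i. r < \<bar>(v :: real^'d) $ i\<bar>} \<in> sets borel" by measurable
  then show ?thesis by simp
qed

lemma outside_box_tendsto: "(\<lambda>k. indicat_real {v :: real^'d. \<exists>i. real k < \<bar>v $ i\<bar>} v) \<longlonglongrightarrow> 0"
proof (rule tendsto_eventually)
  have "\<forall>\<^sub>F k in sequentially. norm v \<le> real k"
    using filterlim_real_sequentially by (simp add: filterlim_at_top)
  then show "\<forall>\<^sub>F k in sequentially. indicat_real {v. \<exists>i. real k < \<bar>v $ i\<bar>} v = 0"
  proof eventually_elim
    case (elim k)
    have "\<bar>v $ i\<bar> \<le> real k" for i using component_le_norm_cart[of v i] elim by linarith
    then show ?case by (auto simp: not_less[symmetric])
  qed
qed

definition truncation :: "nat \<Rightarrow> real \<Rightarrow> real" where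
  "truncation n x = max (- real n) (min (real n) x)"

lemma truncation_measurable[measurable]: "truncation n \<in> borel_measurable borel"
  unfolding truncation_def[abs_def] by measurable

lemma truncation_bounds:
  "\<bar>truncation n x\<bar> \<le> real n" "\<bar>truncation n x\<bar> \<le> \<bar>x\<bar>" "\<bar>x - truncation n x\<bar> \<le> \<bar>x\<bar>"
  by (auto simp: truncation_def)

lemma mono_truncation: "mono (truncation n)"
  by (auto simp: mono_def truncation_def)

lemma truncation_tendsto: "(\<lambda>n. truncation n x) \<longlonglongrightarrow> x"
proof (rule tendsto_eventually)
  show "\<forall>\<^sub>F n in sequentially. truncation n x = x"
    using eventually_ge_at_top[of "nat \<lceil>\<bar>x\<bar>\<rceil>"] by eventually_elim (auto simp: truncation_def; linarith)
qed


section \<open>Lebesgue measure on a set and continuity of translations\<close>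

text \<open>
  A density, unlike a restricted space, keeps the Borel sets of the whole space, so that measurability
  of integrands carries over without side conditions.
\<close>

definition lborel_on :: "'a::euclidean_space set \<Rightarrow> 'a measure" where
  "lborel_on A = density lborel (\<lambda>x. ennreal (indicator A x))"

lemma sets_lborel_on[simp, measurable_cong]: "sets (lborel_on A) = sets borel"
  by (simp add: lborel_on_def)

lemma space_lborel_on[simp]: "space (lborel_on A) = UNIV"
  by (simp add: lborel_on_def)

lemma emeasure_lborel_on:
  "A \<in> sets borel \<Longrightarrow> B \<in> sets borel \<Longrightarrow> emeasure (lborel_on A) B = emeasure lborel (A \<inter> B)"
  by (simp add: lborel_on_def emeasure_density ennreal_indicator flip: indicator_inter_arith)

lemma measure_lborel_on:
  "A \<in> sets borel \<Longrightarrow> B \<in> sets borel \<Longrightarrow> measure (lborel_on A) B = measure lborel (A \<inter> B)"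
  by (simp add: measure_def emeasure_lborel_on)

lemma integral_lborel_on:
  fixes f :: "'a::euclidean_space \<Rightarrow> real"
  assumes "A \<in> sets borel" "f \<in> borel_measurable borel"
  shows "integral\<^sup>L (lborel_on A) f = (LINT x:A|lborel. f x)"
  unfolding lborel_on_def using assms by (subst integral_density) (auto simp: set_lebesgue_integral_def)

lemma integrable_lborel_on:
  fixes f :: "'a::euclidean_space \<Rightarrow> real"
  assumes "A \<in> sets borel" "f \<in> borel_measurable borel"
  shows "integrable (lborel_on A) f \<longleftrightarrow> set_integrable lborel A f"
  unfolding lborel_on_def using assms by (subst integrable_density) (auto simp: set_integrable_def)

lemma AE_lborel_on:
  assumes "A \<in> sets borel" "AE x in lborel. x \<in> A \<longrightarrow> P x"
  shows "AE x in lborel_on A. P x"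
  unfolding lborel_on_def using assms
  by (subst AE_density) (auto split: split_indicator elim!: eventually_mono)

lemma finite_measure_lborel_on:
  assumes "A \<in> sets borel" "emeasure lborel A < top"
  shows "finite_measure (lborel_on A)"
  by (rule finite_measureI) (use assms in \<open>simp add: emeasure_lborel_on less_top\<close>)

lemma emeasure_lborel_bounded: "bounded A \<Longrightarrow> emeasure lborel A < top" for A :: "'a::euclidean_space set"
  using emeasure_bounded_finite by (simp add: less_top)

lemma
  fixes f :: "'a::euclidean_space \<Rightarrow> real"
  shows lborel_integral_translate: "(\<integral>x. f (x + c) \<partial>lborel) = (\<integral>x. f x \<partial>lborel)"
    and lborel_integrable_translate: "integrable lborel (\<lambda>x. f (x + c)) \<longleftrightarrow> integrable lborel f"
proof -
  have *: "lborel = distr lborel lborel ((+) c)"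
    using lborel_distr_plus[of c] by (metis distr_cong sets_lborel)
  have r: "integrable lborel (\<lambda>x. f (x + c))" if "integrable lborel f" for f :: "'a \<Rightarrow> real" and c
  proof -
    have "integrable (distr lborel borel ((+) c)) f" using that by (simp add: lborel_distr_plus)
    then show ?thesis by (subst (asm) integrable_distr_eq) (use that in \<open>auto simp: add.commute\<close>)
  qed
  show i: "integrable lborel (\<lambda>x. f (x + c)) \<longleftrightarrow> integrable lborel f"
    using r[of f c] r[of "\<lambda>x. f (x + c)" "-c"] by (auto simp: algebra_simps)
  show "(\<integral>x. f (x + c) \<partial>lborel) = (\<integral>x. f x \<partial>lborel)"
  proof (cases "integrable lborel f")
    case True
    have "(\<integral>x. f x \<partial>lborel) = (\<integral>x. f x \<partial>distr lborel borel ((+) c))" by (simp add: lborel_distr_plus)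
    also have "\<dots> = (\<integral>x. f (x + c) \<partial>lborel)"
      by (subst integral_distr) (use True in \<open>auto simp: add.commute\<close>)
    finally show ?thesis ..
  next
    case False
    then show ?thesis using i by (simp add: not_integrable_integral_eq)
  qed
qed

lemma
  fixes F :: "'a::euclidean_space \<Rightarrow> real"
  assumes F: "integrable lborel F"
  shows lborel_integral_reflect: "(\<integral>x. F (c - x) \<partial>lborel) = (\<integral>x. F x \<partial>lborel)"
    and lborel_integrable_reflect: "integrable lborel (\<lambda>x. F (c - x))"
proof -
  have d: "lborel = distr lborel borel (\<lambda>x::'a. c - x)"
    using lborel_affine[of "-1" c] by (simp add: density_1)
  have [measurable]: "F \<in> borel_measurable borel" using F by auto
  show "(\<integral>x. F (c - x) \<partial>lborel) = (\<integral>x. F x \<partial>lborel)"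
    by (subst (2) d, subst integral_distr) auto
  have "integrable (distr lborel borel (\<lambda>x::'a. c - x)) F" using F d by simp
  then show "integrable lborel (\<lambda>x. F (c - x))" by (subst (asm) integrable_distr_eq) auto
qed

text \<open>
  A measurable function is an almost everywhere limit of continuous functions, for which the claim is
  clear. On a bounded set the approximation is also one in mean, by bounded convergence, and
  translating by less than one moves the set only within a slightly larger ball.
\<close>

lemma translation_continuous_L1:
  fixes z :: "'a::euclidean_space \<Rightarrow> real"
  assumes z[measurable]: "z \<in> borel_measurable borel" and bd: "\<And>x. \<bar>z x\<bar> \<le> N"
    and A: "A \<in> sets borel" "bounded A" and h: "h \<longlonglongrightarrow> 0"
  shows "(\<lambda>n. \<integral>x. \<bar>z (x + h n) - z x\<bar> \<partial>lborel_on A) \<longlonglongrightarrow> 0"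
proof (rule LIMSEQ_I)
  fix e :: real assume "0 < e"
  obtain R where R: "A \<subseteq> cball 0 R" using A(2) by (auto simp: bounded_iff subset_iff)
  define U where "U = cball (0::'a) (R + 1)"
  have U[measurable]: "U \<in> sets borel" by (simp add: U_def)
  note A(1)[measurable]
  interpret U: finite_measure "lborel_on U"
    by (rule finite_measure_lborel_on) (auto simp: U_def intro: emeasure_lborel_bounded)
  interpret A: finite_measure "lborel_on A"
    by (rule finite_measure_lborel_on) (use A in \<open>auto intro: emeasure_lborel_bounded\<close>)
  have "0 \<le> N" using bd[of 0] by linarith
  obtain S g where S: "negligible S" and g: "\<And>n::nat. continuous_on UNIV (g n)"
    and lim: "\<And>x. x \<notin> S \<Longrightarrow> (\<lambda>n. g n x) \<longlonglongrightarrow> z x"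
    using lebesgue_measurable_imp_measurable_on[of z UNIV]
    by (auto simp: measurable_on_def measurable_completion)
  define G where "G n x = max (-N) (min N (g n x))" for n x
  have Gc: "continuous_on UNIV (G n)" for n
    unfolding G_def by (intro continuous_intros g)
  have Gm[measurable]: "G n \<in> borel_measurable borel" for n
    using Gc by (intro borel_measurable_continuous_onI)
  have Gb: "\<bar>G n x\<bar> \<le> N" for n x using \<open>0 \<le> N\<close> by (auto simp: G_def)
  have Glim: "(\<lambda>n. G n x) \<longlonglongrightarrow> z x" if "x \<notin> S" for x
  proof -
    have "(\<lambda>n. G n x) \<longlonglongrightarrow> max (-N) (min N (z x))"
      unfolding G_def by (intro tendsto_intros lim that)
    also have "max (-N) (min N (z x)) = z x" using bd[of x] by auto
    finally show ?thesis .
  qed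
  have AE: "AE x in lborel. x \<notin> S"
  proof -
    have "AE x in completion lborel. x \<notin> S"
      using S by (intro AE_not_in) (simp add: negligible_iff_null_sets)
    then show ?thesis by (simp add: AE_completion_iff)
  qed
  have "(\<lambda>n. \<integral>x. \<bar>z x - G n x\<bar> \<partial>lborel_on U) \<longlonglongrightarrow> (\<integral>x. 0 \<partial>lborel_on U)"
  proof (rule integral_dominated_convergence[where w="\<lambda>_. 2 * N"])
    show "AE x in lborel_on U. (\<lambda>n. \<bar>z x - G n x\<bar>) \<longlonglongrightarrow> 0"
    proof (rule AE_lborel_on[OF U])
      show "AE x in lborel. x \<in> U \<longrightarrow> (\<lambda>n. \<bar>z x - G n x\<bar>) \<longlonglongrightarrow> 0"
        using AE
      proof eventually_elim
        case (elim x)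
        have "(\<lambda>n. \<bar>z x - G n x\<bar>) \<longlonglongrightarrow> \<bar>z x - z x\<bar>" by (intro tendsto_intros Glim elim)
        then show ?case by simp
      qed
    qed
    show "AE x in lborel_on U. norm \<bar>z x - G n x\<bar> \<le> 2 * N" for n
      using abs_diff_le_twice[OF bd Gb] by simp
  qed auto
  then obtain k where k: "(\<integral>x. \<bar>z x - G k x\<bar> \<partial>lborel_on U) < e / 4"
    using \<open>0 < e\<close> order_tendstoD(2)[of _ "\<integral>x. 0 \<partial>lborel_on U" sequentially "e/4"]
    by (auto simp: eventually_sequentially)
  have i: "integrable (lborel_on V) (\<lambda>x. \<bar>p x - q x\<bar>)"
    if "finite_measure (lborel_on V)" "p \<in> borel_measurable borel" "q \<in> borel_measurable borel"
      "\<And>x. \<bar>p x\<bar> \<le> N" "\<And>x. \<bar>q x\<bar> \<le> N" for V :: "'a set" and p q :: "'a \<Rightarrow> real"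
  proof -
    interpret finite_measure "lborel_on V" by fact
    have [measurable]: "p \<in> borel_measurable borel" "q \<in> borel_measurable borel" using that by auto
    have "\<bar>p x - q x\<bar> \<le> 2 * N" for x using that(4)[of x] that(5)[of x] by linarith
    then show ?thesis by (intro integrable_const_bound[where B="2*N"]) auto
  qed
  note finA = A.finite_measure_axioms and finU = U.finite_measure_axioms
  \<comment> \<open>the approximation error of the translated functions is not larger than that on the ball \<open>U\<close>\<close>
  have shift: "(\<integral>x. \<bar>z (x + c) - G k (x + c)\<bar> \<partial>lborel_on A) \<le> (\<integral>x. \<bar>z x - G k x\<bar> \<partial>lborel_on U)"
    if c: "norm c \<le> 1" for c
  proof -
    have sub: "x + c \<in> U" if "x \<in> A" for x
      using R that c norm_triangle_ineq[of x c] by (force simp: U_def)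
    have iU: "integrable lborel (\<lambda>x. indicator U x * \<bar>z x - G k x\<bar>)"
      using i[OF finU z Gm[of k] bd Gb[of k]] by (subst (asm) integrable_lborel_on) (auto simp: set_integrable_def)
    have iA: "integrable lborel (\<lambda>x. indicator A x * \<bar>z (x+c) - G k (x+c)\<bar>)"
    proof -
      have "integrable (lborel_on A) (\<lambda>x. \<bar>z (x+c) - G k (x+c)\<bar>)"
        using bd Gb by (intro i[OF finA]) auto
      then show ?thesis by (subst (asm) integrable_lborel_on) (auto simp: set_integrable_def)
    qed
    have "(\<integral>x. indicator A x * \<bar>z (x + c) - G k (x + c)\<bar> \<partial>lborel)
        \<le> (\<integral>x. indicator U (x+c) * \<bar>z (x + c) - G k (x + c)\<bar> \<partial>lborel)"
    proof (rule integral_mono[OF iA])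
      show "integrable lborel (\<lambda>x. indicator U (x+c) * \<bar>z (x + c) - G k (x + c)\<bar>)"
        using iU lborel_integrable_translate[of "\<lambda>x. indicator U x * \<bar>z x - G k x\<bar>" c] by simp
    qed (use sub in \<open>auto split: split_indicator\<close>)
    also have "\<dots> = (\<integral>x. indicator U x * \<bar>z x - G k x\<bar> \<partial>lborel)"
      by (rule lborel_integral_translate[of "\<lambda>x. indicator U x * \<bar>z x - G k x\<bar>"])
    finally show ?thesis
      by (subst (1 2) integral_lborel_on) (auto simp: set_lebesgue_integral_def)
  qed
  have "(\<lambda>n. \<integral>x. \<bar>G k (x + h n) - G k x\<bar> \<partial>lborel_on A) \<longlonglongrightarrow> (\<integral>x. 0 \<partial>lborel_on A)"
  proof (rule integral_dominated_convergence[where w="\<lambda>_. 2 * N"])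
    show "AE x in lborel_on A. (\<lambda>n. \<bar>G k (x + h n) - G k x\<bar>) \<longlonglongrightarrow> 0"
    proof (rule AE_I2)
      fix x :: 'a
      have "(\<lambda>n. G k (x + h n)) \<longlonglongrightarrow> G k (x + 0)"
        using Gc[of k] by (intro isCont_tendsto_compose[where g="G k"] tendsto_intros h)
          (auto simp: continuous_on_eq_continuous_at)
      then have "(\<lambda>n. \<bar>G k (x + h n) - G k x\<bar>) \<longlonglongrightarrow> \<bar>G k (x + 0) - G k x\<bar>" by (intro tendsto_intros)
      then show "(\<lambda>n. \<bar>G k (x + h n) - G k x\<bar>) \<longlonglongrightarrow> 0" by simp
    qed
    show "AE x in lborel_on A. norm \<bar>G k (x + h n) - G k x\<bar> \<le> 2 * N" for n
      using abs_diff_le_twice[OF Gb Gb] by simp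
  qed auto
  then have "\<forall>\<^sub>F n in sequentially. (\<integral>x. \<bar>G k (x + h n) - G k x\<bar> \<partial>lborel_on A) < e / 4"
    using \<open>0 < e\<close> by (intro order_tendstoD(2)) auto
  moreover have "\<forall>\<^sub>F n in sequentially. norm (h n) < 1"
    using order_tendstoD(2)[OF tendsto_norm[OF h], of 1] by simp
  ultimately have "\<forall>\<^sub>F n in sequentially. norm ((\<integral>x. \<bar>z (x + h n) - z x\<bar> \<partial>lborel_on A) - 0) < e"
  proof eventually_elim
    case (elim n)
    have ii: "integrable (lborel_on A) (\<lambda>x. \<bar>z (x + h n) - G k (x + h n)\<bar>)"
      "integrable (lborel_on A) (\<lambda>x. \<bar>G k (x + h n) - G k x\<bar>)"
      "integrable (lborel_on A) (\<lambda>x. \<bar>z (x + 0) - G k (x + 0)\<bar>)"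
      "integrable (lborel_on A) (\<lambda>x. \<bar>z (x + h n) - z x\<bar>)"
      using bd Gb by (intro i[OF finA]; simp)+
    have "(\<integral>x. \<bar>z (x + h n) - z x\<bar> \<partial>lborel_on A)
      \<le> (\<integral>x. \<bar>z (x + h n) - G k (x + h n)\<bar> + \<bar>G k (x + h n) - G k x\<bar> + \<bar>z (x + 0) - G k (x + 0)\<bar> \<partial>lborel_on A)"
      by (rule integral_mono) (use ii in auto)
    also have "\<dots> = (\<integral>x. \<bar>z (x + h n) - G k (x + h n)\<bar> \<partial>lborel_on A)
       + (\<integral>x. \<bar>G k (x + h n) - G k x\<bar> \<partial>lborel_on A) + (\<integral>x. \<bar>z (x + 0) - G k (x + 0)\<bar> \<partial>lborel_on A)"
      using ii by simp
    also have "\<dots> < e" using shift[of "h n"] shift[of 0] elim k \<open>0 < e\<close> by simp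
    finally show ?case by simp
  qed
  then show "\<exists>no. \<forall>n\<ge>no. norm ((\<integral>x. \<bar>z (x + h n) - z x\<bar> \<partial>lborel_on A) - 0) < e"
    by (simp add: eventually_sequentially)
qed


section \<open>Stationary measurable fields\<close>

lemma measurable_field_compose:
  assumes "measurable_field M X" "g \<in> borel_measurable borel"
  shows "measurable_field M (\<lambda>t \<omega>. g (X t \<omega>))"
proof -
  have "(\<lambda>x. g ((\<lambda>(\<omega>, t). X t \<omega>) x)) \<in> borel_measurable (M \<Otimes>\<^sub>M borel)"
    by (rule measurable_compose[OF _ assms(2)]) (use assms(1) in \<open>simp add: measurable_field_def\<close>)
  then show ?thesis by (simp add: measurable_field_def split_beta')
qed

lemma measurable_field_eval:
  assumes X: "measurable_field M X" and "a \<in> N \<rightarrow>\<^sub>M borel" "b \<in> N \<rightarrow>\<^sub>M M"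
  shows "(\<lambda>x. X (a x) (b x)) \<in> borel_measurable N"
proof -
  have "(\<lambda>x. (\<lambda>(\<omega>, t). X t \<omega>) (b x, a x)) \<in> borel_measurable N"
    by (rule measurable_compose[OF _ X[unfolded measurable_field_def]]) (use assms in measurable)
  then show ?thesis by simp
qed

lemma measurable_field_at:
  "measurable_field M X \<Longrightarrow> X t \<in> borel_measurable M"
  using measurable_field_eval[of M X "\<lambda>_. t" M "\<lambda>x. x"] by simp

lemma measurable_field_at_set:
  assumes "measurable_field M X"
  shows "field_at (\<lambda>t. X (p t)) I \<in> M \<rightarrow>\<^sub>M (\<Pi>\<^sub>M t\<in>I. borel)"
  unfolding field_at_def by (rule measurable_restrict) (use assms in \<open>rule measurable_field_at\<close>)

lemma
  fixes H :: "(real^'d \<Rightarrow> real) \<Rightarrow> real"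
  assumes X: "measurable_field M X" "stationary_field M X" and I: "finite I"
    and H[measurable]: "H \<in> borel_measurable (\<Pi>\<^sub>M t\<in>I. borel)"
  shows stationary_integral: "(\<integral>\<omega>. H (field_at (\<lambda>t. X (t + h)) I \<omega>) \<partial>M) = (\<integral>\<omega>. H (field_at X I \<omega>) \<partial>M)"
    and stationary_integrable: "integrable M (\<lambda>\<omega>. H (field_at (\<lambda>t. X (t + h)) I \<omega>))
          \<longleftrightarrow> integrable M (\<lambda>\<omega>. H (field_at X I \<omega>))"
proof -
  note m = measurable_field_at_set[OF X(1)]
  have e: "distr M (\<Pi>\<^sub>M t\<in>I. borel) (field_at (\<lambda>t. X (t + h)) I) = distr M (\<Pi>\<^sub>M t\<in>I. borel) (field_at X I)"
    using X(2) I by (simp add: stationary_field_def)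
  show "(\<integral>\<omega>. H (field_at (\<lambda>t. X (t + h)) I \<omega>) \<partial>M) = (\<integral>\<omega>. H (field_at X I \<omega>) \<partial>M)"
    using integral_distr[OF m[of "\<lambda>t. t + h" I] H] integral_distr[OF m[of "\<lambda>t. t" I] H] e by simp
  show "integrable M (\<lambda>\<omega>. H (field_at (\<lambda>t. X (t + h)) I \<omega>)) \<longleftrightarrow> integrable M (\<lambda>\<omega>. H (field_at X I \<omega>))"
    using integrable_distr_eq[OF m[of "\<lambda>t. t + h" I] H] integrable_distr_eq[OF m[of "\<lambda>t. t" I] H] e by simp
qed

lemma stationary_field_compose:
  fixes X :: "real^'d \<Rightarrow> 'w \<Rightarrow> real"
  assumes X: "measurable_field M X" "stationary_field M X" and g[measurable]: "g \<in> borel_measurable borel"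
  shows "stationary_field M (\<lambda>t \<omega>. g (X t \<omega>))"
  unfolding stationary_field_def
proof (intro allI impI)
  fix I :: "(real^'d) set" and h assume I: "finite I"
  define G where "G x = (\<lambda>t\<in>I. g (x t))" for x :: "real^'d \<Rightarrow> real"
  have G: "G \<in> (\<Pi>\<^sub>M t\<in>I. borel) \<rightarrow>\<^sub>M (\<Pi>\<^sub>M t\<in>I. borel)"
    unfolding G_def by measurable
  have eq: "field_at (\<lambda>t \<omega>. g (X (p t) \<omega>)) I = G \<circ> field_at (\<lambda>t. X (p t)) I" for p
    by (auto simp: field_at_def G_def fun_eq_iff)
  note m = measurable_field_at_set[OF X(1)]
  show "distr M (\<Pi>\<^sub>M t\<in>I. borel) (field_at (\<lambda>t \<omega>. g (X (t + h) \<omega>)) I)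
      = distr M (\<Pi>\<^sub>M t\<in>I. borel) (field_at (\<lambda>t \<omega>. g (X t \<omega>)) I)"
    using X(2) I distr_distr[OF G m[of "\<lambda>t. t + h" I]] distr_distr[OF G m[of "\<lambda>t. t" I]]
    by (simp add: eq stationary_field_def)
qed

locale L2_field = prob_space M for M :: "'w measure" +
  fixes Z :: "real^'d \<Rightarrow> 'w \<Rightarrow> real"
  assumes mf: "measurable_field M Z" and sf: "stationary_field M Z"
    and L2_0: "integrable M (\<lambda>\<omega>. (Z 0 \<omega>)\<^sup>2)"
begin

lemmas eval[measurable (raw)] = measurable_field_eval[OF mf]
lemmas Z_measurable[measurable] = measurable_field_at[OF mf]

lemma
  fixes H :: "real \<Rightarrow> real"
  assumes [measurable]: "H \<in> borel_measurable borel"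
  shows law1: "expectation (\<lambda>\<omega>. H (Z t \<omega>)) = expectation (\<lambda>\<omega>. H (Z 0 \<omega>))"
    and integrable_law1: "integrable M (\<lambda>\<omega>. H (Z t \<omega>)) \<longleftrightarrow> integrable M (\<lambda>\<omega>. H (Z 0 \<omega>))"
  using stationary_integral[OF mf sf, of "{0}" "\<lambda>x. H (x 0)" t]
    stationary_integrable[OF mf sf, of "{0}" "\<lambda>x. H (x 0)" t]
  by (simp_all add: field_at_def)

text \<open>
  Evaluate at the two points \<open>0\<close> and \<open>t - s\<close>, and translate both by \<open>s\<close>. If \<open>s = t\<close> the index set
  degenerates to one point, which does no harm because the coordinates are indexed by points.
\<close>

lemma law2:
  fixes H :: "real \<times> real \<Rightarrow> real"
  assumes [measurable]: "H \<in> borel_measurable (borel \<Otimes>\<^sub>M borel)"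
  shows "expectation (\<lambda>\<omega>. H (Z s \<omega>, Z t \<omega>)) = expectation (\<lambda>\<omega>. H (Z 0 \<omega>, Z (t - s) \<omega>))"
proof -
  have [measurable]: "(\<lambda>x. H (x 0, x (t - s))) \<in> borel_measurable (\<Pi>\<^sub>M u\<in>{0, t - s}. borel)"
    by measurable
  show ?thesis
    using stationary_integral[OF mf sf, of "{0, t - s}" "\<lambda>x. H (x 0, x (t - s))" s]
    by (simp add: field_at_def)
qed

lemma L2: "integrable M (\<lambda>\<omega>. (Z t \<omega>)\<^sup>2)"
  using integrable_law1[of "\<lambda>x. x\<^sup>2" t] L2_0 by simp

lemma integrable_Z: "integrable M (Z t)"
  using integrable_of_L2[OF _ L2] by simp

text \<open>
  The covariance function \<open>C\<close> and the mean square increment \<open>D\<close> depend on one point only, by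
  stationarity.
\<close>

definition \<mu> where "\<mu> = expectation (Z 0)"
definition m2 where "m2 = expectation (\<lambda>\<omega>. (Z 0 \<omega>)\<^sup>2)"
definition C where "C t = cov M (Z 0) (Z t)"
definition D where "D h = expectation (\<lambda>\<omega>. (Z h \<omega> - Z 0 \<omega>)\<^sup>2)"

lemma mean: "expectation (Z t) = \<mu>"
  using law1[of "\<lambda>x. x" t] by (simp add: \<mu>_def)

lemma second_moment: "expectation (\<lambda>\<omega>. (Z t \<omega>)\<^sup>2) = m2"
  using law1[of "\<lambda>x. x\<^sup>2" t] by (simp add: m2_def)

lemma cov_eq_C: "cov M (Z s) (Z t) = C (t - s)"
  using law2[of "\<lambda>(x, y). (x - \<mu>) * (y - \<mu>)" s t] by (simp add: C_def cov_def mean)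

lemma C_measurable[measurable]: "C \<in> borel_measurable borel"
  unfolding C_def cov_def by measurable

lemma C0_nonneg: "0 \<le> C 0"
  unfolding C_def by (rule cov_self_nonneg)

lemma abs_C_le: "\<bar>C t\<bar> \<le> C 0"
  using cov_le_sqrt[OF _ _ L2 L2, of 0 t] C0_nonneg by (simp add: cov_eq_C)

lemma C_eq_expectation: "C (t - s) = expectation (\<lambda>\<omega>. (Z s \<omega> - \<mu>) * (Z t \<omega> - \<mu>))"
  unfolding cov_eq_C[symmetric] cov_def by (simp add: mean)

lemma D_shift: "expectation (\<lambda>\<omega>. (Z t \<omega> - Z s \<omega>)\<^sup>2) = D (t - s)"
  using law2[of "\<lambda>(x, y). (y - x)\<^sup>2" s t] by (simp add: D_def)

lemma D_nonneg: "0 \<le> D h"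
  by (simp add: D_def)

lemma L2_increment: "integrable M (\<lambda>\<omega>. (Z t \<omega> - Z s \<omega>)\<^sup>2)"
  by (intro L2_diff L2) auto

text \<open>
  Truncation reduces the claim to first moments of increments of a bounded field, because the square of
  such an increment is at most a constant times its modulus. By stationarity this first moment equals its
  average over the unit cube. After exchanging the two integrations, continuity of translations
  applies to each path.
\<close>

lemma mean_square_continuous:
  assumes h: "h \<longlonglongrightarrow> 0"
  shows "(\<lambda>n. D (h n)) \<longlonglongrightarrow> 0"
proof -
  define err where "err N = expectation (\<lambda>\<omega>. (Z 0 \<omega> - truncation N (Z 0 \<omega>))\<^sup>2)" for N
  have errL2: "integrable M (\<lambda>\<omega>. (Z t \<omega> - truncation N (Z t \<omega>))\<^sup>2)" for t N
    by (rule L2_dominated[OF _ _ L2[of t], of _ 0 1]) (use truncation_bounds(3) in auto)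
  have err_shift: "expectation (\<lambda>\<omega>. (Z t \<omega> - truncation N (Z t \<omega>))\<^sup>2) = err N" for t N
    using law1[of "\<lambda>x. (x - truncation N x)\<^sup>2" t] by (simp add: err_def)
  have "err \<longlonglongrightarrow> expectation (\<lambda>\<omega>. 0)"
    unfolding err_def
  proof (rule integral_dominated_convergence[where w="\<lambda>\<omega>. (Z 0 \<omega>)\<^sup>2"])
    show "AE \<omega> in M. (\<lambda>i. (Z 0 \<omega> - truncation i (Z 0 \<omega>))\<^sup>2) \<longlonglongrightarrow> 0"
    proof (rule AE_I2)
      fix \<omega>
      have "(\<lambda>i. (Z 0 \<omega> - truncation i (Z 0 \<omega>))\<^sup>2) \<longlonglongrightarrow> (Z 0 \<omega> - Z 0 \<omega>)\<^sup>2"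
        by (intro tendsto_intros truncation_tendsto)
      then show "(\<lambda>i. (Z 0 \<omega> - truncation i (Z 0 \<omega>))\<^sup>2) \<longlonglongrightarrow> 0" by simp
    qed
    show "AE \<omega> in M. norm ((Z 0 \<omega> - truncation i (Z 0 \<omega>))\<^sup>2) \<le> (Z 0 \<omega>)\<^sup>2" for i
      using truncation_bounds(3) by (auto simp: abs_le_square_iff[symmetric])
  qed (use L2_0 in auto)
  then have err0: "err \<longlonglongrightarrow> 0" by simp
  define A :: "(real^'d) set" where "A = cbox 0 One"
  have A: "A \<in> sets borel" "bounded A" "measure lborel A = 1"
    by (auto simp: A_def measure_def)
  interpret A: finite_measure "lborel_on A"
    by (rule finite_measure_lborel_on) (use A in \<open>auto intro: emeasure_lborel_bounded\<close>)
  have trunc: "(\<lambda>n. expectation (\<lambda>\<omega>. \<bar>truncation N (Z (h n) \<omega>) - truncation N (Z 0 \<omega>)\<bar>)) \<longlonglongrightarrow> 0" for N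
  proof -
    have "expectation (\<lambda>\<omega>. \<bar>truncation N (Z (h n) \<omega>) - truncation N (Z 0 \<omega>)\<bar>)
        = expectation (\<lambda>\<omega>. \<integral>t. \<bar>truncation N (Z (t + h n) \<omega>) - truncation N (Z t \<omega>)\<bar> \<partial>lborel_on A)" for n
    proof -
      define Y where "Y t \<omega> = \<bar>truncation N (Z (t + h n) \<omega>) - truncation N (Z t \<omega>)\<bar>" for t \<omega>
      have Yb: "\<bar>Y t \<omega>\<bar> \<le> 2 * real N" for t \<omega> using abs_diff_le_twice[OF truncation_bounds(1) truncation_bounds(1)] by (simp add: Y_def)
      interpret Y: L2_process M "lborel_on A" Y "(2 * real N)\<^sup>2"
      proof
        show m: "(\<lambda>(\<omega>, t). Y t \<omega>) \<in> borel_measurable (M \<Otimes>\<^sub>M lborel_on A)"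
          unfolding Y_def by measurable
        have [measurable]: "Y t \<in> borel_measurable M" for t unfolding Y_def by measurable
        show i: "integrable M (\<lambda>\<omega>. (Y t \<omega>)\<^sup>2)" for t by (rule L2_bounded[OF _ Yb]) auto
        show "expectation (\<lambda>\<omega>. (Y t \<omega>)\<^sup>2) \<le> (2 * real N)\<^sup>2" for t
          by (rule integral_le_const[OF i]) (use power_mono[OF Yb abs_ge_zero, of _ _ 2] in auto)
      qed
      have "expectation (Y t) = expectation (\<lambda>\<omega>. \<bar>truncation N (Z (h n) \<omega>) - truncation N (Z 0 \<omega>)\<bar>)" for t
        using law2[of "\<lambda>(x, y). \<bar>truncation N y - truncation N x\<bar>" t "t + h n"] by (simp add: Y_def[abs_def])
      then have "expectation (\<lambda>\<omega>. \<integral>t. Y t \<omega> \<partial>lborel_on A)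
          = (\<integral>t. expectation (\<lambda>\<omega>. \<bar>truncation N (Z (h n) \<omega>) - truncation N (Z 0 \<omega>)\<bar>) \<partial>lborel_on A)"
        by (simp add: Y.expectation_integral)
      then show ?thesis using A by (simp add: measure_lborel_on Y_def)
    qed
    moreover have "(\<lambda>n. expectation (\<lambda>\<omega>. \<integral>t. \<bar>truncation N (Z (t + h n) \<omega>) - truncation N (Z t \<omega>)\<bar> \<partial>lborel_on A))
        \<longlonglongrightarrow> expectation (\<lambda>\<omega>. 0)"
    proof (rule integral_dominated_convergence[where w="\<lambda>_. 2 * real N"])
      show "AE \<omega> in M. (\<lambda>n. \<integral>t. \<bar>truncation N (Z (t + h n) \<omega>) - truncation N (Z t \<omega>)\<bar> \<partial>lborel_on A) \<longlonglongrightarrow> 0"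
      proof (rule AE_I2)
        fix \<omega> assume [measurable]: "\<omega> \<in> space M"
        show "(\<lambda>n. \<integral>t. \<bar>truncation N (Z (t + h n) \<omega>) - truncation N (Z t \<omega>)\<bar> \<partial>lborel_on A) \<longlonglongrightarrow> 0"
          by (rule translation_continuous_L1[OF _ _ A(1,2) h, where z="\<lambda>t. truncation N (Z t \<omega>)" and N="real N"])
             (use truncation_bounds(1) in auto)
      qed
      show "AE \<omega> in M. norm (\<integral>t. \<bar>truncation N (Z (t + h n) \<omega>) - truncation N (Z t \<omega>)\<bar> \<partial>lborel_on A) \<le> 2 * real N" for n
      proof (rule AE_I2)
        fix \<omega> assume [measurable]: "\<omega> \<in> space M"
        have b: "\<bar>truncation N (Z (t + h n) \<omega>) - truncation N (Z t \<omega>)\<bar> \<le> 2 * real N" for t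
          by (rule abs_diff_le_twice[OF truncation_bounds(1) truncation_bounds(1)])
        have "(\<integral>t. \<bar>truncation N (Z (t + h n) \<omega>) - truncation N (Z t \<omega>)\<bar> \<partial>lborel_on A) \<le> (\<integral>t. 2 * real N \<partial>lborel_on A)"
          by (rule integral_mono)
             (use b in \<open>auto intro!: A.integrable_const_bound[where B="2 * real N"]\<close>)
        then show "norm (\<integral>t. \<bar>truncation N (Z (t + h n) \<omega>) - truncation N (Z t \<omega>)\<bar> \<partial>lborel_on A) \<le> 2 * real N"
          using A by (simp add: measure_lborel_on)
      qed
    qed auto
    ultimately show ?thesis by simp
  qed
  have bound: "D (h n) \<le> 6 * err N + 6 * real N * expectation (\<lambda>\<omega>. \<bar>truncation N (Z (h n) \<omega>) - truncation N (Z 0 \<omega>)\<bar>)" for n N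
  proof -
    let ?a = "\<lambda>\<omega>. Z (h n) \<omega> - truncation N (Z (h n) \<omega>)" and ?b = "\<lambda>\<omega>. truncation N (Z (h n) \<omega>) - truncation N (Z 0 \<omega>)"
      and ?c = "\<lambda>\<omega>. Z 0 \<omega> - truncation N (Z 0 \<omega>)"
    have sq3: "(x + y - z)\<^sup>2 \<le> 3 * x\<^sup>2 + 3 * y\<^sup>2 + 3 * z\<^sup>2" for x y z :: real
      using zero_le_power2[of "x - y"] zero_le_power2[of "x + z"] zero_le_power2[of "y + z"]
      by (simp add: power2_eq_square algebra_simps)
    have "(Z (h n) \<omega> - Z 0 \<omega>)\<^sup>2 \<le> 3 * (?a \<omega>)\<^sup>2 + 6 * real N * \<bar>?b \<omega>\<bar> + 3 * (?c \<omega>)\<^sup>2" for \<omega>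
    proof -
      have "\<bar>?b \<omega>\<bar> * \<bar>?b \<omega>\<bar> \<le> (2 * real N) * \<bar>?b \<omega>\<bar>"
        by (intro mult_right_mono abs_diff_le_twice[OF truncation_bounds(1) truncation_bounds(1)]) simp
      then have "(?b \<omega>)\<^sup>2 \<le> 2 * real N * \<bar>?b \<omega>\<bar>" by (simp add: power2_eq_square)
      then show ?thesis using sq3[of "?a \<omega>" "?b \<omega>" "?c \<omega>"] by simp
    qed
    moreover have ib: "integrable M (\<lambda>\<omega>. \<bar>?b \<omega>\<bar>)"
    proof (rule integrable_const_bound[where B="2 * real N"])
      have "\<bar>?b \<omega>\<bar> \<le> 2 * real N" for \<omega>
        by (rule abs_diff_le_twice[OF truncation_bounds(1) truncation_bounds(1)])
      then show "AE \<omega> in M. norm \<bar>?b \<omega>\<bar> \<le> 2 * real N" by simp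
    qed simp
    ultimately have "D (h n) \<le> expectation (\<lambda>\<omega>. 3 * (?a \<omega>)\<^sup>2 + 6 * real N * \<bar>?b \<omega>\<bar> + 3 * (?c \<omega>)\<^sup>2)"
      unfolding D_def by (intro integral_mono) (use errL2 L2_increment in auto)
    also have "\<dots> = 3 * err N + 6 * real N * expectation (\<lambda>\<omega>. \<bar>?b \<omega>\<bar>) + 3 * err N"
      using errL2 ib err_shift by simp
    finally show ?thesis by simp
  qed
  show ?thesis
  proof (rule LIMSEQ_I)
    fix e :: real assume "0 < e"
    obtain N where N: "err N < e / 12"
      using order_tendstoD(2)[OF err0, of "e/12"] \<open>0 < e\<close> by (auto simp: eventually_sequentially)
    have "(\<lambda>n. 6 * real N * expectation (\<lambda>\<omega>. \<bar>truncation N (Z (h n) \<omega>) - truncation N (Z 0 \<omega>)\<bar>)) \<longlonglongrightarrow> 6 * real N * 0"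
      by (intro tendsto_intros trunc)
    then have "\<forall>\<^sub>F n in sequentially. 6 * real N * expectation (\<lambda>\<omega>. \<bar>truncation N (Z (h n) \<omega>) - truncation N (Z 0 \<omega>)\<bar>) < e / 2"
      using \<open>0 < e\<close> by (intro order_tendstoD(2)) auto
    then have "\<forall>\<^sub>F n in sequentially. norm (D (h n) - 0) < e"
    proof eventually_elim
      case (elim n)
      then show ?case using bound[of n N] N D_nonneg[of "h n"] by simp
    qed
    then show "\<exists>no. \<forall>n\<ge>no. norm (D (h n) - 0) < e" by (simp add: eventually_sequentially)
  qed
qed

text \<open>
  An increment of \<open>C\<close> is the covariance of \<open>Z 0\<close> with an increment of the field.
\<close>

lemma C_tendsto:
  assumes "s \<longlonglongrightarrow> t"
  shows "(\<lambda>n. C (s n)) \<longlonglongrightarrow> C t"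
proof -
  have le: "\<bar>C (s n) - C t\<bar> \<le> sqrt (C 0) * sqrt (D (s n - t))" for n
  proof -
    have inc: "cov M (\<lambda>\<omega>. Z (s n) \<omega> - Z t \<omega>) (\<lambda>\<omega>. Z (s n) \<omega> - Z t \<omega>) \<le> D (s n - t)"
      using cov_self_le[OF _ L2_increment[of "s n" t]] by (simp add: D_shift)
    have "C (s n) - C t = cov M (Z 0) (\<lambda>\<omega>. Z (s n) \<omega> - Z t \<omega>)"
      unfolding C_def using L2 L2_increment integrable_Z
      by (simp add: cov_eq integrable_mult_L2 algebra_simps)
    then have "\<bar>C (s n) - C t\<bar> \<le> sqrt (cov M (Z 0) (Z 0)) * sqrt (cov M (\<lambda>\<omega>. Z (s n) \<omega> - Z t \<omega>) (\<lambda>\<omega>. Z (s n) \<omega> - Z t \<omega>))"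
      using cov_le_sqrt[OF _ _ L2 L2_increment, of 0 "s n" t] by simp
    also have "\<dots> \<le> sqrt (C 0) * sqrt (D (s n - t))"
      using inc C0_nonneg by (intro mult_mono) (auto simp: cov_eq_C cov_self_nonneg)
    finally show ?thesis .
  qed
  have "(\<lambda>n. s n - t) \<longlonglongrightarrow> 0" using assms by (simp add: LIM_zero)
  from mean_square_continuous[OF this]
  have "(\<lambda>n. sqrt (C 0) * sqrt (D (s n - t))) \<longlonglongrightarrow> sqrt (C 0) * sqrt 0" by (intro tendsto_intros)
  then have "(\<lambda>n. sqrt (C 0) * sqrt (D (s n - t))) \<longlonglongrightarrow> 0" by simp
  moreover have "\<forall>\<^sub>F n in sequentially. norm (C (s n) - C t) \<le> sqrt (C 0) * sqrt (D (s n - t))"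
    using le by simp
  ultimately have "(\<lambda>n. C (s n) - C t) \<longlonglongrightarrow> 0" by (rule Lim_null_comparison[rotated])
  then show ?thesis by (simp add: LIM_zero_iff)
qed

end

section \<open>Lattices and half-open cubes\<close>

text \<open>
  Half-open cubes with corners in a lattice partition the space exactly, and \<open>grid_floor \<Delta> x\<close> is the
  corner of the cube of side \<open>1 / \<Delta>\<close> that contains \<open>x\<close>. A set is \<open>grid_aligned\<close> if it is a union of such
  cubes.
\<close>

definition hcube :: "real^'d \<Rightarrow> real \<Rightarrow> (real^'d) set" where
  "hcube a m = {x. \<forall>i. a $ i \<le> x $ i \<and> x $ i < a $ i + m}"

definition grid_floor :: "real \<Rightarrow> real^'d \<Rightarrow> real^'d" where
  "grid_floor \<Delta> x = (\<chi> i. of_int \<lfloor>\<Delta> * x $ i\<rfloor> / \<Delta>)"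

definition grid_aligned :: "real \<Rightarrow> (real^'d) set \<Rightarrow> bool" where
  "grid_aligned \<Delta> A \<longleftrightarrow> (\<forall>x. grid_floor \<Delta> x \<in> A \<longleftrightarrow> x \<in> A)"

lemma lattice_ptsI: "x = (\<chi> k. of_int (j k) / \<Delta>) \<Longrightarrow> x \<in> lattice_pts \<Delta>"
  by (auto simp: lattice_pts_def)

lemma grid_floor_in_lattice: "grid_floor \<Delta> x \<in> lattice_pts \<Delta>"
  by (auto simp: grid_floor_def lattice_pts_def)

lemma mem_hcube_lattice_iff:
  assumes "s \<in> lattice_pts \<Delta>" "0 < \<Delta>"
  shows "x \<in> hcube s (1 / \<Delta>) \<longleftrightarrow> grid_floor \<Delta> x = s"
proof -
  obtain j where s: "s = (\<chi> k. of_int (j k) / \<Delta>)" using assms(1) by (auto simp: lattice_pts_def)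
  have "(s $ i \<le> x $ i \<and> x $ i < s $ i + 1 / \<Delta>) \<longleftrightarrow> \<lfloor>\<Delta> * x $ i\<rfloor> = j i" for i
  proof -
    have "(s $ i \<le> x $ i \<and> x $ i < s $ i + 1 / \<Delta>) \<longleftrightarrow> (of_int (j i) \<le> \<Delta> * x $ i \<and> \<Delta> * x $ i < of_int (j i) + 1)"
      using assms(2) by (simp add: s field_simps)
    then show ?thesis by (simp add: floor_eq_iff)
  qed
  then show ?thesis
    using assms(2) by (auto simp: hcube_def grid_floor_def vec_eq_iff s)
qed

lemma hcube_borel[measurable]: "hcube a m \<in> sets borel"
proof -
  have "hcube a m = {x \<in> space borel. \<forall>i. a $ i \<le> x $ i \<and> x $ i < a $ i + m}"
    by (auto simp: hcube_def)
  also have "\<dots> \<in> sets borel" by measurable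
  finally show ?thesis .
qed

lemma hcube_subset_cbox: "hcube a m \<subseteq> cbox a (a + (\<chi> i. m))"
proof
  fix x assume "x \<in> hcube a m"
  then have "a $ i \<le> x $ i" "x $ i \<le> a $ i + m" for i by (simp_all add: hcube_def less_imp_le)
  then show "x \<in> cbox a (a + (\<chi> i. m))" by (simp add: mem_box_cart)
qed

lemma bounded_hcube: "bounded (hcube a m)"
  by (rule bounded_subset[OF bounded_cbox hcube_subset_cbox])

lemma measure_mono_bounded:
  fixes A B :: "'a::euclidean_space set"
  assumes "A \<subseteq> B" "A \<in> sets borel" "B \<in> sets borel" "bounded B"
  shows "measure lborel A \<le> measure lborel B"
  using assms emeasure_lborel_bounded[of B]
  by (intro measure_mono_fmeasurable) (auto simp: fmeasurable_def)

lemma measure_hcube: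
  assumes "0 \<le> m"
  shows "measure lborel (hcube (a::real^'d) m) = m ^ CARD('d)"
proof -
  define b :: "real^'d" where "b = a + (\<chi> i. m)"
  have "a \<in> cbox a b" using assms by (simp add: b_def mem_box_cart)
  then have ne: "cbox a b \<noteq> {}" by blast
  have c: "measure lborel (cbox a b) = m ^ CARD('d)"
    using content_cbox_cart[OF ne] by (simp add: b_def)
  have "measure lborel (box a b) = measure lborel (cbox a b)"
    by (simp add: measure_lborel_box_eq measure_lborel_cbox_eq)
  moreover have "box a b \<subseteq> hcube a m" by (auto simp: mem_box_cart b_def hcube_def less_imp_le)
  then have "measure lborel (box a b) \<le> measure lborel (hcube a m)"
    by (rule measure_mono_bounded) (auto simp: bounded_hcube)
  moreover have "measure lborel (hcube a m) \<le> measure lborel (cbox a b)"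
    by (rule measure_mono_bounded) (use hcube_subset_cbox in \<open>auto simp: b_def\<close>)
  ultimately show ?thesis using c by simp
qed

lemma grid_floor_measurable[measurable]: "grid_floor \<Delta> \<in> borel_measurable borel"
  unfolding grid_floor_def[abs_def]
  by (subst borel_measurable_euclidean_space) (auto simp: Basis_vec_def inner_axis)

lemma norm_grid_floor_le:
  fixes x :: "real^'d"
  assumes "0 < \<Delta>"
  shows "norm (grid_floor \<Delta> x - x) \<le> CARD('d) / \<Delta>"
proof -
  have "\<bar>(grid_floor \<Delta> x - x) $ i\<bar> \<le> 1 / \<Delta>" for i
  proof -
    have "of_int \<lfloor>\<Delta> * x $ i\<rfloor> / \<Delta> - x $ i = (of_int \<lfloor>\<Delta> * x $ i\<rfloor> - \<Delta> * x $ i) / \<Delta>"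
      using assms by (simp add: field_simps)
    moreover have "\<bar>of_int \<lfloor>\<Delta> * x $ i\<rfloor> - \<Delta> * x $ i\<bar> \<le> 1" by linarith
    ultimately show ?thesis using assms by (simp add: grid_floor_def divide_right_mono)
  qed
  then have "(\<Sum>i\<in>UNIV. \<bar>(grid_floor \<Delta> x - x) $ i\<bar>) \<le> (\<Sum>i\<in>(UNIV::'d set). 1 / \<Delta>)"
    by (intro sum_mono)
  then show ?thesis using norm_le_l1_cart[of "grid_floor \<Delta> x - x"] by simp
qed

lemma grid_floor_tendsto:
  fixes x :: "real^'d"
  assumes "\<And>n. 0 < \<Delta> n" "filterlim \<Delta> at_top sequentially"
  shows "(\<lambda>n. grid_floor (\<Delta> n) x) \<longlonglongrightarrow> x"
proof -
  have "(\<lambda>n. real CARD('d) / \<Delta> n) \<longlonglongrightarrow> 0"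
    by (intro tendsto_divide_0[OF tendsto_const] filterlim_at_top_imp_at_infinity assms(2))
  moreover have "\<forall>\<^sub>F n in sequentially. norm (grid_floor (\<Delta> n) x - x) \<le> real CARD('d) / \<Delta> n"
    by (intro always_eventually allI norm_grid_floor_le assms(1))
  ultimately have "(\<lambda>n. grid_floor (\<Delta> n) x - x) \<longlonglongrightarrow> 0" by (rule Lim_null_comparison[rotated])
  then show ?thesis by (simp add: LIM_zero_iff)
qed

lemma finite_lattice_Int:
  assumes "bounded A" "0 < \<Delta>"
  shows "finite (lattice_pts \<Delta> \<inter> A)"
proof -
  obtain B where B: "\<And>x. x \<in> A \<Longrightarrow> norm x \<le> B" using assms(1) by (auto simp: bounded_iff)
  define n where "n = \<lceil>\<Delta> * B\<rceil>"
  have "lattice_pts \<Delta> \<inter> A \<subseteq> (\<lambda>j. \<chi> k. of_int (j k) / \<Delta>) ` (UNIV \<rightarrow>\<^sub>E {-n..n})"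
  proof
    fix s assume s: "s \<in> lattice_pts \<Delta> \<inter> A"
    then obtain j where j: "s = (\<chi> k. of_int (j k) / \<Delta>)" by (auto simp: lattice_pts_def)
    have "j k \<in> {-n..n}" for k
    proof -
      have "\<bar>of_int (j k) / \<Delta>\<bar> \<le> B" using B[of s] s component_le_norm_cart[of s k] by (simp add: j)
      then have "\<Delta> * \<bar>of_int (j k) / \<Delta>\<bar> \<le> \<Delta> * B" using assms(2) by (intro mult_left_mono) auto
      moreover have "\<Delta> * \<bar>of_int (j k) / \<Delta>\<bar> = \<bar>of_int (j k)\<bar>" using assms(2) by (simp add: abs_divide)
      ultimately have "of_int \<bar>j k\<bar> \<le> (of_int n :: real)" unfolding n_def of_int_abs by linarith
      then have "\<bar>j k\<bar> \<le> n" by (simp only: of_int_le_iff)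
      then show ?thesis by auto
    qed
    then show "s \<in> (\<lambda>j. \<chi> k. of_int (j k) / \<Delta>) ` (UNIV \<rightarrow>\<^sub>E {-n..n})" using j by auto
  qed
  moreover have "finite ((UNIV :: 'a set) \<rightarrow>\<^sub>E {-n..n})" by (intro finite_PiE) auto
  ultimately show ?thesis using finite_subset by blast
qed

lemma grid_aligned_UN: "(\<And>c. c \<in> K \<Longrightarrow> grid_aligned \<Delta> (A c)) \<Longrightarrow> grid_aligned \<Delta> (\<Union>c\<in>K. A c)"
  by (auto simp: grid_aligned_def)

text \<open>
  With an integral corner, side and refinement \<open>k\<close>, the faces of the cube lie on the faces of the finer
  grid.
\<close>

lemma grid_aligned_hcube:
  fixes m k :: nat
  assumes "c \<in> lattice_pts 1" "0 < k"
  shows "grid_aligned (real k) (hcube c (real m))"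
proof -
  obtain j where c: "c = (\<chi> i. of_int (j i))" using assms(1) by (auto simp: lattice_pts_def)
  show ?thesis unfolding grid_aligned_def
  proof
    fix x :: "real^'a"
    have "(c $ i \<le> grid_floor k x $ i \<and> grid_floor k x $ i < c $ i + real m) \<longleftrightarrow> (c $ i \<le> x $ i \<and> x $ i < c $ i + real m)" for i
    proof -
      let ?f = "\<lfloor>real k * x $ i\<rfloor>"
      have 1: "c $ i \<le> grid_floor k x $ i \<longleftrightarrow> of_int (j i * int k) \<le> (of_int ?f :: real)"
        "grid_floor k x $ i < c $ i + real m \<longleftrightarrow> (of_int ?f :: real) < of_int ((j i + int m) * int k)"
        using assms(2) by (auto simp: c grid_floor_def field_simps)
      have 2: "c $ i \<le> x $ i \<longleftrightarrow> of_int (j i * int k) \<le> real k * x $ i"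
        "x $ i < c $ i + real m \<longleftrightarrow> real k * x $ i < of_int ((j i + int m) * int k)"
      proof -
        have k: "0 < real k" using assms(2) by simp
        show "c $ i \<le> x $ i \<longleftrightarrow> of_int (j i * int k) \<le> real k * x $ i"
          using mult_le_cancel_left_pos[OF k, of "c $ i" "x $ i"] by (simp add: c mult.commute)
        show "x $ i < c $ i + real m \<longleftrightarrow> real k * x $ i < of_int ((j i + int m) * int k)"
          using mult_less_cancel_left_pos[OF k, of "x $ i" "c $ i + real m"] by (simp add: c algebra_simps)
      qed
      show ?thesis unfolding 1 2 by (simp only: of_int_le_iff of_int_less_iff le_floor_iff floor_less_iff)
    qed
    then show "(grid_floor (real k) x \<in> hcube c (real m)) = (x \<in> hcube c (real m))"
      by (auto simp: hcube_def)
  qed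
qed

lemma lattice_pts_inverse_nat_subset:
  "lattice_pts (1 / real p) \<subseteq> (lattice_pts 1 :: (real^'d) set)"
proof
  fix x :: "real^'d" assume "x \<in> lattice_pts (1 / real p)"
  then obtain j where "x = (\<chi> k. of_int (j k) / (1 / real p))" by (auto simp: lattice_pts_def)
  then have "x = (\<chi> k. of_int (j k * int p) / 1)" by (simp add: vec_eq_iff)
  then show "x \<in> lattice_pts 1" by (rule lattice_ptsI)
qed

lemma lattice_pts_add: "x \<in> lattice_pts \<Delta> \<Longrightarrow> y \<in> lattice_pts \<Delta> \<Longrightarrow> x + y \<in> lattice_pts \<Delta>"
proof -
  assume "x \<in> lattice_pts \<Delta>" "y \<in> lattice_pts \<Delta>"
  then obtain i j where "x = (\<chi> k. of_int (i k) / \<Delta>)" "y = (\<chi> k. of_int (j k) / \<Delta>)"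
    by (auto simp: lattice_pts_def)
  then have "x + y = (\<chi> k. of_int (i k + j k) / \<Delta>)" by (simp add: vec_eq_iff add_divide_distrib)
  then show "x + y \<in> lattice_pts \<Delta>" by (rule lattice_ptsI)
qed

lemma lattice_pts_minus: "x \<in> lattice_pts \<Delta> \<Longrightarrow> - x \<in> lattice_pts \<Delta>"
proof -
  assume "x \<in> lattice_pts \<Delta>"
  then obtain i where "x = (\<chi> k. of_int (i k) / \<Delta>)"
    by (auto simp: lattice_pts_def)
  then have "- x = (\<chi> k. of_int (- i k) / \<Delta>)" by (simp add: vec_eq_iff)
  then show "- x \<in> lattice_pts \<Delta>" by (rule lattice_ptsI)
qed

lemma lattice_pts_1_subset:
  assumes "0 < k" shows "lattice_pts 1 \<subseteq> (lattice_pts (real k) :: (real^'d) set)"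
proof
  fix x :: "real^'d" assume "x \<in> lattice_pts 1"
  then obtain j where "x = (\<chi> k. of_int (j k) / 1)" by (auto simp: lattice_pts_def)
  then have "x = (\<chi> i. of_int (j i * int k) / real k)" using assms by (simp add: vec_eq_iff)
  then show "x \<in> lattice_pts (real k)" by (rule lattice_ptsI)
qed

lemma lattice_Int_hcube_translate:
  assumes "c \<in> lattice_pts \<Delta>"
  shows "lattice_pts \<Delta> \<inter> hcube c m = (\<lambda>s. s + c) ` (lattice_pts \<Delta> \<inter> hcube 0 m)"
proof (intro set_eqI iffI)
  fix x assume x: "x \<in> lattice_pts \<Delta> \<inter> hcube c m"
  have "x - c \<in> lattice_pts \<Delta> \<inter> hcube 0 m"
    using x lattice_pts_add[OF _ lattice_pts_minus[OF assms], of x] by (auto simp: hcube_def algebra_simps)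
  then show "x \<in> (\<lambda>s. s + c) ` (lattice_pts \<Delta> \<inter> hcube 0 m)" by (auto intro!: image_eqI[of _ _ "x - c"])
next
  fix x assume "x \<in> (\<lambda>s. s + c) ` (lattice_pts \<Delta> \<inter> hcube 0 m)"
  then show "x \<in> lattice_pts \<Delta> \<inter> hcube c m"
    using lattice_pts_add[OF _ assms] by (auto simp: hcube_def algebra_simps)
qed

text \<open>
  Two different corners differ by at least one grid step in some coordinate, so that cubes which
  leave free a corridor of width \<open>r\<close> are at distance at least \<open>r\<close>.
\<close>

lemma hcube_separated:
  fixes m r :: nat
  assumes c: "c \<in> lattice_pts (1 / real (m + r))" "c' \<in> lattice_pts (1 / real (m + r))" "c \<noteq> c'"
    and x: "x \<in> hcube c (real m)" and y: "y \<in> hcube c' (real m)"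
  shows "\<exists>i. real r < \<bar>x $ i - y $ i\<bar>"
proof -
  obtain j j' where j: "c = (\<chi> k. of_int (j k) / (1 / real (m + r)))" "c' = (\<chi> k. of_int (j' k) / (1 / real (m + r)))"
    using c by (auto simp: lattice_pts_def)
  obtain i where i: "j i \<noteq> j' i" using c(3) j by (auto simp: vec_eq_iff)
  have c1: "c $ i = of_int (j i) * real (m + r)" "c' $ i = of_int (j' i) * real (m + r)" by (simp_all add: j)
  have xy: "c $ i \<le> x $ i" "x $ i < c $ i + m" "c' $ i \<le> y $ i" "y $ i < c' $ i + m"
    using x y by (auto simp: hcube_def)
  consider "j i + 1 \<le> j' i" | "j' i + 1 \<le> j i" using i by linarith
  then show ?thesis
  proof cases
    case 1
    then have "of_int (j i + 1) * real (m + r) \<le> of_int (j' i) * real (m + r)"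
      by (intro mult_right_mono) (auto simp del: of_int_add)
    then show ?thesis using xy by (intro exI[of _ i]) (simp add: c1 algebra_simps)
  next
    case 2
    then have "of_int (j' i + 1) * real (m + r) \<le> of_int (j i) * real (m + r)"
      by (intro mult_right_mono) (auto simp del: of_int_add)
    then show ?thesis using xy by (intro exI[of _ i]) (simp add: c1 algebra_simps)
  qed
qed

lemma hcube_disjoint:
  assumes "c \<in> lattice_pts (1 / real (m + r))" "c' \<in> lattice_pts (1 / real (m + r))" "c \<noteq> c'"
  shows "hcube c (real m) \<inter> hcube c' (real m) = {}"
  using hcube_separated[OF assms] by force

text \<open>
  The integrand is constant on every cell of the grid: a Riemann sum over an aligned set is an
  integral, with no boundary terms.
\<close>

lemma integral_grid_floor:
  fixes F :: "real^'d \<Rightarrow> real"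
  assumes A: "A \<in> sets borel" "bounded A" "grid_aligned \<Delta> A" and \<Delta>: "0 < \<Delta>"
  shows "(LINT t:A|lborel. F (grid_floor \<Delta> t)) = (1 / \<Delta>) ^ CARD('d) * (\<Sum>s\<in>lattice_pts \<Delta> \<inter> A. F s)"
    and "set_integrable lborel A (\<lambda>t. F (grid_floor \<Delta> t))"
proof -
  let ?G = "lattice_pts \<Delta> \<inter> A"
  have fin: "finite ?G" using A \<Delta> by (intro finite_lattice_Int)
  have eq: "indicator A t * F (grid_floor \<Delta> t) = (\<Sum>s\<in>?G. F s * indicator (hcube s (1 / \<Delta>)) t)" for t
  proof -
    have "(\<Sum>s\<in>?G. F s * indicator (hcube s (1 / \<Delta>)) t) = (\<Sum>s\<in>?G. if s = grid_floor \<Delta> t then F s else 0)"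
      using \<Delta> by (intro sum.cong) (auto simp: mem_hcube_lattice_iff indicator_def)
    also have "\<dots> = (if grid_floor \<Delta> t \<in> ?G then F (grid_floor \<Delta> t) else 0)"
      using fin by simp
    also have "\<dots> = indicator A t * F (grid_floor \<Delta> t)"
      using A(3) grid_floor_in_lattice[of \<Delta> t] by (auto simp: grid_aligned_def)
    finally show ?thesis ..
  qed
  have i: "integrable lborel (\<lambda>t. F s * indicator (hcube s (1 / \<Delta>)) t)" for s
    using emeasure_lborel_bounded[OF bounded_hcube] by (intro integrable_mult_right) (auto intro!: integrable_real_indicator)
  show "set_integrable lborel A (\<lambda>t. F (grid_floor \<Delta> t))"
    using i by (simp add: set_integrable_def eq)
  have "(LINT t:A|lborel. F (grid_floor \<Delta> t)) = (\<Sum>s\<in>?G. \<integral>t. F s * indicator (hcube s (1 / \<Delta>)) t \<partial>lborel)"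
    using i by (simp add: set_lebesgue_integral_def eq)
  also have "\<dots> = (\<Sum>s\<in>?G. F s * (1 / \<Delta>) ^ CARD('d))"
    using \<Delta> by (simp add: measure_hcube)
  finally show "(LINT t:A|lborel. F (grid_floor \<Delta> t)) = (1 / \<Delta>) ^ CARD('d) * (\<Sum>s\<in>?G. F s)"
    by (simp only: sum_distrib_right[symmetric] mult.commute)
qed

lemma card_lattice_Int:
  fixes A :: "(real^'d) set"
  assumes "A \<in> sets borel" "bounded A" "grid_aligned \<Delta> A" "0 < \<Delta>"
  shows "(1 / \<Delta>) ^ CARD('d) * real (card (lattice_pts \<Delta> \<inter> A)) = measure lborel A"
  using integral_grid_floor(1)[OF assms, of "\<lambda>_. 1"] emeasure_lborel_bounded[OF assms(2)] assms(1)
  by (simp add: set_lebesgue_integral_def)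


section \<open>Riemann sums of a field\<close>

context L2_field begin

definition S :: "(real^'d) set \<Rightarrow> 'w \<Rightarrow> real" where
  "S A \<omega> = (LINT t:A|lborel. Z t \<omega>)"

definition riemann :: "real \<Rightarrow> (real^'d) set \<Rightarrow> 'w \<Rightarrow> real" where
  "riemann \<Delta> A \<omega> = (\<Sum>s\<in>lattice_pts \<Delta> \<inter> A. (1 / \<Delta>) ^ CARD('d) * Z s \<omega>)"

lemma S_measurable[measurable]: "A \<in> sets borel \<Longrightarrow> S A \<in> borel_measurable M"
proof -
  assume [measurable]: "A \<in> sets borel"
  show ?thesis unfolding S_def[abs_def] set_lebesgue_integral_def by measurable
qed

lemma riemann_measurable[measurable]: "riemann \<Delta> A \<in> borel_measurable M"
  unfolding riemann_def[abs_def] by measurable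

lemma S_eq:
  "A \<in> sets borel \<Longrightarrow> \<omega> \<in> space M \<Longrightarrow> S A \<omega> = (\<integral>t. Z t \<omega> \<partial>lborel_on A)"
  unfolding S_def by (subst integral_lborel_on) auto

lemma Z_process:
  assumes "A \<in> sets borel" "bounded A"
  shows "L2_process M (lborel_on A) (\<lambda>t \<omega>. Z t \<omega> - c) (expectation (\<lambda>\<omega>. (Z 0 \<omega> - c)\<^sup>2))"
proof -
  interpret A: finite_measure "lborel_on A"
    by (rule finite_measure_lborel_on) (use assms in \<open>auto intro: emeasure_lborel_bounded\<close>)
  show ?thesis
  proof
    show "(\<lambda>(\<omega>, t). Z t \<omega> - c) \<in> borel_measurable (M \<Otimes>\<^sub>M lborel_on A)" by measurable
    show "integrable M (\<lambda>\<omega>. (Z t \<omega> - c)\<^sup>2)" for t by (intro L2_diff L2) auto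
    show "expectation (\<lambda>\<omega>. (Z t \<omega> - c)\<^sup>2) \<le> expectation (\<lambda>\<omega>. (Z 0 \<omega> - c)\<^sup>2)" for t
      using law1[of "\<lambda>x. (x - c)\<^sup>2" t] by simp
  qed
qed

text \<open>
  The error is the integral of the increments \<open>Z (grid_floor \<Delta> t) - Z t\<close>, whose first moments tend to zero
  by mean square continuity and are bounded uniformly in \<open>t\<close>.
\<close>

lemma riemann_L1:
  assumes A: "A \<in> sets borel" "bounded A" and al: "\<And>n. grid_aligned (\<Delta> n) A" "\<And>n. 0 < \<Delta> n"
    and \<Delta>: "filterlim \<Delta> at_top sequentially"
  shows "(\<lambda>n. expectation (\<lambda>\<omega>. \<bar>riemann (\<Delta> n) A \<omega> - S A \<omega>\<bar>)) \<longlonglongrightarrow> 0"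
proof -
  interpret A: finite_measure "lborel_on A"
    by (rule finite_measure_lborel_on) (use A in \<open>auto intro: emeasure_lborel_bounded\<close>)
  interpret P: L2_process M "lborel_on A" "\<lambda>t \<omega>. Z t \<omega> - 0" "expectation (\<lambda>\<omega>. (Z 0 \<omega> - 0)\<^sup>2)"
    by (rule Z_process[OF A])
  define Y where "Y n t \<omega> = Z (grid_floor (\<Delta> n) t) \<omega> - Z t \<omega>" for n t \<omega>
  have Ym[measurable]: "(\<lambda>(\<omega>, t). Y n t \<omega>) \<in> borel_measurable (M \<Otimes>\<^sub>M borel)" for n
    unfolding Y_def by measurable
  have YL2: "integrable M (\<lambda>\<omega>. (Y n t \<omega>)\<^sup>2)" and YE: "expectation (\<lambda>\<omega>. (Y n t \<omega>)\<^sup>2) = D (grid_floor (\<Delta> n) t - t)" for n t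
    unfolding Y_def using L2_increment D_shift by auto
  have Db: "D h \<le> 4 * m2" for h
  proof -
    have "(Z h \<omega> - Z 0 \<omega>)\<^sup>2 \<le> 2 * (Z h \<omega>)\<^sup>2 + 2 * (Z 0 \<omega>)\<^sup>2" for \<omega>
      using zero_le_power2[of "Z h \<omega> + Z 0 \<omega>"] by (simp add: power2_eq_square algebra_simps)
    then have "D h \<le> expectation (\<lambda>\<omega>. 2 * (Z h \<omega>)\<^sup>2 + 2 * (Z 0 \<omega>)\<^sup>2)"
      unfolding D_def by (intro integral_mono L2_increment) (use L2 in auto)
    then show ?thesis using L2 by (simp add: second_moment)
  qed
  have proc: "L2_process M (lborel_on A) (Y n) (4 * m2)" for n
    by standard (use YL2 YE Db in auto)
  have le: "expectation (\<lambda>\<omega>. \<bar>riemann (\<Delta> n) A \<omega> - S A \<omega>\<bar>) \<le> (\<integral>t. expectation (\<lambda>\<omega>. \<bar>Y n t \<omega>\<bar>) \<partial>lborel_on A)" for n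
  proof -
    interpret Y: L2_process M "lborel_on A" "Y n" "4 * m2" by (rule proc)
    have "AE \<omega> in M. riemann (\<Delta> n) A \<omega> - S A \<omega> = (\<integral>t. Y n t \<omega> \<partial>lborel_on A)"
      using P.AE_integrable AE_space
    proof eventually_elim
      fix \<omega> assume i: "integrable (lborel_on A) (\<lambda>t. Z t \<omega> - 0)" and [measurable]: "\<omega> \<in> space M"
      have r: "riemann (\<Delta> n) A \<omega> = (\<integral>t. Z (grid_floor (\<Delta> n) t) \<omega> \<partial>lborel_on A)"
        unfolding riemann_def sum_distrib_left[symmetric]
        using A al[of n] by (subst integral_grid_floor(1)[symmetric]) (auto simp: integral_lborel_on)
      have i2: "integrable (lborel_on A) (\<lambda>t. Z (grid_floor (\<Delta> n) t) \<omega>)"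
        using A al[of n] by (subst integrable_lborel_on) (auto intro!: integral_grid_floor(2))
      show "riemann (\<Delta> n) A \<omega> - S A \<omega> = (\<integral>t. Y n t \<omega> \<partial>lborel_on A)"
        using i i2 A \<open>\<omega> \<in> space M\<close> unfolding r Y_def by (simp add: S_eq)
    qed
    then have "expectation (\<lambda>\<omega>. \<bar>riemann (\<Delta> n) A \<omega> - S A \<omega>\<bar>) = expectation (\<lambda>\<omega>. \<bar>\<integral>t. Y n t \<omega> \<partial>lborel_on A\<bar>)"
      using A by (intro integral_cong_AE) auto
    then show ?thesis using Y.expectation_abs_integral_le by simp
  qed
  have "(\<lambda>n. \<integral>t. expectation (\<lambda>\<omega>. \<bar>Y n t \<omega>\<bar>) \<partial>lborel_on A) \<longlonglongrightarrow> (\<integral>t. 0 \<partial>lborel_on A)"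
  proof (rule integral_dominated_convergence[where w="\<lambda>_. sqrt (4 * m2)"])
    have EY: "expectation (\<lambda>\<omega>. \<bar>Y n t \<omega>\<bar>) \<le> sqrt (D (grid_floor (\<Delta> n) t - t))" for n t
      unfolding YE[symmetric] by (rule expectation_abs_le_L2[OF _ YL2]) (simp add: Y_def[abs_def])
    then show "AE t in lborel_on A. norm (expectation (\<lambda>\<omega>. \<bar>Y n t \<omega>\<bar>)) \<le> sqrt (4 * m2)" for n
      using Db by (auto intro!: AE_I2 order_trans[OF EY])
    show "AE t in lborel_on A. (\<lambda>n. expectation (\<lambda>\<omega>. \<bar>Y n t \<omega>\<bar>)) \<longlonglongrightarrow> 0"
    proof (rule AE_I2)
      fix t :: "real^'d"
      have "(\<lambda>n. grid_floor (\<Delta> n) t - t) \<longlonglongrightarrow> 0"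
        using grid_floor_tendsto[OF al(2) \<Delta>] by (rule LIM_zero)
      from mean_square_continuous[OF this]
      have "(\<lambda>n. sqrt (D (grid_floor (\<Delta> n) t - t))) \<longlonglongrightarrow> sqrt 0" by (intro tendsto_intros)
      then have "(\<lambda>n. sqrt (D (grid_floor (\<Delta> n) t - t))) \<longlonglongrightarrow> 0" by simp
      then show "(\<lambda>n. expectation (\<lambda>\<omega>. \<bar>Y n t \<omega>\<bar>)) \<longlonglongrightarrow> 0"
        by (rule Lim_null_comparison[rotated]) (use EY in auto)
    qed
  qed (auto simp: Y_def)
  then have "(\<lambda>n. \<integral>t. expectation (\<lambda>\<omega>. \<bar>Y n t \<omega>\<bar>) \<partial>lborel_on A) \<longlonglongrightarrow> 0" by simp
  then show ?thesis by (rule Lim_null_comparison[rotated]) (use le in auto)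
qed

end

section \<open>Bounded Lipschitz functions of approximated variables\<close>

text \<open>
  The functions of interest are shifted and scaled sines and cosines. Fixing the bound one and keeping only
  the Lipschitz constant variable is all that they need.
\<close>

definition bdd_lipschitz :: "real \<Rightarrow> (real \<Rightarrow> real) \<Rightarrow> bool" where
  "bdd_lipschitz L \<phi> \<longleftrightarrow> (\<forall>x. \<bar>\<phi> x\<bar> \<le> 1) \<and> (\<forall>x y. \<bar>\<phi> x - \<phi> y\<bar> \<le> L * \<bar>x - y\<bar>)"

lemma bdd_lipschitzD:
  assumes "bdd_lipschitz L \<phi>"
  shows "\<bar>\<phi> x\<bar> \<le> 1" "\<bar>\<phi> x - \<phi> y\<bar> \<le> L * \<bar>x - y\<bar>" "0 \<le> L" "\<phi> \<in> borel_measurable borel"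
proof -
  show "\<bar>\<phi> x\<bar> \<le> 1" "\<bar>\<phi> x - \<phi> y\<bar> \<le> L * \<bar>x - y\<bar>" for x y
    using assms by (auto simp: bdd_lipschitz_def)
  from this(2)[of 1 0] show L: "0 \<le> L" by simp
  have "L-lipschitz_on UNIV \<phi>"
    by (rule lipschitz_onI) (use assms L in \<open>auto simp: bdd_lipschitz_def dist_real_def\<close>)
  then show "\<phi> \<in> borel_measurable borel"
    by (intro borel_measurable_continuous_onI lipschitz_on_continuous_on)
qed

context prob_space begin

text \<open>
  The difference of two products of bounded functions is split by changing one factor at a time.
\<close>

lemma tendsto_cov_lipschitz:
  assumes \<phi>: "bdd_lipschitz L \<phi>" and \<psi>: "bdd_lipschitz L' \<psi>"
    and [measurable]: "\<And>n. U n \<in> borel_measurable M" "Y \<in> borel_measurable M"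
      "\<And>n. V n \<in> borel_measurable M" "X \<in> borel_measurable M"
    and iU: "\<And>n. integrable M (U n)" "integrable M Y" and iV: "\<And>n. integrable M (V n)" "integrable M X"
    and U: "(\<lambda>n. expectation (\<lambda>\<omega>. \<bar>U n \<omega> - Y \<omega>\<bar>)) \<longlonglongrightarrow> 0"
    and V: "(\<lambda>n. expectation (\<lambda>\<omega>. \<bar>V n \<omega> - X \<omega>\<bar>)) \<longlonglongrightarrow> 0"
  shows "(\<lambda>n. expectation (\<lambda>\<omega>. \<phi> (U n \<omega>))) \<longlonglongrightarrow> expectation (\<lambda>\<omega>. \<phi> (Y \<omega>))"
    and "(\<lambda>n. cov M (\<lambda>\<omega>. \<phi> (U n \<omega>)) (\<lambda>\<omega>. \<psi> (V n \<omega>))) \<longlonglongrightarrow> cov M (\<lambda>\<omega>. \<phi> (Y \<omega>)) (\<lambda>\<omega>. \<psi> (X \<omega>))"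
proof -
  note f = bdd_lipschitzD[OF \<phi>] and g = bdd_lipschitzD[OF \<psi>]
  note [measurable] = f(4) g(4)
  have ib: "integrable M W" if [measurable]: "W \<in> borel_measurable M" and "\<And>x. \<bar>W x\<bar> \<le> 1" for W :: "'a \<Rightarrow> real"
    by (rule integrable_const_bound[where B=1]) (use that in auto)
  have one: "(\<lambda>n. expectation (\<lambda>\<omega>. \<phi> (U n \<omega>))) \<longlonglongrightarrow> expectation (\<lambda>\<omega>. \<phi> (Y \<omega>))"
    if \<phi>: "bdd_lipschitz L \<phi>" and [measurable]: "\<And>n. U n \<in> borel_measurable M" "Y \<in> borel_measurable M"
      and iU: "\<And>n. integrable M (U n)" "integrable M Y"
      and U: "(\<lambda>n. expectation (\<lambda>\<omega>. \<bar>U n \<omega> - Y \<omega>\<bar>)) \<longlonglongrightarrow> 0" for L \<phi> U Y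
  proof -
    note f = bdd_lipschitzD[OF \<phi>]
    note [measurable] = f(4)
    have "norm (expectation (\<lambda>\<omega>. \<phi> (U n \<omega>)) - expectation (\<lambda>\<omega>. \<phi> (Y \<omega>))) \<le> L * expectation (\<lambda>\<omega>. \<bar>U n \<omega> - Y \<omega>\<bar>)" for n
    proof -
      have "expectation (\<lambda>\<omega>. \<phi> (U n \<omega>)) - expectation (\<lambda>\<omega>. \<phi> (Y \<omega>)) = expectation (\<lambda>\<omega>. \<phi> (U n \<omega>) - \<phi> (Y \<omega>))"
        by (rule Bochner_Integration.integral_diff[symmetric]) (rule ib, simp, rule f)+
      also have "norm \<dots> \<le> expectation (\<lambda>\<omega>. norm (\<phi> (U n \<omega>) - \<phi> (Y \<omega>)))" by (rule integral_norm_bound)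
      also have "\<dots> \<le> expectation (\<lambda>\<omega>. L * \<bar>U n \<omega> - Y \<omega>\<bar>)"
      proof (rule integral_mono)
        show "integrable M (\<lambda>\<omega>. norm (\<phi> (U n \<omega>) - \<phi> (Y \<omega>)))"
          by (intro integrable_norm Bochner_Integration.integrable_diff) (rule ib, simp, rule f)+
      qed (use f iU in auto)
      finally show ?thesis by simp
    qed
    moreover have "(\<lambda>n. L * expectation (\<lambda>\<omega>. \<bar>U n \<omega> - Y \<omega>\<bar>)) \<longlonglongrightarrow> 0"
      using tendsto_mult_left[OF U, of L] by simp
    ultimately show ?thesis
      by (subst LIM_zero_iff[symmetric]) (rule Lim_null_comparison[rotated], auto)
  qed
  show 1: "(\<lambda>n. expectation (\<lambda>\<omega>. \<phi> (U n \<omega>))) \<longlonglongrightarrow> expectation (\<lambda>\<omega>. \<phi> (Y \<omega>))"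
    by (rule one[OF \<phi> _ _ iU U]) simp_all
  have 2: "(\<lambda>n. expectation (\<lambda>\<omega>. \<psi> (V n \<omega>))) \<longlonglongrightarrow> expectation (\<lambda>\<omega>. \<psi> (X \<omega>))"
    by (rule one[OF \<psi> _ _ iV V]) simp_all
  have pb: "\<bar>\<phi> x * \<psi> y\<bar> \<le> 1" for x y
    using mult_mono[OF f(1)[of x] g(1)[of y]] by (simp add: abs_mult)
  have "norm (expectation (\<lambda>\<omega>. \<phi> (U n \<omega>) * \<psi> (V n \<omega>)) - expectation (\<lambda>\<omega>. \<phi> (Y \<omega>) * \<psi> (X \<omega>)))
      \<le> L * expectation (\<lambda>\<omega>. \<bar>U n \<omega> - Y \<omega>\<bar>) + L' * expectation (\<lambda>\<omega>. \<bar>V n \<omega> - X \<omega>\<bar>)" for n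
  proof -
    have "expectation (\<lambda>\<omega>. \<phi> (U n \<omega>) * \<psi> (V n \<omega>)) - expectation (\<lambda>\<omega>. \<phi> (Y \<omega>) * \<psi> (X \<omega>))
       = expectation (\<lambda>\<omega>. \<phi> (U n \<omega>) * \<psi> (V n \<omega>) - \<phi> (Y \<omega>) * \<psi> (X \<omega>))"
      by (rule Bochner_Integration.integral_diff[symmetric]) (rule ib, simp, rule pb)+
    also have "norm \<dots> \<le> expectation (\<lambda>\<omega>. norm (\<phi> (U n \<omega>) * \<psi> (V n \<omega>) - \<phi> (Y \<omega>) * \<psi> (X \<omega>)))"
      by (rule integral_norm_bound)
    also have "\<dots> \<le> expectation (\<lambda>\<omega>. L * \<bar>U n \<omega> - Y \<omega>\<bar> + L' * \<bar>V n \<omega> - X \<omega>\<bar>)"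
    proof (rule integral_mono)
      fix \<omega>
      have "\<phi> (U n \<omega>) * \<psi> (V n \<omega>) - \<phi> (Y \<omega>) * \<psi> (X \<omega>)
          = (\<phi> (U n \<omega>) - \<phi> (Y \<omega>)) * \<psi> (V n \<omega>) + \<phi> (Y \<omega>) * (\<psi> (V n \<omega>) - \<psi> (X \<omega>))" by (simp add: algebra_simps)
      also have "\<bar>\<dots>\<bar> \<le> \<bar>\<phi> (U n \<omega>) - \<phi> (Y \<omega>)\<bar> * \<bar>\<psi> (V n \<omega>)\<bar> + \<bar>\<phi> (Y \<omega>)\<bar> * \<bar>\<psi> (V n \<omega>) - \<psi> (X \<omega>)\<bar>"
        by (rule order_trans[OF abs_triangle_ineq]) (simp add: abs_mult)
      also have "\<dots> \<le> (L * \<bar>U n \<omega> - Y \<omega>\<bar>) * 1 + 1 * (L' * \<bar>V n \<omega> - X \<omega>\<bar>)"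
        by (intro add_mono mult_mono f g) (use f(3) in auto)
      finally show "norm (\<phi> (U n \<omega>) * \<psi> (V n \<omega>) - \<phi> (Y \<omega>) * \<psi> (X \<omega>)) \<le> L * \<bar>U n \<omega> - Y \<omega>\<bar> + L' * \<bar>V n \<omega> - X \<omega>\<bar>"
        by simp
    next
      show "integrable M (\<lambda>\<omega>. norm (\<phi> (U n \<omega>) * \<psi> (V n \<omega>) - \<phi> (Y \<omega>) * \<psi> (X \<omega>)))"
        by (intro integrable_norm Bochner_Integration.integrable_diff) (rule ib, simp, rule pb)+
    qed (use iU iV in auto)
    finally show ?thesis using iU iV by simp
  qed
  moreover have "(\<lambda>n. L * expectation (\<lambda>\<omega>. \<bar>U n \<omega> - Y \<omega>\<bar>) + L' * expectation (\<lambda>\<omega>. \<bar>V n \<omega> - X \<omega>\<bar>)) \<longlonglongrightarrow> 0"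
    using tendsto_add[OF tendsto_mult_left[OF U, of L] tendsto_mult_left[OF V, of L']] by simp
  ultimately have 3: "(\<lambda>n. expectation (\<lambda>\<omega>. \<phi> (U n \<omega>) * \<psi> (V n \<omega>))) \<longlonglongrightarrow> expectation (\<lambda>\<omega>. \<phi> (Y \<omega>) * \<psi> (X \<omega>))"
    by (subst LIM_zero_iff[symmetric]) (rule Lim_null_comparison[rotated], auto)
  have c: "cov M (\<lambda>\<omega>. \<phi> (A \<omega>)) (\<lambda>\<omega>. \<psi> (B \<omega>))
      = expectation (\<lambda>\<omega>. \<phi> (A \<omega>) * \<psi> (B \<omega>)) - expectation (\<lambda>\<omega>. \<phi> (A \<omega>)) * expectation (\<lambda>\<omega>. \<psi> (B \<omega>))"
    if [measurable]: "A \<in> borel_measurable M" "B \<in> borel_measurable M" for A B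
    by (rule cov_eq) (use f g in \<open>auto intro!: L2_bounded[where B=1]\<close>)
  show "(\<lambda>n. cov M (\<lambda>\<omega>. \<phi> (U n \<omega>)) (\<lambda>\<omega>. \<psi> (V n \<omega>))) \<longlonglongrightarrow> cov M (\<lambda>\<omega>. \<phi> (Y \<omega>)) (\<lambda>\<omega>. \<psi> (X \<omega>))"
    using 1 2 3 by (simp add: c tendsto_intros)
qed

end


section \<open>Integrals of a field over cubes\<close>

text \<open>Power decay beyond the dimension is integrable at infinity: compare with dyadic shells.\<close>

lemma integrable_power_decay:
  fixes K c \<epsilon> :: real
  assumes "0 < \<epsilon>" "0 \<le> c" "0 \<le> K"
  shows "integrable lborel (\<lambda>t::real^'d. if infnorm t \<le> 1 then K else c * infnorm t powr (- real CARD('d) - \<epsilon>))"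
    (is "integrable lborel ?f")
proof -
  let ?d = "real CARD('d)"
  define Q where "Q k = (cbox (\<chi> i. - (2 ^ k)) (\<chi> i. 2 ^ k) :: (real^'d) set)" for k :: nat
  have inQ: "t \<in> Q k" if "infnorm t \<le> 2 ^ k" for t k
    using order_trans[OF component_le_infnorm_cart that] unfolding Q_def mem_box_cart by (auto simp: abs_le_iff minus_le_iff)
  have mQ: "measure lborel (Q k) = (2 * 2 ^ k) ^ CARD('d)" for k
  proof -
    have "0 \<in> Q k" by (simp add: Q_def mem_box_cart)
    then have "Q k \<noteq> {}" by blast
    then show ?thesis unfolding Q_def by (subst content_cbox_cart) auto
  qed
  have iQ: "integrable lborel (\<lambda>t. a * indicator (Q k) t)" for a :: real and k
    using emeasure_lborel_bounded[of "Q k"]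
    by (intro integrable_mult_right integrable_real_indicator) (auto simp: Q_def)
  define F where "F k t = c * (2 ^ k) powr (- ?d - \<epsilon>) * indicator (Q (Suc k)) t" for k t
  have F0: "0 \<le> F k t" for k t using assms by (simp add: F_def)
  have powk: "(2 ^ k) powr (- ?d - \<epsilon>) = (2 powr (- ?d - \<epsilon>)) ^ k" for k :: nat
    by (simp add: powr_realpow[symmetric] powr_powr mult.commute)
  have geo: "\<bar>2 powr (- ?d - \<epsilon>)\<bar> < (1::real)" "\<bar>2 powr (- \<epsilon>)\<bar> < (1::real)"
    using assms(1) powr_less_mono[of "- ?d - \<epsilon>" 0 2] powr_less_mono[of "- \<epsilon>" 0 2] by auto
  have "integrable lborel (\<lambda>t. K * indicator (Q 0) t + (\<Sum>k. F k t))"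
  proof (intro Bochner_Integration.integrable_add iQ integrable_suminf)
    show "integrable lborel (F k)" for k unfolding F_def by (rule iQ)
    show "AE t in lborel. summable (\<lambda>k. norm (F k t))"
    proof (rule AE_I2, rule summable_comparison_test')
      show "summable (\<lambda>k. c * (2 powr (- ?d - \<epsilon>)) ^ k)"
        using geo by (intro summable_mult summable_geometric) simp
      show "norm (norm (F k t)) \<le> c * (2 powr (- ?d - \<epsilon>)) ^ k" for k t
        unfolding powk[symmetric] using assms by (simp add: F_def abs_mult indicator_def)
    qed
    have "(\<integral>t. norm (F k t) \<partial>lborel) = (c * 4 ^ CARD('d)) * (2 powr (- \<epsilon>)) ^ k" for k
    proof -
      have "(\<integral>t. norm (F k t) \<partial>lborel) = (\<integral>t. (c * (2 ^ k) powr (- ?d - \<epsilon>)) * indicator (Q (Suc k)) t \<partial>lborel)"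
        using F0 by (simp add: F_def)
      also have "\<dots> = (c * (2 ^ k) powr (- ?d - \<epsilon>)) * (2 * 2 ^ Suc k) ^ CARD('d)"
        unfolding mQ[symmetric] by (subst integral_mult_right_zero) (simp add: Q_def)
      also have "(2 * 2 ^ Suc k :: real) ^ CARD('d) = 4 ^ CARD('d) * (2 ^ k) powr ?d"
        by (simp add: powr_realpow power_mult_distrib)
      also have "c * (2 ^ k) powr (- ?d - \<epsilon>) * (4 ^ CARD('d) * (2 ^ k) powr ?d)
          = c * 4 ^ CARD('d) * (2 ^ k) powr (- \<epsilon>)"
        by (simp add: powr_add[symmetric])
      also have "(2 ^ k) powr (- \<epsilon>) = (2 powr (- \<epsilon>)) ^ k"
        by (simp add: powr_realpow[symmetric] powr_powr mult.commute)
      finally show ?thesis .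
    qed
    then show "summable (\<lambda>k. \<integral>t. norm (F k t) \<partial>lborel)"
      using geo by (simp only:) (intro summable_mult summable_geometric, simp)
  qed
  then show ?thesis
  proof (rule Bochner_Integration.integrable_bound)
    have [measurable]: "(infnorm :: real^'d \<Rightarrow> real) \<in> borel_measurable borel"
      by (intro borel_measurable_continuous_onI continuous_at_imp_continuous_on ballI continuous_infnorm continuous_ident)
    show "?f \<in> borel_measurable lborel" by measurable
    have "norm (?f t) \<le> norm (K * indicator (Q 0) t + (\<Sum>k. F k t))" for t
    proof -
      have sm: "summable (\<lambda>k. F k t)"
      proof (rule summable_comparison_test')
        show "summable (\<lambda>k. c * (2 powr (- ?d - \<epsilon>)) ^ k)"
          using geo by (intro summable_mult summable_geometric) simp
        show "norm (F k t) \<le> c * (2 powr (- ?d - \<epsilon>)) ^ k" for k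
          unfolding powk[symmetric] using assms by (simp add: F_def abs_mult indicator_def)
      qed
      have S0: "0 \<le> (\<Sum>k. F k t)" using F0 sm by (intro suminf_nonneg) auto
      show ?thesis
      proof (cases "infnorm t \<le> 1")
        case True
        then have "t \<in> Q 0" by (intro inQ) simp
        then show ?thesis using True S0 assms by simp
      next
        case False
        obtain k where k: "2 ^ k \<le> infnorm t" "infnorm t < 2 ^ Suc k"
        proof -
          define k where "k = nat \<lfloor>log 2 (infnorm t)\<rfloor>"
          have l0: "0 \<le> log 2 (infnorm t)" using False by simp
          have "real k \<le> log 2 (infnorm t)" "log 2 (infnorm t) < real (Suc k)"
            unfolding k_def using l0 by linarith+
          then have "2 ^ k \<le> infnorm t" "infnorm t < 2 ^ Suc k"
            using False by (simp_all add: le_log_iff log_less_iff powr_realpow[symmetric] del: power_Suc of_nat_Suc)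
          then show thesis by (rule that)
        qed
        have "infnorm t powr (- ?d - \<epsilon>) \<le> (2 ^ k) powr (- ?d - \<epsilon>)"
          using k(1) assms by (intro powr_mono2') auto
        then have "c * infnorm t powr (- ?d - \<epsilon>) \<le> F k t"
          using inQ[of t "Suc k"] k(2) assms by (simp add: F_def mult_left_mono)
        also have "\<dots> \<le> (\<Sum>k. F k t)"
          using sum_le_suminf[OF sm, of "{k}"] F0 by simp
        finally show ?thesis using False S0 assms by (simp add: indicator_def)
      qed
    qed
    then show "AE t in lborel. norm (?f t) \<le> norm (K * indicator (Q 0) t + (\<Sum>k. F k t))" by simp
  qed
qed

context L2_field begin

text \<open>
  Stationarity concerns finitely many points. It gives the claim for Riemann sums, since translation by an
  integral vector maps the grid to itself, and the claim passes to the limit.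
\<close>

lemma block_law:
  fixes m :: nat
  assumes \<phi>: "bdd_lipschitz L \<phi>" and c: "c \<in> lattice_pts 1"
  shows "expectation (\<lambda>\<omega>. \<phi> (S (hcube c m) \<omega>)) = expectation (\<lambda>\<omega>. \<phi> (S (hcube 0 m) \<omega>))"
proof -
  note [measurable] = bdd_lipschitzD(4)[OF \<phi>]
  have zero: "(0::real^'d) \<in> lattice_pts 1" by (rule lattice_ptsI[of _ "\<lambda>_. 0"]) (simp add: vec_eq_iff)
  define \<Delta> where "\<Delta> n = real (Suc n)" for n
  have top: "filterlim \<Delta> at_top sequentially"
    unfolding \<Delta>_def by (rule filterlim_compose[OF filterlim_real_sequentially filterlim_Suc])
  have lim: "(\<lambda>n. expectation (\<lambda>\<omega>. \<phi> (riemann (\<Delta> n) (hcube a m) \<omega>))) \<longlonglongrightarrow> expectation (\<lambda>\<omega>. \<phi> (S (hcube a m) \<omega>))"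
    if a: "a \<in> lattice_pts 1" for a
  proof -
    interpret P: L2_process M "lborel_on (hcube a m)" "\<lambda>t \<omega>. Z t \<omega> - 0" "expectation (\<lambda>\<omega>. (Z 0 \<omega> - 0)\<^sup>2)"
      by (rule Z_process) (auto simp: bounded_hcube)
    have iS: "integrable M (S (hcube a m))"
      using P.integrable_integral
      by (subst Bochner_Integration.integrable_cong[OF refl, of _ _ "\<lambda>\<omega>. \<integral>t. Z t \<omega> - 0 \<partial>lborel_on (hcube a m)"])
         (simp_all add: S_eq)
    have iR: "integrable M (riemann (\<Delta> n) (hcube a m))" for n
      unfolding riemann_def[abs_def] using integrable_Z by auto
    have "(\<lambda>n. expectation (\<lambda>\<omega>. \<bar>riemann (\<Delta> n) (hcube a m) \<omega> - S (hcube a m) \<omega>\<bar>)) \<longlonglongrightarrow> 0"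
      by (rule riemann_L1[OF _ _ _ _ top])
         (use a in \<open>auto simp: bounded_hcube \<Delta>_def simp del: of_nat_Suc intro!: grid_aligned_hcube\<close>)
    from tendsto_cov_lipschitz(1)[OF \<phi> \<phi> _ _ _ _ iR iS iR iS this this]
    show ?thesis by simp
  qed
  have "expectation (\<lambda>\<omega>. \<phi> (riemann (\<Delta> n) (hcube c m) \<omega>)) = expectation (\<lambda>\<omega>. \<phi> (riemann (\<Delta> n) (hcube 0 m) \<omega>))" for n
  proof -
    let ?I = "lattice_pts (\<Delta> n) \<inter> hcube 0 m" and ?w = "(1 / \<Delta> n) ^ CARD('d)"
    have c': "c \<in> lattice_pts (\<Delta> n)" unfolding \<Delta>_def using lattice_pts_1_subset[of "Suc n"] c by auto
    have fin: "finite ?I" by (rule finite_lattice_Int) (auto simp: bounded_hcube \<Delta>_def)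
    have r: "riemann (\<Delta> n) (hcube c m) \<omega> = (\<Sum>s\<in>?I. ?w * Z (s + c) \<omega>)" for \<omega>
      unfolding riemann_def lattice_Int_hcube_translate[OF c'] by (subst sum.reindex) (auto simp: inj_on_def)
    have [measurable]: "(\<lambda>x. \<phi> (\<Sum>s\<in>?I. ?w * x s)) \<in> borel_measurable (\<Pi>\<^sub>M s\<in>?I. borel)"
      by measurable
    show ?thesis
      using stationary_integral[OF mf sf fin, of "\<lambda>x. \<phi> (\<Sum>s\<in>?I. ?w * x s)" c]
      unfolding r by (simp add: riemann_def field_at_def)
  qed
  then show ?thesis using lim[OF c] lim[OF zero] LIMSEQ_unique by fastforce
qed

lemma
  assumes A: "A \<in> sets borel" "bounded A"
  shows S_L2: "integrable M (\<lambda>\<omega>. (S A \<omega>)\<^sup>2)"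
    and S_mean: "expectation (S A) = \<mu> * measure lborel A"
    and S_AE: "AE \<omega> in M. set_integrable lborel A (\<lambda>t. Z t \<omega>)"
    and S_variance: "expectation (\<lambda>\<omega>. (S A \<omega> - \<mu> * measure lborel A)\<^sup>2)
          = (\<integral>t. (\<integral>s. C (s - t) \<partial>lborel_on A) \<partial>lborel_on A)"
    and S_variance_integrable: "integrable (lborel_on A \<Otimes>\<^sub>M lborel_on A) (\<lambda>x. C (snd x - fst x))"
proof -
  interpret A: finite_measure "lborel_on A"
    by (rule finite_measure_lborel_on) (use A in \<open>auto intro: emeasure_lborel_bounded\<close>)
  interpret P: L2_process M "lborel_on A" "\<lambda>t \<omega>. Z t \<omega> - 0" "expectation (\<lambda>\<omega>. (Z 0 \<omega> - 0)\<^sup>2)"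
    by (rule Z_process[OF A])
  interpret Q: L2_process M "lborel_on A" "\<lambda>t \<omega>. Z t \<omega> - \<mu>" "expectation (\<lambda>\<omega>. (Z 0 \<omega> - \<mu>)\<^sup>2)"
    by (rule Z_process[OF A])
  have mA: "measure (lborel_on A) UNIV = measure lborel A" using A by (simp add: measure_lborel_on)
  show "integrable M (\<lambda>\<omega>. (S A \<omega>)\<^sup>2)"
    using P.integrable_integral_sq
    by (subst Bochner_Integration.integrable_cong[OF refl, of _ _ "\<lambda>\<omega>. (\<integral>t. Z t \<omega> - 0 \<partial>lborel_on A)\<^sup>2"])
       (simp_all add: S_eq A)
  have "expectation (S A) = expectation (\<lambda>\<omega>. \<integral>t. Z t \<omega> - 0 \<partial>lborel_on A)"
    by (rule Bochner_Integration.integral_cong) (auto simp: S_eq A)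
  also have "\<dots> = (\<integral>t. \<mu> \<partial>lborel_on A)" unfolding P.expectation_integral by (simp add: mean)
  finally show "expectation (S A) = \<mu> * measure lborel A" by (simp add: mA)
  show "AE \<omega> in M. set_integrable lborel A (\<lambda>t. Z t \<omega>)"
    using P.AE_integrable AE_space
  proof eventually_elim
    case (elim \<omega>)
    then have [measurable]: "\<omega> \<in> space M" by simp
    show ?case using elim A by (subst integrable_lborel_on[symmetric]) auto
  qed
  have "AE \<omega> in M. S A \<omega> - \<mu> * measure lborel A = (\<integral>t. Z t \<omega> - \<mu> \<partial>lborel_on A)"
    using P.AE_integrable AE_space
    by eventually_elim (simp add: S_eq A mA)
  then have "expectation (\<lambda>\<omega>. (S A \<omega> - \<mu> * measure lborel A)\<^sup>2) = expectation (\<lambda>\<omega>. (\<integral>t. Z t \<omega> - \<mu> \<partial>lborel_on A)\<^sup>2)"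
    using A by (intro integral_cong_AE) auto
  also have "\<dots> = (\<integral>t. (\<integral>s. C (s - t) \<partial>lborel_on A) \<partial>lborel_on A)"
    unfolding Q.expectation_integral_sq by (simp add: C_eq_expectation)
  finally show "expectation (\<lambda>\<omega>. (S A \<omega> - \<mu> * measure lborel A)\<^sup>2) = \<dots>" .
  show "integrable (lborel_on A \<Otimes>\<^sub>M lborel_on A) (\<lambda>x. C (snd x - fst x))"
    using Q.integrable_second_moment by (simp add: C_eq_expectation)
qed

lemma integrable_S: "A \<in> sets borel \<Longrightarrow> bounded A \<Longrightarrow> integrable M (S A)"
  by (rule integrable_of_L2[OF _ S_L2]) auto

text \<open>
  For fixed \<open>t\<close> the integral of \<open>C (s - t)\<close> over \<open>s \<in> A\<close> is at most the integral of \<open>\<bar>C\<bar>\<close> over the whole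
  space.
\<close>

lemma S_variance_le:
  assumes A: "A \<in> sets borel" "bounded A" and C: "integrable lborel C"
  shows "expectation (\<lambda>\<omega>. (S A \<omega> - \<mu> * measure lborel A)\<^sup>2) \<le> measure lborel A * (\<integral>u. \<bar>C u\<bar> \<partial>lborel)"
proof -
  interpret A: finite_measure "lborel_on A"
    by (rule finite_measure_lborel_on) (use A in \<open>auto intro: emeasure_lborel_bounded\<close>)
  interpret AA: pair_sigma_finite "lborel_on A" "lborel_on A" ..
  note [measurable] = A(1)
  have inner: "(\<integral>s. C (s - t) \<partial>lborel_on A) \<le> (\<integral>u. \<bar>C u\<bar> \<partial>lborel)" for t
  proof -
    have i: "integrable lborel (\<lambda>s. \<bar>C (s + (- t))\<bar>)"
      using C by (subst lborel_integrable_translate[of "\<lambda>u. \<bar>C u\<bar>"]) auto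
    then have i': "integrable lborel (\<lambda>s. C (s - t))"
      by (rule Bochner_Integration.integrable_bound) auto
    have "(\<integral>s. C (s - t) \<partial>lborel_on A) = (\<integral>s. indicator A s * C (s - t) \<partial>lborel)"
      by (subst integral_lborel_on) (auto simp: set_lebesgue_integral_def)
    also have "\<dots> \<le> (\<integral>s. \<bar>C (s + (- t))\<bar> \<partial>lborel)"
      using i i' integrable_mult_indicator[of A lborel "\<lambda>s. C (s - t)"]
      by (intro integral_mono) (auto simp: indicator_def)
    also have "\<dots> = (\<integral>u. \<bar>C u\<bar> \<partial>lborel)" by (rule lborel_integral_translate[of "\<lambda>u. \<bar>C u\<bar>"])
    finally show ?thesis .
  qed
  have "(\<integral>t. (\<integral>s. C (s - t) \<partial>lborel_on A) \<partial>lborel_on A) \<le> (\<integral>t. (\<integral>u. \<bar>C u\<bar> \<partial>lborel) \<partial>lborel_on A)"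
    using AA.integrable_fst[of "\<lambda>t s. C (s - t)"] S_variance_integrable[OF A] inner
    by (intro integral_mono) (auto simp: split_beta')
  then show ?thesis using A by (simp add: S_variance measure_lborel_on)
qed

text \<open>The volume of the overlap of a cube with its translate, the weight of \<open>C u\<close> in the variance.\<close>

definition overlap :: "nat \<Rightarrow> real^'d \<Rightarrow> real" where
  "overlap m u = measure lborel (hcube 0 m \<inter> {t. t + u \<in> hcube 0 m})"

definition block_variance :: "nat \<Rightarrow> real" where
  "block_variance m = expectation (\<lambda>\<omega>. (S (hcube 0 m) \<omega> - \<mu> * real m ^ CARD('d))\<^sup>2)"

lemma overlap_set[measurable]:
  "hcube 0 (real m) \<inter> {t. t + u \<in> hcube 0 (real m)} \<in> sets (borel :: (real^'e) measure)"
  by measurable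

lemma overlap_le: "0 \<le> overlap m u" "overlap m u \<le> real m ^ CARD('d)"
proof -
  show "0 \<le> overlap m u" by (simp add: overlap_def)
  have "overlap m u \<le> measure lborel (hcube (0::real^'d) m)"
    unfolding overlap_def by (rule measure_mono_bounded) (auto simp: bounded_hcube)
  then show "overlap m u \<le> real m ^ CARD('d)" by (simp add: measure_hcube)
qed

text \<open>
  A cube of side \<open>m\<close>, shrunk by \<open>norm u\<close> on all sides, stays inside the cube after translation by \<open>u\<close>.
\<close>

lemma overlap_lim: "(\<lambda>m. overlap m u / real m ^ CARD('d)) \<longlonglongrightarrow> 1"
proof (rule tendsto_sandwich)
  show "\<forall>\<^sub>F m in sequentially. overlap m u / real m ^ CARD('d) \<le> 1"
    using overlap_le by (auto simp: divide_le_eq_1 intro!: always_eventually)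
  have "\<forall>\<^sub>F m in sequentially. 2 * norm u \<le> real m"
    using filterlim_real_sequentially by (simp add: filterlim_at_top)
  moreover have "\<forall>\<^sub>F m in sequentially. 0 < (m :: nat)" by (rule eventually_gt_at_top)
  ultimately show "\<forall>\<^sub>F m in sequentially. (1 - 2 * norm u / real m) ^ CARD('d) \<le> overlap m u / real m ^ CARD('d)"
  proof eventually_elim
    case (elim m)
    have "hcube (\<chi> i::'d. norm u) (real m - 2 * norm u) \<subseteq> hcube 0 m \<inter> {t. t + u \<in> hcube 0 m}"
    proof
      fix t assume t: "t \<in> hcube (\<chi> i::'d. norm u) (real m - 2 * norm u)"
      have "0 \<le> t $ i \<and> t $ i < m \<and> 0 \<le> (t + u) $ i \<and> (t + u) $ i < m" for i
        using t component_le_norm_cart[of u i] norm_ge_zero[of u]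
        by (auto simp: hcube_def abs_le_iff dest!: spec[of _ i])
      then show "t \<in> hcube 0 m \<inter> {t. t + u \<in> hcube 0 m}" by (auto simp: hcube_def)
    qed
    then have "measure lborel (hcube (\<chi> i::'d. norm u) (real m - 2 * norm u)) \<le> overlap m u"
      unfolding overlap_def by (rule measure_mono_bounded) (auto simp: bounded_Int bounded_hcube)
    then have "(real m - 2 * norm u) ^ CARD('d) \<le> overlap m u" using elim by (simp add: measure_hcube)
    moreover have "1 - 2 * norm u / real m = (real m - 2 * norm u) / real m" using elim by (simp add: field_simps)
    ultimately show ?case using elim by (simp add: power_divide divide_right_mono)
  qed
  have "(\<lambda>m. (1 - 2 * norm u / real m) ^ CARD('d)) \<longlonglongrightarrow> (1 - 0) ^ CARD('d)"
    by (intro tendsto_intros tendsto_divide_0[OF tendsto_const] filterlim_at_top_imp_at_infinity[OF filterlim_real_sequentially])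
  then show "(\<lambda>m. (1 - 2 * norm u / real m) ^ CARD('d)) \<longlonglongrightarrow> 1" by simp
qed simp

text \<open>
  Substitute \<open>u = s - t\<close> in the double integral of \<open>C (s - t)\<close> and integrate over \<open>t\<close> first. Boundedness of \<open>C\<close>
  and of the cube justify the exchange.
\<close>

lemma
  shows block_variance_eq: "block_variance m = (\<integral>u. C u * overlap m u \<partial>lborel)"
    and integrable_C_overlap: "integrable lborel (\<lambda>u. C u * overlap m u)"
proof -
  let ?Q = "hcube (0::real^'d) m"
  let ?g = "\<lambda>t u. indicator ?Q t * indicator ?Q (t + u) * C u :: real"
  have bd: "bounded ?Q" by (rule bounded_hcube)
  have m: "(\<lambda>(t, u). ?g t u) \<in> borel_measurable (lborel \<Otimes>\<^sub>M lborel)" by measurable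
  have inner_i: "integrable lborel (\<lambda>u. ?g t u)" for t
  proof -
    have "integrable lborel (\<lambda>u. indicator ?Q (u + t) * C 0)"
      using emeasure_lborel_bounded[OF bd]
      by (subst lborel_integrable_translate[of "\<lambda>u. indicator ?Q u * C 0"])
         (auto intro!: integrable_mult_left integrable_real_indicator)
    then show ?thesis
      by (rule Bochner_Integration.integrable_bound)
         (auto simp: abs_mult add.commute C0_nonneg abs_C_le split: split_indicator)
  qed
  have shift: "(\<integral>u. indicator ?Q (t + u) * F u \<partial>lborel) = (\<integral>s. F (s - t) \<partial>lborel_on ?Q)"
    if [measurable]: "F \<in> borel_measurable borel" for F :: "real^'d \<Rightarrow> real" and t
    using lborel_integral_translate[of "\<lambda>s. indicator ?Q s * F (s - t)" t]
    by (subst integral_lborel_on) (auto simp: set_lebesgue_integral_def add.commute)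
  have i: "integrable (lborel \<Otimes>\<^sub>M lborel) (\<lambda>(t, u). ?g t u)"
  proof (rule lborel_pair.Fubini_integrable[OF m])
    show "AE t in lborel. integrable lborel (\<lambda>u. case (t, u) of (t, u) \<Rightarrow> ?g t u)"
      using inner_i by simp
    have m2[measurable]: "(\<lambda>t. \<integral>u. norm (case (t, u) of (t, u) \<Rightarrow> ?g t u) \<partial>lborel) \<in> borel_measurable lborel"
      by measurable
    show "integrable lborel (\<lambda>t. \<integral>u. norm (case (t, u) of (t, u) \<Rightarrow> ?g t u) \<partial>lborel)"
    proof (rule Bochner_Integration.integrable_bound[where f="\<lambda>t. indicator ?Q t * (C 0 * measure lborel ?Q)"])
      show "integrable lborel (\<lambda>t. indicator ?Q t * (C 0 * measure lborel ?Q))"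
        using emeasure_lborel_bounded[OF bd] by (intro integrable_mult_left integrable_real_indicator) auto
      have "(\<integral>u. norm (?g t u) \<partial>lborel) \<le> indicator ?Q t * (C 0 * measure lborel ?Q)" for t
      proof -
        have "(\<integral>u. norm (?g t u) \<partial>lborel) \<le> (\<integral>u. indicator ?Q (u + t) * (indicator ?Q t * C 0) \<partial>lborel)"
        proof (rule integral_mono)
          show "integrable lborel (\<lambda>u. indicator ?Q (u + t) * (indicator ?Q t * C 0))"
            using emeasure_lborel_bounded[OF bd]
            by (subst lborel_integrable_translate[of "\<lambda>u. indicator ?Q u * (indicator ?Q t * C 0)"])
               (auto intro!: integrable_mult_left integrable_real_indicator)
          show "integrable lborel (\<lambda>u. norm (?g t u))" using inner_i by (rule integrable_norm)
        qed (use abs_C_le C0_nonneg in \<open>auto simp: add.commute split: split_indicator\<close>)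
        also have "\<dots> = (\<integral>u. indicator ?Q u * (indicator ?Q t * C 0) \<partial>lborel)"
          by (rule lborel_integral_translate[of "\<lambda>u. indicator ?Q u * (indicator ?Q t * C 0)"])
        also have "\<dots> = indicator ?Q t * (C 0 * measure lborel ?Q)" by simp
        finally show ?thesis .
      qed
      then show "AE t in lborel. norm (\<integral>u. norm (case (t, u) of (t, u) \<Rightarrow> ?g t u) \<partial>lborel)
          \<le> norm (indicator ?Q t * (C 0 * measure lborel ?Q))"
        using C0_nonneg by (intro AE_I2) (simp add: abs_mult)
    qed (rule m2)
  qed
  have ov: "(\<integral>t. ?g t u \<partial>lborel) = C u * overlap m u" for u
  proof -
    have "(\<integral>t. ?g t u \<partial>lborel) = (\<integral>t. C u * indicator (?Q \<inter> {t. t + u \<in> ?Q}) t \<partial>lborel)"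
      by (rule Bochner_Integration.integral_cong) (auto split: split_indicator)
    then show ?thesis by (simp add: overlap_def)
  qed
  show "integrable lborel (\<lambda>u. C u * overlap m u)"
    using lborel_pair.integrable_snd[OF i] unfolding ov .
  have "block_variance m = (\<integral>t. (\<integral>s. C (s - t) \<partial>lborel_on ?Q) \<partial>lborel_on ?Q)"
    unfolding block_variance_def using S_variance[of ?Q] by (simp add: bd measure_hcube)
  also have "\<dots> = (\<integral>t. (\<integral>u. indicator ?Q (t + u) * C u \<partial>lborel) \<partial>lborel_on ?Q)"
    by (simp add: shift)
  also have "\<dots> = (\<integral>t. (\<integral>u. ?g t u \<partial>lborel) \<partial>lborel)"
    by (subst integral_lborel_on) (auto simp: set_lebesgue_integral_def mult.assoc)
  also have "\<dots> = (\<integral>u. (\<integral>t. ?g t u \<partial>lborel) \<partial>lborel)"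
    by (rule lborel_pair.Fubini_integral[OF i, symmetric])
  finally show "block_variance m = (\<integral>u. C u * overlap m u \<partial>lborel)" unfolding ov .
qed

lemma overlap_measurable[measurable]: "overlap m \<in> borel_measurable borel"
proof -
  have "overlap m = (\<lambda>u. \<integral>t. indicator (hcube 0 m) t * indicator (hcube 0 m) (t + u) \<partial>lborel)"
  proof
    fix u
    have "(\<integral>t. indicator (hcube 0 m) t * indicat_real (hcube 0 m) (t + u) \<partial>lborel)
      = (\<integral>t. indicator (hcube 0 m \<inter> {t. t + u \<in> hcube 0 m}) t \<partial>(lborel :: (real^'d) measure))"
      by (rule Bochner_Integration.integral_cong) (auto split: split_indicator)
    then show "overlap m u = (\<integral>t. indicator (hcube 0 m) t * indicator (hcube 0 m) (t + u) \<partial>lborel)"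
      by (simp add: overlap_def)
  qed
  also have "\<dots> \<in> borel_measurable borel" by measurable
  finally show ?thesis .
qed

lemma block_variance_lim:
  assumes C: "integrable lborel C"
  shows "(\<lambda>m. block_variance m / real m ^ CARD('d)) \<longlonglongrightarrow> (\<integral>u. C u \<partial>lborel)"
proof -
  have "(\<lambda>m. \<integral>u. C u * (overlap m u / real m ^ CARD('d)) \<partial>lborel) \<longlonglongrightarrow> (\<integral>u. C u * 1 \<partial>lborel)"
  proof (rule integral_dominated_convergence[where w="\<lambda>u. \<bar>C u\<bar>"])
    show "AE u in lborel. (\<lambda>m. C u * (overlap m u / real m ^ CARD('d))) \<longlonglongrightarrow> C u * 1"
      by (intro AE_I2 tendsto_intros overlap_lim)
    show "AE u in lborel. norm (C u * (overlap m u / real m ^ CARD('d))) \<le> \<bar>C u\<bar>" for m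
    proof (rule AE_I2)
      fix u :: "real^'d"
      have "\<bar>overlap m u / real m ^ CARD('d)\<bar> \<le> 1"
        using overlap_le[of m u] by (cases "m = 0") (auto simp: divide_le_eq_1)
      then show "norm (C u * (overlap m u / real m ^ CARD('d))) \<le> \<bar>C u\<bar>"
        using mult_left_mono[of "\<bar>overlap m u / real m ^ CARD('d)\<bar>" 1 "\<bar>C u\<bar>"] by (simp add: abs_mult)
    qed
  qed (use C in auto)
  then show ?thesis by (simp add: block_variance_eq)
qed

text \<open>
  An integrable upper bound suffices for the integrability of a covariance function. Since the variance of the
  integral over a cube is nonnegative, the weighted integral of the negative part never exceeds
  that of the positive part. The weights tend to one, and Fatou's lemma concludes.
\<close>

lemma integrable_C_of_upper_bound:
  assumes g: "integrable lborel g" and le: "\<And>u. C u \<le> g u" and nn: "\<And>u. 0 \<le> g u"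
  shows "integrable lborel C"
proof -
  define N where "N u = max 0 (- C u)" for u
  have [measurable]: "N \<in> borel_measurable borel" unfolding N_def by measurable
  have [measurable]: "g \<in> borel_measurable borel" using g by auto
  define w where "w m u = overlap m u / real m ^ CARD('d)" for m u
  have w: "0 \<le> w m u" "w m u \<le> 1" for m u using overlap_le[of m u] by (cases "m = 0"; auto simp: w_def divide_le_eq_1)+
  have [measurable]: "w m \<in> borel_measurable borel" for m unfolding w_def by measurable
  have bound: "(\<integral>\<^sup>+u. ennreal (N u * w m u) \<partial>lborel) \<le> ennreal (\<integral>u. g u \<partial>lborel)" for m
  proof -
    have i: "integrable lborel (\<lambda>u. C u * w m u)"
      using integrable_C_overlap[of m] by (simp add: w_def)
    have "0 \<le> block_variance m / real m ^ CARD('d)" by (simp add: block_variance_def)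
    also have "\<dots> = (\<integral>u. C u * w m u \<partial>lborel)" by (simp add: block_variance_eq w_def)
    finally have nnC: "0 \<le> (\<integral>u. C u * w m u \<partial>lborel)" .
    have iN: "integrable lborel (\<lambda>u. N u * w m u)"
      by (rule Bochner_Integration.integrable_bound[OF i])
         (use w in \<open>auto simp: N_def abs_mult intro!: mult_right_mono AE_I2\<close>)
    have "N u * w m u + C u * w m u \<le> g u" for u
    proof -
      have "N u * w m u + C u * w m u = max (C u) 0 * w m u" by (simp add: N_def max_def algebra_simps)
      also have "\<dots> \<le> g u * 1" using le[of u] nn[of u] w by (intro mult_mono) auto
      finally show ?thesis by simp
    qed
    then have "(\<integral>u. N u * w m u + C u * w m u \<partial>lborel) \<le> (\<integral>u. g u \<partial>lborel)"
      using iN i g by (intro integral_mono) auto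
    then have "(\<integral>u. N u * w m u \<partial>lborel) \<le> (\<integral>u. g u \<partial>lborel)" using nnC iN i by simp
    moreover have "(\<integral>\<^sup>+u. ennreal (N u * w m u) \<partial>lborel) = ennreal (\<integral>u. N u * w m u \<partial>lborel)"
      using iN w by (intro nn_integral_eq_integral) (auto simp: N_def)
    ultimately show ?thesis by (simp add: ennreal_leI)
  qed
  have "(\<integral>\<^sup>+u. ennreal (N u) \<partial>lborel) = (\<integral>\<^sup>+u. liminf (\<lambda>m. ennreal (N u * w m u)) \<partial>lborel)"
  proof (rule nn_integral_cong)
    fix u :: "real^'d"
    have "(\<lambda>m. N u * w m u) \<longlonglongrightarrow> N u * 1" unfolding w_def by (intro tendsto_intros overlap_lim)
    then have "(\<lambda>m. ennreal (N u * w m u)) \<longlonglongrightarrow> ennreal (N u)" by (intro tendsto_ennrealI) simp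
    then show "ennreal (N u) = liminf (\<lambda>m. ennreal (N u * w m u))"
      by (simp add: lim_imp_Liminf)
  qed
  also have "\<dots> \<le> liminf (\<lambda>m. \<integral>\<^sup>+u. ennreal (N u * w m u) \<partial>lborel)"
    by (rule nn_integral_liminf) measurable
  also have "\<dots> \<le> liminf (\<lambda>m. ennreal (\<integral>u. g u \<partial>lborel))"
    by (rule Liminf_mono) (use bound in auto)
  also have "\<dots> < \<infinity>" by (simp add: Liminf_const)
  finally have iN: "integrable lborel N"
    by (intro integrableI_nonneg) (auto simp: N_def)
  show ?thesis
  proof (rule Bochner_Integration.integrable_bound[where f="\<lambda>u. g u + N u"])
    have "\<bar>C u\<bar> \<le> g u + N u" for u using le[of u] nn[of u] by (auto simp: N_def)
    then show "AE u in lborel. norm (C u) \<le> norm (g u + N u)"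
      by (intro AE_I2) (simp add: order_trans[OF _ abs_ge_self])
  qed (use g iN in auto)
qed

end

section \<open>Filling a growing set with lattice cells\<close>

lemma measure_lborel_translate:
  fixes A :: "'a::euclidean_space set"
  assumes "A \<in> sets borel"
  shows "measure lborel ((\<lambda>x. c + x) ` A) = measure lborel A" "(\<lambda>x. c + x) ` A \<in> sets borel"
proof -
  have eq: "(\<lambda>x. c + x) ` A = (\<lambda>x. x - c) -` A \<inter> space borel"
    by (auto intro!: image_eqI[of _ _ "_ - c"])
  have m: "(\<lambda>x. x - c) \<in> borel_measurable borel" by measurable
  show s: "(\<lambda>x. c + x) ` A \<in> sets borel" unfolding eq using measurable_sets[OF m assms] .
  show "measure lborel ((\<lambda>x. c + x) ` A) = measure lborel A"
    using measure_translation[of c A] s assms by (simp add: measure_completion)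
qed

definition fattened :: "(real^'d) set \<Rightarrow> real \<Rightarrow> (real^'d) set" where
  "fattened F \<rho> = {a + b | a b. a \<in> F \<and> b \<in> cball 0 \<rho>}"

lemma compact_fattened: "compact F \<Longrightarrow> compact (fattened F \<rho>)"
  unfolding fattened_def using compact_sums[of F "cball 0 \<rho>"] by simp

text \<open>
  A ball of radius \<open>\<rho>\<close> is covered by finitely many unit balls, so the fattening by \<open>\<rho>\<close> is covered by as many
  translates of the fattening by one. The number depends on \<open>\<rho>\<close> alone, which makes the radius in the
  definition of Van Hove growth immaterial.
\<close>

lemma fattened_measure_le:
  "\<exists>k::nat. \<forall>F :: (real^'d) set. compact F \<longrightarrow>
     measure lborel (fattened F \<rho>) \<le> real k * measure lborel (fattened F 1)"
proof -
  have "cball (0::real^'d) \<rho> \<subseteq> (\<Union>c\<in>cball 0 \<rho>. ball c 1)" by (auto intro!: bexI[of _ "_ :: real^'d"])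
  then obtain T where T: "T \<subseteq> cball (0::real^'d) \<rho>" "finite T" "cball 0 \<rho> \<subseteq> (\<Union>c\<in>T. ball c 1)"
    using compactE_image[OF compact_cball, of "cball (0::real^'d) \<rho>" "\<lambda>c. ball c 1" 0 \<rho>] by auto
  have "measure lborel (fattened F \<rho>) \<le> real (card T) * measure lborel (fattened F 1)"
    if F: "compact F" for F :: "(real^'d) set"
  proof -
    have b: "fattened F 1 \<in> sets borel" "fattened F \<rho> \<in> sets borel"
      using compact_fattened[OF F] by (auto intro: borel_compact)
    note tr = measure_lborel_translate[OF b(1)]
    have "fattened F \<rho> \<subseteq> (\<Union>c\<in>T. (\<lambda>x. c + x) ` fattened F 1)"
    proof
      fix x assume "x \<in> fattened F \<rho>"
      then obtain a y where x: "x = a + y" "a \<in> F" "y \<in> cball 0 \<rho>" by (auto simp: fattened_def)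
      then obtain c where c: "c \<in> T" "y \<in> ball c 1" using T(3) by blast
      have "y - c \<in> cball 0 1" using c(2) by (simp add: dist_norm norm_minus_commute)
      then have "a + (y - c) \<in> fattened F 1" using x(2) unfolding fattened_def by blast
      then show "x \<in> (\<Union>c\<in>T. (\<lambda>x. c + x) ` fattened F 1)"
        using c(1) x(1) by (auto intro!: bexI[of _ c] image_eqI[of _ _ "a + (y - c)"])
    qed
    moreover have "bounded (\<Union>c\<in>T. (\<lambda>x. c + x) ` fattened F 1)"
      using T(2) compact_imp_bounded[OF compact_fattened[OF F]] by (auto intro!: bounded_UN bounded_translation)
    ultimately have "measure lborel (fattened F \<rho>) \<le> measure lborel (\<Union>c\<in>T. (\<lambda>x. c + x) ` fattened F 1)"
      using b(2) tr(2) T(2) by (intro measure_mono_bounded) auto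
    also have "\<dots> \<le> (\<Sum>c\<in>T. measure lborel ((\<lambda>x. c + x) ` fattened F 1))"
      using T(2) tr(2) by (intro measure_UNION_le) auto
    finally show ?thesis by (simp add: tr(1))
  qed
  then show ?thesis by blast
qed

lemma VH_growing_fattened:
  assumes "VH_growing W"
  shows "(\<lambda>n. measure lborel (fattened (frontier (W n)) \<rho>) / measure lborel (W n)) \<longlonglongrightarrow> 0"
proof -
  have W: "compact (W n)" "0 < measure lborel (W n)" for n using assms by (auto simp: VH_growing_def)
  have F: "compact (frontier (W n))" for n using W by (simp add: compact_frontier)
  obtain k :: nat where k: "\<And>F :: (real^'a) set. compact F \<Longrightarrow>
      measure lborel (fattened F \<rho>) \<le> real k * measure lborel (fattened F 1)"
    using fattened_measure_le[of \<rho>] by blast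
  have "(\<lambda>n. measure lborel (fattened (frontier (W n)) 1) / measure lborel (W n)) \<longlonglongrightarrow> 0"
    using assms by (simp add: VH_growing_def fattened_def)
  then have "(\<lambda>n. real k * (measure lborel (fattened (frontier (W n)) 1) / measure lborel (W n))) \<longlonglongrightarrow> 0"
    by (rule tendsto_mult_right_zero)
  moreover have "\<forall>\<^sub>F n in sequentially. norm (measure lborel (fattened (frontier (W n)) \<rho>) / measure lborel (W n))
      \<le> real k * (measure lborel (fattened (frontier (W n)) 1) / measure lborel (W n))"
    using k[OF F] W(2) by (intro always_eventually) (simp add: divide_right_mono less_imp_le)
  ultimately show ?thesis by (rule Lim_null_comparison[rotated])
qed

text \<open>
  The boundary is not empty, so its fattening contains a unit ball, and the Van Hove ratio can
  tend to zero only if its denominator grows.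
\<close>

lemma VH_growing_volume:
  fixes W :: "nat \<Rightarrow> (real^'d) set"
  assumes "VH_growing W"
  shows "filterlim (\<lambda>n. measure lborel (W n)) at_top sequentially"
proof -
  have W: "compact (W n)" "0 < measure lborel (W n)" for n using assms by (auto simp: VH_growing_def)
  define b where "b = measure lborel (cball (0::real^'d) 1)"
  have b: "0 < b" unfolding b_def by (rule content_cball_pos) simp
  have le: "b \<le> measure lborel (fattened (frontier (W n)) 1)" for n
  proof -
    have "W n \<noteq> {}" using W(2)[of n] by auto
    moreover have "W n \<noteq> UNIV" using W(1)[of n] compact_imp_bounded not_bounded_UNIV by metis
    ultimately obtain a where a: "a \<in> frontier (W n)" using frontier_eq_empty by blast
    have "(\<lambda>x. a + x) ` cball 0 1 \<subseteq> fattened (frontier (W n)) 1" using a unfolding fattened_def by blast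
    then have "measure lborel ((\<lambda>x. a + x) ` cball 0 1) \<le> measure lborel (fattened (frontier (W n)) 1)"
      using compact_fattened[OF compact_frontier[OF W(1)]] measure_lborel_translate(2)[of "cball (0::real^'d) 1" a]
      by (intro measure_mono_bounded) (auto intro: borel_compact compact_imp_bounded)
    then show ?thesis using measure_lborel_translate(1)[of "cball (0::real^'d) 1" a] by (simp add: b_def)
  qed
  have "\<forall>\<^sub>F n in sequentially. norm (b / measure lborel (W n)) \<le> measure lborel (fattened (frontier (W n)) 1) / measure lborel (W n)"
    using le W(2) b by (intro always_eventually) (simp add: divide_right_mono less_imp_le)
  then have "(\<lambda>n. b / measure lborel (W n)) \<longlonglongrightarrow> 0"
    using VH_growing_fattened[OF assms, of 1] by (rule Lim_null_comparison)
  then have "filterlim (\<lambda>n. inverse (b / measure lborel (W n))) at_top sequentially"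
    using b W(2) by (intro filterlim_inverse_at_top) (auto intro!: always_eventually)
  then have "filterlim (\<lambda>n. b * inverse (b / measure lborel (W n))) at_top sequentially"
    using b by (intro filterlim_tendsto_pos_mult_at_top[OF tendsto_const])
  then show ?thesis using b by simp
qed

definition cells :: "nat \<Rightarrow> (real^'d) set \<Rightarrow> (real^'d) set" where
  "cells p W = {c \<in> lattice_pts (1 / real p). hcube c p \<subseteq> W}"

lemma corner_in_hcube: "0 < m \<Longrightarrow> c \<in> hcube c m"
  by (simp add: hcube_def)

lemma hcube_mono: "m \<le> m' \<Longrightarrow> hcube c m \<subseteq> hcube c m'"
  unfolding hcube_def by (auto intro: less_le_trans[OF _ add_left_mono])

lemma finite_cells: "bounded W \<Longrightarrow> 0 < p \<Longrightarrow> finite (cells p W)"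
  by (rule finite_subset[OF _ finite_lattice_Int[of W "1 / real p"]])
     (auto simp: cells_def dest: subsetD[OF _ corner_in_hcube])

lemma measure_UN_hcube:
  fixes K :: "(real^'d) set"
  assumes "finite K" "K \<subseteq> lattice_pts (1 / real (m + r))"
  shows "measure lborel (\<Union>c\<in>K. hcube c (real m)) = real (card K) * real m ^ CARD('d)"
proof -
  have "disjoint_family_on (\<lambda>c. hcube c (real m)) K"
    unfolding disjoint_family_on_def using hcube_disjoint[of _ m r] assms(2) by (metis subsetD)
  then have "measure lborel (\<Union>c\<in>K. hcube c (real m)) = (\<Sum>c\<in>K. measure lborel (hcube c (real m)))"
    using assms emeasure_lborel_bounded[OF bounded_hcube]
    by (intro measure_finite_Union) (auto simp: less_top[symmetric])
  then show ?thesis by (simp add: measure_hcube)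
qed

text \<open>
  A cell that meets \<open>W n\<close> but is not contained in it is connected and hence meets the frontier. What the
  cells leave free therefore lies within the diameter of a cell from the frontier.
\<close>

lemma cells_volume_ratio:
  fixes W :: "nat \<Rightarrow> (real^'d) set"
  assumes "VH_growing W" "0 < p"
  shows "(\<lambda>n. real (card (cells p (W n))) / measure lborel (W n)) \<longlonglongrightarrow> 1 / real p ^ CARD('d)"
    and "real (card (cells p (W n))) * real p ^ CARD('d) \<le> measure lborel (W n)"
proof -
  have W: "compact (W n)" "0 < measure lborel (W n)" for n using assms by (auto simp: VH_growing_def)
  have Wb: "W n \<in> sets borel" "bounded (W n)" for n using W by (auto intro: borel_compact compact_imp_bounded)
  define \<rho> where "\<rho> = real p * CARD('d)"
  define U where "U n = (\<Union>c\<in>cells p (W n). hcube c p)" for n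
  have U: "U n \<subseteq> W n" for n by (auto simp: U_def cells_def)
  have fin: "finite (cells p (W n))" for n by (rule finite_cells[OF Wb(2) assms(2)])
  have [measurable]: "U n \<in> sets borel" for n unfolding U_def using fin by auto
  have mU: "measure lborel (U n) = real (card (cells p (W n))) * real p ^ CARD('d)" for n
    unfolding U_def using measure_UN_hcube[of "cells p (W n)" p 0] fin by (auto simp: cells_def)
  have le: "measure lborel (U n) \<le> measure lborel (W n)" for n
    by (rule measure_mono_bounded[OF U]) (use Wb in auto)
  then show "real (card (cells p (W n))) * real p ^ CARD('d) \<le> measure lborel (W n)" by (simp add: mU)
  have sub: "W n \<subseteq> U n \<union> fattened (frontier (W n)) \<rho>" for n
  proof
    fix x assume x: "x \<in> W n"
    define c where "c = grid_floor (1 / real p) x"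
    have c: "c \<in> lattice_pts (1 / real p)" unfolding c_def by (rule grid_floor_in_lattice)
    have xc: "x \<in> hcube c p" using mem_hcube_lattice_iff[OF c, of x] assms(2) by (simp add: c_def)
    show "x \<in> U n \<union> fattened (frontier (W n)) \<rho>"
    proof (cases "hcube c p \<subseteq> W n")
      case True
      then show ?thesis using c xc by (auto simp: U_def cells_def)
    next
      case False
      have "convex (hcube c (real p))"
      proof -
        have "hcube c (real p) = (\<Inter>i\<in>UNIV. {y. c $ i \<le> y $ i} \<inter> {y. y $ i < c $ i + p})"
          by (auto simp: hcube_def)
        moreover have "convex {y :: real^'d. y $ i < a}" "convex {y :: real^'d. a \<le> y $ i}" for a :: real and i
          using convex_halfspace_lt[of "axis i 1 :: real^'d" a] convex_halfspace_ge[of a "axis i 1 :: real^'d"]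
          by (simp_all add: inner_axis inner_commute[of "axis _ _"])
        ultimately show ?thesis by (auto intro!: convex_INT convex_Int)
      qed
      then have "hcube c (real p) \<inter> frontier (W n) \<noteq> {}"
        using False xc x by (intro connected_Int_frontier convex_connected) auto
      then obtain y where y: "y \<in> hcube c (real p)" "y \<in> frontier (W n)" by auto
      have "\<bar>(x - y) $ i\<bar> \<le> real p" for i using xc y(1) by (auto simp: hcube_def abs_le_iff dest!: spec[of _ i])
      then have "(\<Sum>i\<in>UNIV. \<bar>(x - y) $ i\<bar>) \<le> (\<Sum>i\<in>(UNIV::'d set). real p)" by (intro sum_mono)
      then have "norm (x - y) \<le> \<rho>" using norm_le_l1_cart[of "x - y"] by (simp add: \<rho>_def mult.commute)
      then have "y + (x - y) \<in> fattened (frontier (W n)) \<rho>" using y(2) unfolding fattened_def by fastforce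
      then show ?thesis by simp
    qed
  qed
  have "measure lborel (W n) \<le> measure lborel (U n) + measure lborel (fattened (frontier (W n)) \<rho>)" for n
  proof -
    have f: "compact (fattened (frontier (W n)) \<rho>)" using W by (intro compact_fattened compact_frontier)
    have bU: "bounded (U n)" using Wb(2) U bounded_subset by blast
    have "measure lborel (W n) \<le> measure lborel (U n \<union> fattened (frontier (W n)) \<rho>)"
      using f bU Wb by (intro measure_mono_bounded[OF sub]) (auto intro: borel_compact compact_imp_bounded)
    also have "\<dots> \<le> measure lborel (U n) + measure lborel (fattened (frontier (W n)) \<rho>)"
      using f by (intro measure_Un_le) (auto intro: borel_compact)
    finally show ?thesis .
  qed
  then have dv: "measure lborel (W n) / measure lborel (W n)
      \<le> (measure lborel (U n) + measure lborel (fattened (frontier (W n)) \<rho>)) / measure lborel (W n)" for n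
    using W(2)[of n] by (intro divide_right_mono) auto
  have low: "1 - measure lborel (fattened (frontier (W n)) \<rho>) / measure lborel (W n)
      \<le> measure lborel (U n) / measure lborel (W n)" for n
    using W(2)[of n] dv[of n] by (simp add: add_divide_distrib diff_le_eq)
  have "(\<lambda>n. measure lborel (U n) / measure lborel (W n)) \<longlonglongrightarrow> 1"
  proof (rule tendsto_sandwich)
    show "(\<lambda>n. 1 - measure lborel (fattened (frontier (W n)) \<rho>) / measure lborel (W n)) \<longlonglongrightarrow> 1"
      using tendsto_diff[OF tendsto_const VH_growing_fattened[OF assms(1), of \<rho>], of 1] by simp
    show "\<forall>\<^sub>F n in sequentially. measure lborel (U n) / measure lborel (W n) \<le> 1"
      using le W(2) by (intro always_eventually) (simp add: divide_le_eq_1)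
  qed (use low in auto)
  then have "(\<lambda>n. measure lborel (U n) / measure lborel (W n) / real p ^ CARD('d)) \<longlonglongrightarrow> 1 / real p ^ CARD('d)"
    using assms(2) by (intro tendsto_intros) auto
  moreover have "measure lborel (U n) / measure lborel (W n) / real p ^ CARD('d) = real (card (cells p (W n))) / measure lborel (W n)" for n
    using assms(2) by (simp add: mU)
  ultimately show "(\<lambda>n. real (card (cells p (W n))) / measure lborel (W n)) \<longlonglongrightarrow> 1 / real p ^ CARD('d)" by simp
qed

section \<open>A central limit theorem for mixing fields\<close>

lemma norm_iexp_diff_le: "norm (iexp x - iexp y) \<le> \<bar>x - y\<bar>"
proof -
  have "iexp x - iexp y = iexp y * (iexp (x - y) - 1)"
  proof -
    have "iexp y * iexp (x - y) = iexp x"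
      by (simp only: exp_add[symmetric] distrib_left[symmetric] of_real_add[symmetric]) simp
    then show ?thesis by (simp add: right_diff_distrib)
  qed
  moreover have "norm (iexp (x - y) - 1) \<le> \<bar>x - y\<bar>"
    using iexp_approx1[of "x - y" 0] by simp
  ultimately show ?thesis by (simp add: norm_mult)
qed

lemma bdd_lipschitz_cos_sin:
  assumes "0 < s"
  shows "bdd_lipschitz (1 / s) (\<lambda>x. cos ((x - a) / s))" "bdd_lipschitz (1 / s) (\<lambda>x. sin ((x - a) / s))"
proof -
  have d: "\<bar>(x - a) / s - (y - a) / s\<bar> = 1 / s * \<bar>x - y\<bar>" for x y
    using assms by (simp add: diff_divide_distrib[symmetric] abs_divide)
  have l: "\<bar>cos x - cos y\<bar> \<le> \<bar>x - y\<bar>" "\<bar>sin x - sin y\<bar> \<le> \<bar>x - y\<bar>" for x y :: real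
    using norm_iexp_diff_le[of x y] abs_Re_le_cmod[of "iexp x - iexp y"] abs_Im_le_cmod[of "iexp x - iexp y"]
    by (simp_all add: Re_exp Im_exp)
  show "bdd_lipschitz (1 / s) (\<lambda>x. cos ((x - a) / s))" "bdd_lipschitz (1 / s) (\<lambda>x. sin ((x - a) / s))"
    unfolding bdd_lipschitz_def d[symmetric] by (intro conjI allI l abs_cos_le_one abs_sin_le_one)+
qed

text \<open>
  Comparing \<open>1 - x\<close> with \<open>exp (- x)\<close> up to second order avoids logarithms of characteristic functions.
\<close>

lemma abs_exp_minus_le:
  assumes "0 \<le> (x::real)" shows "\<bar>(1 - x) - exp (- x)\<bar> \<le> x\<^sup>2"
proof -
  have 1: "1 - x \<le> exp (- x)" using exp_ge_add_one_self[of "-x"] by simp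
  have "exp (- x) * (1 + x) \<le> exp (- x) * exp x"
    by (intro mult_left_mono exp_ge_add_one_self) simp
  then have "exp (- x) * (1 + x) \<le> 1" by (simp add: exp_minus_inverse mult.commute)
  also have "1 \<le> (1 - x + x\<^sup>2) * (1 + x)" using assms by (simp add: algebra_simps power2_eq_square)
  finally have "exp (- x) \<le> 1 - x + x\<^sup>2" using assms by (simp add: mult_le_cancel_right)
  then show ?thesis using 1 by simp
qed

context prob_space begin

lemma integral_iexp:
  assumes [measurable]: "A \<in> borel_measurable M"
  shows "integrable M (\<lambda>\<omega>. iexp (A \<omega>))"
    and "expectation (\<lambda>\<omega>. iexp (A \<omega>)) = Complex (expectation (\<lambda>\<omega>. cos (A \<omega>))) (expectation (\<lambda>\<omega>. sin (A \<omega>)))"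
proof -
  have i: "integrable M (\<lambda>\<omega>. cos (A \<omega>))" "integrable M (\<lambda>\<omega>. sin (A \<omega>))"
    by (auto intro!: integrable_const_bound[where B=1])
  show ie: "integrable M (\<lambda>\<omega>. iexp (A \<omega>))"
    by (rule integrable_const_bound[where B=1]) auto
  show "expectation (\<lambda>\<omega>. iexp (A \<omega>)) = Complex (expectation (\<lambda>\<omega>. cos (A \<omega>))) (expectation (\<lambda>\<omega>. sin (A \<omega>)))"
    using integral_Re[OF ie] integral_Im[OF ie] by (simp add: complex_eq_iff Re_exp Im_exp)
qed

lemma norm_expectation_iexp_le: "A \<in> borel_measurable M \<Longrightarrow> norm (expectation (\<lambda>\<omega>. iexp (A \<omega>))) \<le> 1"
  using integral_norm_bound[of M "\<lambda>\<omega>. iexp (A \<omega>)"] by (simp add: prob_space)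

text \<open>
  The real and the imaginary part of the difference are sums of two covariances of sines and cosines.
\<close>

lemma norm_iexp_cov_le:
  assumes [measurable]: "A \<in> borel_measurable M" "B \<in> borel_measurable M"
    and b: "\<bar>cov M (\<lambda>\<omega>. cos (A \<omega>)) (\<lambda>\<omega>. cos (B \<omega>))\<bar> \<le> b" "\<bar>cov M (\<lambda>\<omega>. sin (A \<omega>)) (\<lambda>\<omega>. sin (B \<omega>))\<bar> \<le> b"
      "\<bar>cov M (\<lambda>\<omega>. cos (A \<omega>)) (\<lambda>\<omega>. sin (B \<omega>))\<bar> \<le> b" "\<bar>cov M (\<lambda>\<omega>. sin (A \<omega>)) (\<lambda>\<omega>. cos (B \<omega>))\<bar> \<le> b"
  shows "norm (expectation (\<lambda>\<omega>. iexp (A \<omega> + B \<omega>)) - expectation (\<lambda>\<omega>. iexp (A \<omega>)) * expectation (\<lambda>\<omega>. iexp (B \<omega>))) \<le> 4 * b"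
proof -
  have c: "cov M F G = expectation (\<lambda>\<omega>. F \<omega> * G \<omega>) - expectation F * expectation G" "integrable M (\<lambda>\<omega>. F \<omega> * G \<omega>)"
    if [measurable]: "F \<in> borel_measurable M" "G \<in> borel_measurable M" and bd: "\<And>\<omega>. \<bar>F \<omega>\<bar> \<le> 1" "\<And>\<omega>. \<bar>G \<omega>\<bar> \<le> 1"
    for F G :: "'a \<Rightarrow> real"
  proof -
    have i: "integrable M (\<lambda>\<omega>. (F \<omega>)\<^sup>2)" "integrable M (\<lambda>\<omega>. (G \<omega>)\<^sup>2)" by (rule L2_bounded[OF _ bd(1)], simp, rule L2_bounded[OF _ bd(2)], simp)
    show "cov M F G = expectation (\<lambda>\<omega>. F \<omega> * G \<omega>) - expectation F * expectation G"
      by (rule cov_eq[OF _ _ i]) auto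
    show "integrable M (\<lambda>\<omega>. F \<omega> * G \<omega>)" by (rule integrable_mult_L2[OF _ _ i]) auto
  qed
  let ?z = "expectation (\<lambda>\<omega>. iexp (A \<omega> + B \<omega>)) - expectation (\<lambda>\<omega>. iexp (A \<omega>)) * expectation (\<lambda>\<omega>. iexp (B \<omega>))"
  have AB: "(\<lambda>\<omega>. A \<omega> + B \<omega>) \<in> borel_measurable M" by measurable
  note e = integral_iexp(2)[OF AB] integral_iexp(2)[OF assms(1)] integral_iexp(2)[OF assms(2)]
  have "Re ?z = cov M (\<lambda>\<omega>. cos (A \<omega>)) (\<lambda>\<omega>. cos (B \<omega>)) - cov M (\<lambda>\<omega>. sin (A \<omega>)) (\<lambda>\<omega>. sin (B \<omega>))"
    "Im ?z = cov M (\<lambda>\<omega>. sin (A \<omega>)) (\<lambda>\<omega>. cos (B \<omega>)) + cov M (\<lambda>\<omega>. cos (A \<omega>)) (\<lambda>\<omega>. sin (B \<omega>))"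
    by (simp_all only: e) (simp_all add: c cos_add sin_add)
  then have "\<bar>Re ?z\<bar> \<le> 2 * b" "\<bar>Im ?z\<bar> \<le> 2 * b" using b by linarith+
  then show ?thesis using cmod_le[of ?z] by linarith
qed

end

context L2_field begin

text \<open>
  Dependence between the integral over one cube and that over finitely many other cubes of a
  lattice arrangement with corridors of width \<open>r\<close>. The bound grows with the volume of the single
  cube only.
\<close>

definition mixing :: "(nat \<Rightarrow> real) \<Rightarrow> bool" where
  "mixing \<theta> \<longleftrightarrow> (\<forall>r m K k L L' \<phi> \<psi>. 1 \<le> r \<longrightarrow> 0 < m \<longrightarrow> finite K \<longrightarrow>
     K \<subseteq> lattice_pts (1 / real (m + r)) \<longrightarrow> k \<in> lattice_pts (1 / real (m + r)) \<longrightarrow> k \<notin> K \<longrightarrow>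
     bdd_lipschitz L \<phi> \<longrightarrow> bdd_lipschitz L' \<psi> \<longrightarrow>
     \<bar>cov M (\<lambda>\<omega>. \<phi> (\<Sum>c\<in>K. S (hcube c (real m)) \<omega>)) (\<lambda>\<omega>. \<psi> (S (hcube k (real m)) \<omega>))\<bar>
       \<le> L * L' * real m ^ CARD('d) * \<theta> r)"

lemma S_Un:
  assumes "A \<in> sets borel" "bounded A" "B \<in> sets borel" "bounded B" "A \<inter> B = {}"
  shows "AE \<omega> in M. S (A \<union> B) \<omega> = S A \<omega> + S B \<omega>"
  using S_AE[OF assms(1,2)] S_AE[OF assms(3,4)]
  by eventually_elim (simp add: S_def set_integral_Un assms)

lemma S_UN:
  assumes "finite K" "\<And>c. c \<in> K \<Longrightarrow> A c \<in> sets borel" "\<And>c. c \<in> K \<Longrightarrow> bounded (A c)" "disjoint_family_on A K"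
  shows "AE \<omega> in M. S (\<Union>c\<in>K. A c) \<omega> = (\<Sum>c\<in>K. S (A c) \<omega>)"
  using assms
proof (induction K)
  case empty
  then show ?case by (simp add: S_def set_lebesgue_integral_def)
next
  case (insert k K)
  have d: "disjoint_family_on A K" using insert.prems(3) by (auto simp: disjoint_family_on_def)
  have "AE \<omega> in M. S (\<Union>c\<in>K. A c) \<omega> = (\<Sum>c\<in>K. S (A c) \<omega>)"
    by (rule insert.IH) (use insert.prems d in auto)
  moreover have "AE \<omega> in M. S (A k \<union> (\<Union>c\<in>K. A c)) \<omega> = S (A k) \<omega> + S (\<Union>c\<in>K. A c) \<omega>"
  proof (rule S_Un)
    show "A k \<inter> (\<Union>c\<in>K. A c) = {}"
      using insert.prems(3) insert.hyps by (auto simp: disjoint_family_on_def)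
  qed (use insert in \<open>auto intro!: sets.finite_UN\<close>)
  ultimately show ?case
    by eventually_elim (use insert.hyps in auto)
qed

text \<open>
  Split off one block after the other. Each step costs the dependence between one block and the remaining
  ones, and multiplication by a characteristic function does not increase the error made before.
\<close>

lemma blocks_factorize:
  fixes m r :: nat
  assumes mix: "mixing \<theta>" and "0 < s" "1 \<le> r" "0 < m"
    and K: "finite K" "K \<subseteq> lattice_pts (1 / real (m + r))"
  defines "B \<equiv> (\<lambda>c \<omega>. (S (hcube c (real m)) \<omega> - \<mu> * real m ^ CARD('d)) / s)"
  shows "norm (expectation (\<lambda>\<omega>. iexp (\<Sum>c\<in>K. B c \<omega>)) - expectation (\<lambda>\<omega>. iexp (B 0 \<omega>)) ^ card K)
     \<le> real (card K) * (4 * ((1 / s)\<^sup>2 * real m ^ CARD('d) * \<theta> r))"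
  using K
proof (induction K)
  case empty
  then show ?case by (simp add: prob_space)
next
  case (insert k K)
  have [measurable]: "B c \<in> borel_measurable M" for c unfolding B_def by measurable
  let ?z = "expectation (\<lambda>\<omega>. iexp (B 0 \<omega>))" and ?b = "(1 / s)\<^sup>2 * real m ^ CARD('d) * \<theta> r"
  let ?A = "\<lambda>\<omega>. \<Sum>c\<in>K. B c \<omega>" and ?a = "real (card K) * (\<mu> * real m ^ CARD('d))"
  note lip = bdd_lipschitz_cos_sin[OF \<open>0 < s\<close>]
  have A: "?A \<omega> = ((\<Sum>c\<in>K. S (hcube c (real m)) \<omega>) - ?a) / s" for \<omega>
    by (simp add: B_def sum_divide_distrib[symmetric] sum_subtractf)
  have mx: "\<bar>cov M (\<lambda>\<omega>. \<phi> (\<Sum>c\<in>K. S (hcube c (real m)) \<omega>)) (\<lambda>\<omega>. \<psi> (S (hcube k (real m)) \<omega>))\<bar> \<le> ?b"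
    if "bdd_lipschitz (1/s) \<phi>" "bdd_lipschitz (1/s) \<psi>" for \<phi> \<psi>
    using mix[unfolded mixing_def, rule_format, of r m K k "1/s" \<phi> "1/s" \<psi>] assms(3,4) insert that
    by (simp add: power2_eq_square)
  have ind: "norm (expectation (\<lambda>\<omega>. iexp (?A \<omega> + B k \<omega>))
      - expectation (\<lambda>\<omega>. iexp (?A \<omega>)) * expectation (\<lambda>\<omega>. iexp (B k \<omega>))) \<le> 4 * ?b"
    unfolding A unfolding B_def
    by (rule norm_iexp_cov_le; (intro mx lip)?) measurable
  have kz: "expectation (\<lambda>\<omega>. iexp (B k \<omega>)) = ?z"
  proof -
    have k: "k \<in> lattice_pts 1"
      by (rule subsetD[OF lattice_pts_inverse_nat_subset[of "m + r"]]) (use insert.prems in auto)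
    show ?thesis
      using block_law[OF lip(1)[of "\<mu> * real m ^ CARD('d)"] k, of m] block_law[OF lip(2)[of "\<mu> * real m ^ CARD('d)"] k, of m]
      by (simp add: integral_iexp(2)) (simp add: B_def)
  qed
  have "norm (expectation (\<lambda>\<omega>. iexp (?A \<omega>)) * ?z - ?z ^ card K * ?z)
      = norm (expectation (\<lambda>\<omega>. iexp (?A \<omega>)) - ?z ^ card K) * norm ?z"
    by (simp add: norm_mult[symmetric] left_diff_distrib)
  also have "\<dots> \<le> norm (expectation (\<lambda>\<omega>. iexp (?A \<omega>)) - ?z ^ card K) * 1"
    by (intro mult_left_mono norm_expectation_iexp_le) auto
  also have "\<dots> \<le> real (card K) * (4 * ?b)" using insert by simp
  finally have 2: "norm (expectation (\<lambda>\<omega>. iexp (?A \<omega>)) * ?z - ?z ^ card K * ?z) \<le> real (card K) * (4 * ?b)" .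
  have "norm (expectation (\<lambda>\<omega>. iexp (?A \<omega> + B k \<omega>)) - ?z ^ card K * ?z) \<le> 4 * ?b + real (card K) * (4 * ?b)"
    using norm_triangle_mono[OF ind 2] by (simp add: kz)
  then show ?case
    using insert.hyps by (simp add: add.commute mult.commute distrib_left distrib_right)
qed

text \<open>
  Both numbers have modulus at most one, so their \<open>N\<close>-th powers differ by at most \<open>N\<close> times their distance.
  The distance is that between the characteristic function of the block at \<open>1 / s\<close> and its second order
  Taylor polynomial, and from there to the exponential.
\<close>

lemma block_char_expansion:
  fixes m :: nat
  assumes "0 < s"
  defines "X \<equiv> (\<lambda>\<omega>. S (hcube 0 (real m)) \<omega> - \<mu> * real m ^ CARD('d))"
  shows "norm (expectation (\<lambda>\<omega>. iexp (X \<omega> / s)) ^ N - of_real (exp (- (block_variance m * N / (2 * s\<^sup>2)))))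
     \<le> real N / s\<^sup>2 * (expectation (\<lambda>\<omega>. min (6 * (X \<omega>)\<^sup>2) (\<bar>1 / s\<bar> * \<bar>X \<omega>\<bar> ^ 3)) / 6 + (block_variance m)\<^sup>2 / (4 * s\<^sup>2))"
proof -
  have H: "hcube (0::real^'d) (real m) \<in> sets borel" "bounded (hcube (0::real^'d) (real m))" by (auto simp: bounded_hcube)
  have Xm[measurable]: "X \<in> borel_measurable M" unfolding X_def by measurable
  have XL2: "integrable M (\<lambda>\<omega>. (X \<omega>)\<^sup>2)" unfolding X_def by (intro L2_diff S_L2 H) auto
  have X0: "expectation X = 0" unfolding X_def using integrable_S[OF H] by (simp add: S_mean[OF H] measure_hcube prob_space)
  let ?V = "block_variance m" and ?z = "expectation (\<lambda>\<omega>. iexp (X \<omega> / s))"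
    and ?e = "expectation (\<lambda>\<omega>. min (6 * (X \<omega>)\<^sup>2) (\<bar>1 / s\<bar> * \<bar>X \<omega>\<bar> ^ 3))"
  have V0: "0 \<le> ?V" by (simp add: block_variance_def)
  have "?z = char (distr M borel X) (1 / s)"
    unfolding char_def by (subst integral_distr) (auto simp: divide_inverse mult.commute)
  moreover have "cmod (char (distr M borel X) (1 / s) - (1 - (1 / s)\<^sup>2 * ?V / 2)) \<le> ((1 / s)\<^sup>2 / 6) * ?e"
    using integrable_of_L2[OF Xm XL2] XL2 X0
    by (intro char_approx3'[OF Xm]) (auto simp: block_variance_def X_def)
  ultimately have 1: "norm (?z - of_real (1 - ?V / (2 * s\<^sup>2))) \<le> ?e / (6 * s\<^sup>2)"
    by (simp add: power_divide mult.commute)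
  have "norm (of_real (1 - ?V / (2 * s\<^sup>2)) - of_real (exp (- (?V / (2 * s\<^sup>2)))) :: complex) \<le> (?V / (2 * s\<^sup>2))\<^sup>2"
    unfolding of_real_diff[symmetric] norm_of_real using V0 by (intro abs_exp_minus_le) simp
  from norm_triangle_mono[OF 1 this]
  have 2: "norm (?z - of_real (exp (- (?V / (2 * s\<^sup>2))))) \<le> ?e / (6 * s\<^sup>2) + (?V / (2 * s\<^sup>2))\<^sup>2" by simp
  have "norm (?z ^ N - of_real (exp (- (?V / (2 * s\<^sup>2)))) ^ N) \<le> real N * norm (?z - of_real (exp (- (?V / (2 * s\<^sup>2)))))"
    by (rule norm_power_diff) (use norm_expectation_iexp_le[of "\<lambda>\<omega>. X \<omega> / s"] V0 in auto)
  also have "\<dots> \<le> real N * (?e / (6 * s\<^sup>2) + (?V / (2 * s\<^sup>2))\<^sup>2)" by (intro mult_left_mono 2) simp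
  also have "\<dots> = real N / s\<^sup>2 * (?e / 6 + ?V\<^sup>2 / (4 * s\<^sup>2))"
    using assms(1) by (simp add: field_simps power2_eq_square)
  also have "(of_real (exp (- (?V / (2 * s\<^sup>2)))) :: complex) ^ N = of_real (exp (- (?V * N / (2 * s\<^sup>2))))"
    unfolding of_real_power[symmetric] exp_of_nat_mult[symmetric] by (simp add: mult.commute)
  finally show ?thesis .
qed

text \<open>
  The two arguments of \<open>iexp\<close> differ by the normalized integral over what the blocks leave free, whose second
  moment is at most its share of the volume times the integral of \<open>\<bar>C\<bar>\<close>.
\<close>

lemma block_approximation:
  fixes m r :: nat
  assumes C: "integrable lborel C" and W: "W \<in> sets borel" "bounded W" "0 < measure lborel W" and m: "0 < m"
  defines "s \<equiv> sqrt (measure lborel W)" and "K \<equiv> cells (m + r) W"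
  shows "norm (expectation (\<lambda>\<omega>. iexp ((S W \<omega> - \<mu> * measure lborel W) / s))
      - expectation (\<lambda>\<omega>. iexp (\<Sum>c\<in>K. (S (hcube c (real m)) \<omega> - \<mu> * real m ^ CARD('d)) / s)))
     \<le> sqrt ((1 - real (card K) / measure lborel W * real m ^ CARD('d)) * (\<integral>u. \<bar>C u\<bar> \<partial>lborel))"
proof -
  have s: "0 < s" "s\<^sup>2 = measure lborel W" using W(3) by (auto simp: s_def)
  define U where "U = (\<Union>c\<in>K. hcube c (real m))"
  have fin: "finite K" unfolding K_def using W m by (intro finite_cells) auto
  have Klat: "K \<subseteq> lattice_pts (1 / real (m + r))" by (auto simp: K_def cells_def)
  have UW: "U \<subseteq> W" using hcube_mono[of "real m" "real (m + r)"] by (force simp: U_def K_def cells_def)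
  have U[measurable]: "U \<in> sets borel" unfolding U_def using fin by auto
  have bU: "bounded U" using UW W(2) bounded_subset by blast
  have mU: "measure lborel U = real (card K) * real m ^ CARD('d)"
    unfolding U_def by (rule measure_UN_hcube[OF fin Klat])
  define R where "R = W - U"
  have R: "R \<in> sets borel" "bounded R" using W by (auto simp: R_def intro: bounded_subset)
  have mR: "measure lborel R = measure lborel W - measure lborel U"
    unfolding R_def using emeasure_lborel_bounded[OF W(2)] W(1) UW by (intro measure_Diff) auto
  have Sm[measurable]: "S W \<in> borel_measurable M" "S R \<in> borel_measurable M" using W R by auto
  have d: "disjoint_family_on (\<lambda>c. hcube c (real m)) K"
    unfolding disjoint_family_on_def using hcube_disjoint[of _ m r] Klat by (metis subsetD)
  have AE1: "AE \<omega> in M. S U \<omega> = (\<Sum>c\<in>K. S (hcube c (real m)) \<omega>)"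
    unfolding U_def by (rule S_UN[OF fin _ _ d]) (auto simp: bounded_hcube)
  have "U \<union> R = W" using UW by (auto simp: R_def)
  then have AE2: "AE \<omega> in M. S W \<omega> = S U \<omega> + S R \<omega>"
    using S_Un[OF U bU R] by (auto simp: R_def)
  let ?A = "\<lambda>\<omega>. (S W \<omega> - \<mu> * measure lborel W) / s"
    and ?B = "\<lambda>\<omega>. \<Sum>c\<in>K. (S (hcube c (real m)) \<omega> - \<mu> * real m ^ CARD('d)) / s"
    and ?D = "\<lambda>\<omega>. (S R \<omega> - \<mu> * measure lborel R) / s"
  have AE: "AE \<omega> in M. \<bar>?A \<omega> - ?B \<omega>\<bar> = \<bar>?D \<omega>\<bar>"
    using AE1 AE2
  proof eventually_elim
    case (elim \<omega>)
    have "?A \<omega> - ?B \<omega> = ?D \<omega>"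
      using elim by (simp add: sum_divide_distrib[symmetric] sum_subtractf diff_divide_distrib[symmetric] mR mU algebra_simps)
    then show ?case by simp
  qed
  have DL2: "integrable M (\<lambda>\<omega>. (?D \<omega>)\<^sup>2)"
    using L2_cmult[of "\<lambda>\<omega>. S R \<omega> - \<mu> * measure lborel R" "1 / s"] L2_diff[OF _ _ S_L2[OF R], of "\<lambda>_. \<mu> * measure lborel R"]
    by (simp add: R)
  have iD: "integrable M ?D" by (rule integrable_of_L2[OF _ DL2]) (use R in measurable)
  have "norm (expectation (\<lambda>\<omega>. iexp (?A \<omega>)) - expectation (\<lambda>\<omega>. iexp (?B \<omega>)))
      = norm (expectation (\<lambda>\<omega>. iexp (?A \<omega>) - iexp (?B \<omega>)))"
    by (subst Bochner_Integration.integral_diff) (rule integral_iexp(1), measurable)+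
  also have "\<dots> \<le> expectation (\<lambda>\<omega>. norm (iexp (?A \<omega>) - iexp (?B \<omega>)))" by (rule integral_norm_bound)
  also have "\<dots> \<le> expectation (\<lambda>\<omega>. \<bar>?D \<omega>\<bar>)"
  proof (rule integral_mono_AE)
    show "integrable M (\<lambda>\<omega>. norm (iexp (?A \<omega>) - iexp (?B \<omega>)))"
      by (intro integrable_norm Bochner_Integration.integrable_diff integral_iexp(1)) auto
    show "integrable M (\<lambda>\<omega>. \<bar>?D \<omega>\<bar>)" using iD by (rule integrable_abs)
    show "AE \<omega> in M. norm (iexp (?A \<omega>) - iexp (?B \<omega>)) \<le> \<bar>?D \<omega>\<bar>"
      using AE by eventually_elim (use norm_iexp_diff_le in metis)
  qed
  also have "\<dots> \<le> sqrt (expectation (\<lambda>\<omega>. (?D \<omega>)\<^sup>2))"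
    by (rule expectation_abs_le_L2[OF _ DL2]) (use R in measurable)
  also have "expectation (\<lambda>\<omega>. (?D \<omega>)\<^sup>2) \<le> measure lborel R * (\<integral>u. \<bar>C u\<bar> \<partial>lborel) / s\<^sup>2"
    using S_variance_le[OF R C] by (simp add: power_divide divide_right_mono)
  also have "measure lborel R * (\<integral>u. \<bar>C u\<bar> \<partial>lborel) / s\<^sup>2
      = (1 - real (card K) / measure lborel W * real m ^ CARD('d)) * (\<integral>u. \<bar>C u\<bar> \<partial>lborel)"
    using W(3) unfolding s(2) mR mU by (simp add: field_simps)
  finally show ?thesis by simp
qed

text \<open>
  For fixed \<open>r\<close> the distance to the limit is bounded by the sum \<open>G r n\<close> of the errors of the three steps, plus
  the error in the variance. It tends to \<open>g r\<close> as \<open>n\<close> grows, and \<open>g r\<close> tends to zero.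
\<close>

theorem mixing_CLT:
  assumes C: "integrable lborel C" and mix: "mixing \<theta>" and \<theta>: "\<theta> \<longlonglongrightarrow> 0" and VH: "VH_growing W"
  shows "(\<lambda>n. expectation (\<lambda>\<omega>. iexp ((S (W n) \<omega> - \<mu> * measure lborel (W n)) / sqrt (measure lborel (W n)))))
     \<longlonglongrightarrow> of_real (exp (- ((\<integral>u. C u \<partial>lborel) / 2)))"
proof -
  define \<Lambda> where "\<Lambda> n = measure lborel (W n)" for n
  have W: "compact (W n)" and \<Lambda>0: "0 < \<Lambda> n" for n using VH by (auto simp: VH_growing_def \<Lambda>_def)
  have Wb: "W n \<in> sets borel" "bounded (W n)" for n using W by (auto intro: borel_compact compact_imp_bounded)
  have \<Lambda>top: "filterlim \<Lambda> at_top sequentially" unfolding \<Lambda>_def by (rule VH_growing_volume[OF VH])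
  define \<sigma> I where "\<sigma> = (\<integral>u. C u \<partial>lborel)" and "I = (\<integral>u. \<bar>C u\<bar> \<partial>lborel)"
  define a where "a n = expectation (\<lambda>\<omega>. iexp ((S (W n) \<omega> - \<mu> * \<Lambda> n) / sqrt (\<Lambda> n)))" for n
  \<comment> \<open>blocks of side \<open>r\<^sup>2\<close> separated by corridors of width \<open>r\<close>\<close>
  define m where "m r = r ^ 2" for r :: nat
  define N where "N r n = card (cells (m r + r) (W n))" for r n
  define V where "V r = block_variance (m r)" for r
  define X where "X r \<omega> = S (hcube 0 (real (m r))) \<omega> - \<mu> * real (m r) ^ CARD('d)" for r \<omega>
  define e where "e r n = expectation (\<lambda>\<omega>. min (6 * (X r \<omega>)\<^sup>2) (\<bar>1 / sqrt (\<Lambda> n)\<bar> * \<bar>X r \<omega>\<bar> ^ 3))" for r n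
  define G where "G r n = sqrt ((1 - real (N r n) / \<Lambda> n * real (m r) ^ CARD('d)) * I)
      + 4 * (real (N r n) / \<Lambda> n) * real (m r) ^ CARD('d) * \<theta> r
      + real (N r n) / \<Lambda> n * (e r n / 6 + (V r)\<^sup>2 / (4 * \<Lambda> n))
      + \<bar>exp (- (V r * (real (N r n) / \<Lambda> n) / 2)) - exp (- (\<sigma> / 2))\<bar>" for r n
  define q where "q r = real (m r) ^ CARD('d) / real (m r + r) ^ CARD('d)" for r
  define g where "g r = sqrt ((1 - q r) * I) + 4 * q r * \<theta> r
      + \<bar>exp (- (V r / real (m r) ^ CARD('d) * q r / 2)) - exp (- (\<sigma> / 2))\<bar>" for r
  have bound: "norm (a n - of_real (exp (- (\<sigma> / 2)))) \<le> G r n" if r: "1 \<le> r" for r n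
  proof -
    let ?s = "sqrt (\<Lambda> n)" and ?K = "cells (m r + r) (W n)"
    let ?B = "\<lambda>c \<omega>. (S (hcube c (real (m r))) \<omega> - \<mu> * real (m r) ^ CARD('d)) / ?s"
    have mr: "0 < m r" using r by (simp add: m_def)
    have s: "0 < ?s" "?s\<^sup>2 = \<Lambda> n" using \<Lambda>0[of n] by auto
    have fin: "finite ?K" using Wb mr by (intro finite_cells) auto
    have K: "?K \<subseteq> lattice_pts (1 / real (m r + r))" by (auto simp: cells_def)
    have 1: "norm (a n - expectation (\<lambda>\<omega>. iexp (\<Sum>c\<in>?K. ?B c \<omega>))) \<le> sqrt ((1 - real (N r n) / \<Lambda> n * real (m r) ^ CARD('d)) * I)"
      using block_approximation[OF C Wb \<Lambda>0[unfolded \<Lambda>_def] mr, of n r] by (simp add: a_def N_def I_def \<Lambda>_def)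
    have 2: "norm (expectation (\<lambda>\<omega>. iexp (\<Sum>c\<in>?K. ?B c \<omega>)) - expectation (\<lambda>\<omega>. iexp (?B 0 \<omega>)) ^ N r n)
        \<le> 4 * (real (N r n) / \<Lambda> n) * real (m r) ^ CARD('d) * \<theta> r"
      using blocks_factorize[OF mix s(1) r mr fin K] s(2) by (simp add: N_def power_divide algebra_simps)
    have 3: "norm (expectation (\<lambda>\<omega>. iexp (?B 0 \<omega>)) ^ N r n - of_real (exp (- (V r * (real (N r n) / \<Lambda> n) / 2))))
        \<le> real (N r n) / \<Lambda> n * (e r n / 6 + (V r)\<^sup>2 / (4 * \<Lambda> n))"
      using block_char_expansion[OF s(1), of "m r" "N r n"] unfolding s(2) e_def X_def V_def by (simp add: mult.commute)
    have 4: "norm (of_real (exp (- (V r * (real (N r n) / \<Lambda> n) / 2))) - of_real (exp (- (\<sigma> / 2))) :: complex)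
        \<le> \<bar>exp (- (V r * (real (N r n) / \<Lambda> n) / 2)) - exp (- (\<sigma> / 2))\<bar>"
      unfolding of_real_diff[symmetric] norm_of_real by simp
    show ?thesis
      using norm_triangle_mono[OF norm_triangle_mono[OF norm_triangle_mono[OF 1 2] 3] 4] by (simp add: G_def)
  qed
  have Glim: "(\<lambda>n. G r n) \<longlonglongrightarrow> g r" if r: "1 \<le> r" for r
  proof -
    have mr: "0 < m r + r" using r by simp
    have Nlim: "(\<lambda>n. real (N r n) / \<Lambda> n) \<longlonglongrightarrow> 1 / real (m r + r) ^ CARD('d)"
      unfolding N_def \<Lambda>_def by (rule cells_volume_ratio(1)[OF VH mr])
    have Xm[measurable]: "X r \<in> borel_measurable M" unfolding X_def[abs_def] by measurable
    have XL2: "integrable M (\<lambda>\<omega>. (X r \<omega>)\<^sup>2)"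
      unfolding X_def by (intro L2_diff S_L2) (auto simp: bounded_hcube)
    have inv0: "(\<lambda>n. 1 / \<Lambda> n) \<longlonglongrightarrow> 0"
      by (rule tendsto_divide_0[OF tendsto_const filterlim_at_top_imp_at_infinity[OF \<Lambda>top]])
    have elim: "(\<lambda>n. e r n) \<longlonglongrightarrow> expectation (\<lambda>\<omega>. 0)"
      unfolding e_def
    proof (rule integral_dominated_convergence[where w="\<lambda>\<omega>. 6 * (X r \<omega>)\<^sup>2"])
      show "AE \<omega> in M. (\<lambda>n. min (6 * (X r \<omega>)\<^sup>2) (\<bar>1 / sqrt (\<Lambda> n)\<bar> * \<bar>X r \<omega>\<bar> ^ 3)) \<longlonglongrightarrow> 0"
      proof (rule AE_I2)
        fix \<omega>
        have "(\<lambda>n. sqrt (1 / \<Lambda> n)) \<longlonglongrightarrow> sqrt 0" by (intro tendsto_intros inv0)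
        then have "(\<lambda>n. \<bar>1 / sqrt (\<Lambda> n)\<bar>) \<longlonglongrightarrow> 0"
          using \<Lambda>0 by (simp add: real_sqrt_divide less_imp_le)
        then have "(\<lambda>n. min (6 * (X r \<omega>)\<^sup>2) (\<bar>1 / sqrt (\<Lambda> n)\<bar> * \<bar>X r \<omega>\<bar> ^ 3)) \<longlonglongrightarrow> min (6 * (X r \<omega>)\<^sup>2) (0 * \<bar>X r \<omega>\<bar> ^ 3)"
          by (intro tendsto_intros)
        then show "(\<lambda>n. min (6 * (X r \<omega>)\<^sup>2) (\<bar>1 / sqrt (\<Lambda> n)\<bar> * \<bar>X r \<omega>\<bar> ^ 3)) \<longlonglongrightarrow> 0" by simp
      qed
    qed (use XL2 in auto)
    then have elim0: "(\<lambda>n. e r n) \<longlonglongrightarrow> 0" by simp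
    define R where "R n = real (N r n) / \<Lambda> n" for n
    have Rlim: "R \<longlonglongrightarrow> 1 / real (m r + r) ^ CARD('d)" using Nlim by (simp add: R_def[abs_def])
    have "G r n = sqrt ((1 - R n * real (m r) ^ CARD('d)) * I) + 4 * R n * real (m r) ^ CARD('d) * \<theta> r
      + R n * (e r n / 6 + (V r)\<^sup>2 / 4 * (1 / \<Lambda> n)) + \<bar>exp (- (V r * R n / 2)) - exp (- (\<sigma> / 2))\<bar>" for n
      by (simp add: G_def R_def)
    moreover have "(\<lambda>n. sqrt ((1 - R n * real (m r) ^ CARD('d)) * I) + 4 * R n * real (m r) ^ CARD('d) * \<theta> r
      + R n * (e r n / 6 + (V r)\<^sup>2 / 4 * (1 / \<Lambda> n)) + \<bar>exp (- (V r * R n / 2)) - exp (- (\<sigma> / 2))\<bar>)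
      \<longlonglongrightarrow> sqrt ((1 - 1 / real (m r + r) ^ CARD('d) * real (m r) ^ CARD('d)) * I)
      + 4 * (1 / real (m r + r) ^ CARD('d)) * real (m r) ^ CARD('d) * \<theta> r
      + 1 / real (m r + r) ^ CARD('d) * (0 / 6 + (V r)\<^sup>2 / 4 * 0)
      + \<bar>exp (- (V r * (1 / real (m r + r) ^ CARD('d)) / 2)) - exp (- (\<sigma> / 2))\<bar>"
      by (intro tendsto_intros Rlim elim0 inv0) simp_all
    moreover have "V r * (1 / real (m r + r) ^ CARD('d)) = V r / real (m r) ^ CARD('d) * q r"
      using r by (simp add: q_def m_def)
    moreover have "m r \<noteq> 0" using r by (simp add: m_def)
    ultimately show ?thesis by (simp add: g_def q_def mult.commute)
  qed
  have "g \<longlonglongrightarrow> 0"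
  proof -
    have q: "q \<longlonglongrightarrow> 1"
    proof -
      have "(\<lambda>r. (1 - 1 / real (Suc r)) ^ CARD('d)) \<longlonglongrightarrow> (1 - 0) ^ CARD('d)"
        using LIMSEQ_inverse_real_of_nat by (intro tendsto_intros) (simp add: inverse_eq_divide)
      moreover have "\<forall>\<^sub>F r in sequentially. (1 - 1 / real (Suc r)) ^ CARD('d) = q r"
        using eventually_gt_at_top[of 0]
      proof eventually_elim
        case (elim r)
        have "real (m r) = real r * real r" "real (m r + r) = real r * real (Suc r)"
          by (simp_all add: m_def power2_eq_square algebra_simps)
        then have "real (m r) / real (m r + r) = real r / real (Suc r)" using elim by simp
        also have "\<dots> = 1 - 1 / real (Suc r)" by (simp add: field_simps)
        finally have "real (m r) / real (m r + r) = 1 - 1 / real (Suc r)" .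
        then show ?case by (simp add: q_def power_divide[symmetric])
      qed
      ultimately show ?thesis by (simp add: tendsto_cong)
    qed
    have mtop: "filterlim m at_top sequentially"
      unfolding m_def by (rule filterlim_at_top_mono[OF filterlim_ident]) (auto simp: power2_eq_square)
    have v: "(\<lambda>r. V r / real (m r) ^ CARD('d)) \<longlonglongrightarrow> \<sigma>"
      unfolding V_def \<sigma>_def by (rule filterlim_compose[OF block_variance_lim[OF C] mtop])
    have "g \<longlonglongrightarrow> sqrt ((1 - 1) * I) + 4 * 1 * 0 + \<bar>exp (- (\<sigma> * 1 / 2)) - exp (- (\<sigma> / 2))\<bar>"
      unfolding g_def[abs_def] by (intro tendsto_intros q v \<theta>) simp_all
    then show ?thesis by simp
  qed
  have "a \<longlonglongrightarrow> of_real (exp (- (\<sigma> / 2)))"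
  proof (rule LIMSEQ_I)
    fix \<epsilon> :: real assume "0 < \<epsilon>"
    then have "\<forall>\<^sub>F r in sequentially. g r < \<epsilon>" using \<open>g \<longlonglongrightarrow> 0\<close> by (rule order_tendstoD(2)[rotated])
    then have "\<forall>\<^sub>F r in sequentially. g r < \<epsilon> \<and> 1 \<le> r"
      using eventually_ge_at_top[of 1] by (rule eventually_conj)
    then obtain r where r: "g r < \<epsilon>" "1 \<le> r" by (auto simp: eventually_sequentially)
    have "\<forall>\<^sub>F n in sequentially. G r n < \<epsilon>" by (rule order_tendstoD(2)[OF Glim[OF r(2)] r(1)])
    then have "\<forall>\<^sub>F n in sequentially. norm (a n - of_real (exp (- (\<sigma> / 2)))) < \<epsilon>"
      by eventually_elim (use bound[OF r(2)] in \<open>rule le_less_trans\<close>)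
    then show "\<exists>no. \<forall>n\<ge>no. norm (a n - of_real (exp (- (\<sigma> / 2)))) < \<epsilon>" by (simp add: eventually_sequentially)
  qed
  then show ?thesis by (simp add: a_def[abs_def] \<Lambda>_def \<sigma>_def)
qed

end

section \<open>From Riemann sums to mixing\<close>

lemma cov_cong_AE:
  assumes [measurable]: "Y \<in> borel_measurable M" "Y' \<in> borel_measurable M" "V \<in> borel_measurable M" "V' \<in> borel_measurable M"
    and "AE \<omega> in M. Y \<omega> = Y' \<omega>" "AE \<omega> in M. V \<omega> = V' \<omega>"
  shows "cov M Y V = cov M Y' V'"
proof -
  have "integral\<^sup>L M Y = integral\<^sup>L M Y'" "integral\<^sup>L M V = integral\<^sup>L M V'"
    using assms by (auto intro!: integral_cong_AE)
  then show ?thesis unfolding cov_def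
    by (intro integral_cong_AE) (use assms(5,6) in \<open>auto elim: eventually_elim2\<close>)
qed

lemma cov_minus_left: "cov M (\<lambda>\<omega>. - Y \<omega>) V = - cov M Y V"
proof -
  have "(\<lambda>\<omega>. (- Y \<omega> - - integral\<^sup>L M Y) * (V \<omega> - integral\<^sup>L M V))
      = (\<lambda>\<omega>. - ((Y \<omega> - integral\<^sup>L M Y) * (V \<omega> - integral\<^sup>L M V)))"
    by (auto simp: algebra_simps)
  then show ?thesis unfolding cov_def by simp
qed

lemma bdd_lipschitz_minus: "bdd_lipschitz L \<phi> \<Longrightarrow> bdd_lipschitz L (\<lambda>x. - \<phi> x)"
  by (simp add: bdd_lipschitz_def abs_minus_commute)

lemma mesh_at_top: "filterlim (\<lambda>n. real (n + 2)) at_top sequentially"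
  by (rule filterlim_compose[OF filterlim_real_sequentially]) (rule filterlim_add_const_nat_at_top)

definition separated :: "nat \<Rightarrow> (real^'d) set \<Rightarrow> (real^'d) set \<Rightarrow> bool" where
  "separated r U V \<longleftrightarrow> (\<forall>x\<in>U. \<forall>y\<in>V. \<exists>i. real r < \<bar>x $ i - y $ i\<bar>)"

text \<open>
  Regions that are resolved exactly by the grids of mesh \<open>1 / 2, 1 / 3, \<dots>\<close>. The refinement starts
  at \<open>2\<close> because \<open>BL_dependent\<close> speaks about \<open>\<Delta> > 1\<close> only.
\<close>

definition grid_region :: "(real^'d) set \<Rightarrow> bool" where
  "grid_region U \<longleftrightarrow> U \<in> sets borel \<and> bounded U \<and> U \<noteq> {} \<and> (\<forall>n. grid_aligned (real (n + 2)) U)"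

abbreviation grid_pts :: "nat \<Rightarrow> (real^'d) set \<Rightarrow> (real^'d) set" where
  "grid_pts n U \<equiv> lattice_pts (real (n + 2)) \<inter> U"

lemma grid_regionD:
  fixes U :: "(real^'d) set"
  assumes "grid_region U"
  shows "U \<in> sets borel" "bounded U" "grid_aligned (real (n + 2)) U" "finite (grid_pts n U)" "grid_pts n U \<noteq> {}"
    "(1 / real (n + 2)) ^ CARD('d) * real (card (grid_pts n U)) = measure lborel U"
proof -
  show U: "U \<in> sets borel" "bounded U" and a: "grid_aligned (real (n + 2)) U" for n
    using assms unfolding grid_region_def by blast+
  show "finite (grid_pts n U)" using U by (intro finite_lattice_Int) auto
  obtain x where "x \<in> U" using assms by (auto simp: grid_region_def)
  then have "grid_floor (real (n + 2)) x \<in> grid_pts n U"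
    using a[of n] grid_floor_in_lattice by (auto simp: grid_aligned_def)
  then show "grid_pts n U \<noteq> {}" by blast
  show "(1 / real (n + 2)) ^ CARD('d) * real (card (grid_pts n U)) = measure lborel U"
    using U a by (intro card_lattice_Int) auto
qed

context L2_field begin

text \<open>
  It is enough to bound the covariances of Riemann sums by a convergent sequence with a suitable limit: both the
  block and the union of the other blocks are resolved by every grid.
\<close>

lemma mixingI:
  assumes \<theta>: "\<And>r. 1 \<le> r \<Longrightarrow> 0 \<le> \<theta> r"
    and bound: "\<And>r U V L L' \<phi> \<psi>. 1 \<le> r \<Longrightarrow> grid_region U \<Longrightarrow> grid_region V \<Longrightarrow> separated r U V \<Longrightarrow>
      bdd_lipschitz L \<phi> \<Longrightarrow> bdd_lipschitz L' \<psi> \<Longrightarrow>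
      \<exists>b \<beta>. b \<longlonglongrightarrow> \<beta> \<and> \<beta> \<le> L * L' * measure lborel V * \<theta> r \<and>
        (\<forall>n. \<bar>cov M (\<lambda>\<omega>. \<phi> (riemann (real (n + 2)) U \<omega>)) (\<lambda>\<omega>. \<psi> (riemann (real (n + 2)) V \<omega>))\<bar> \<le> b n)"
  shows "mixing \<theta>"
  unfolding mixing_def
proof (intro allI impI)
  fix r m :: nat and K :: "(real^'d) set" and k L L' \<phi> \<psi>
  assume r: "1 \<le> r" and m: "0 < m" and K: "finite K" "K \<subseteq> lattice_pts (1 / real (m + r))"
    and k: "k \<in> lattice_pts (1 / real (m + r))" "k \<notin> K"
    and \<phi>: "bdd_lipschitz L \<phi>" and \<psi>: "bdd_lipschitz L' \<psi>"
  let ?cov = "cov M (\<lambda>\<omega>. \<phi> (\<Sum>c\<in>K. S (hcube c (real m)) \<omega>)) (\<lambda>\<omega>. \<psi> (S (hcube k (real m)) \<omega>))"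
  note [measurable] = bdd_lipschitzD(4)[OF \<phi>] bdd_lipschitzD(4)[OF \<psi>]
  show "\<bar>?cov\<bar> \<le> L * L' * real m ^ CARD('d) * \<theta> r"
  proof (cases "K = {}")
    case True
    have "?cov = 0" unfolding cov_def by (simp add: True prob_space)
    then show ?thesis using \<theta>[OF r] bdd_lipschitzD(3)[OF \<phi>] bdd_lipschitzD(3)[OF \<psi>] by simp
  next
    case False
    define U V where "U = (\<Union>c\<in>K. hcube c (real m))" and "V = hcube k (real m)"
    have al: "grid_aligned (real (n + 2)) (hcube c (real m))" if "c \<in> lattice_pts (1 / real (m + r))" for c and n :: nat
      by (rule grid_aligned_hcube) (use that lattice_pts_inverse_nat_subset in blast, simp)
    have U: "grid_region U" unfolding grid_region_def
    proof (intro conjI allI)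
      show "U \<in> sets borel" "bounded U" using K by (auto simp: U_def bounded_hcube)
      show "U \<noteq> {}" using False corner_in_hcube[of "real m"] m by (auto simp: U_def)
      show "grid_aligned (real (n + 2)) U" for n
        unfolding U_def by (rule grid_aligned_UN, rule al) (use K in auto)
    qed
    have V: "grid_region V" unfolding grid_region_def
    proof (intro conjI allI)
      show "V \<noteq> {}" using corner_in_hcube[of "real m" k] m by (auto simp: V_def)
      show "grid_aligned (real (n + 2)) V" for n unfolding V_def by (rule al[OF k(1)])
    qed (auto simp: V_def bounded_hcube)
    have sep: "separated r U V" unfolding separated_def
    proof (intro ballI)
      fix x y assume "x \<in> U" "y \<in> V"
      then obtain c where c: "c \<in> K" "x \<in> hcube c (real m)" by (auto simp: U_def)
      show "\<exists>i. real r < \<bar>x $ i - y $ i\<bar>"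
        by (rule hcube_separated[of c m r k]) (use c K k \<open>y \<in> V\<close> in \<open>auto simp: V_def\<close>)
    qed
    note Ud = grid_regionD[OF U] and Vd = grid_regionD[OF V]
    obtain b \<beta> where b: "b \<longlonglongrightarrow> \<beta>" "\<beta> \<le> L * L' * measure lborel V * \<theta> r"
      "\<And>n. \<bar>cov M (\<lambda>\<omega>. \<phi> (riemann (real (n + 2)) U \<omega>)) (\<lambda>\<omega>. \<psi> (riemann (real (n + 2)) V \<omega>))\<bar> \<le> b n"
      using bound[OF r U V sep \<phi> \<psi>] by blast
    have iR: "integrable M (riemann (real (n + 2)) A)" for n A
      unfolding riemann_def[abs_def] using integrable_Z by auto
    have "(\<lambda>n. cov M (\<lambda>\<omega>. \<phi> (riemann (real (n + 2)) U \<omega>)) (\<lambda>\<omega>. \<psi> (riemann (real (n + 2)) V \<omega>)))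
        \<longlonglongrightarrow> cov M (\<lambda>\<omega>. \<phi> (S U \<omega>)) (\<lambda>\<omega>. \<psi> (S V \<omega>))"
      by (rule tendsto_cov_lipschitz(2)[OF \<phi> \<psi>])
         (use Ud Vd iR integrable_S riemann_L1[OF Ud(1,2,3) _ mesh_at_top] riemann_L1[OF Vd(1,2,3) _ mesh_at_top] in auto)
    from tendsto_rabs[OF this] b(1) have "\<bar>cov M (\<lambda>\<omega>. \<phi> (S U \<omega>)) (\<lambda>\<omega>. \<psi> (S V \<omega>))\<bar> \<le> \<beta>"
      by (rule LIMSEQ_le) (use b(3) in blast)
    moreover have "cov M (\<lambda>\<omega>. \<phi> (S U \<omega>)) (\<lambda>\<omega>. \<psi> (S V \<omega>)) = ?cov"
    proof (rule cov_cong_AE)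
      have "disjoint_family_on (\<lambda>c. hcube c (real m)) K"
        unfolding disjoint_family_on_def using hcube_disjoint[of _ m r] K by (metis subsetD)
      from S_UN[OF K(1) _ _ this] have "AE \<omega> in M. S U \<omega> = (\<Sum>c\<in>K. S (hcube c (real m)) \<omega>)"
        by (simp add: U_def bounded_hcube)
      then show "AE \<omega> in M. \<phi> (S U \<omega>) = \<phi> (\<Sum>c\<in>K. S (hcube c (real m)) \<omega>)" by eventually_elim simp
    qed (use Ud Vd in \<open>auto simp: V_def\<close>)
    ultimately show ?thesis using b(2) by (simp add: V_def measure_hcube)
  qed
qed

end

text \<open>
  Covariance bounds in terms of an integrable kernel: double Riemann sums of the kernel converge,
  and the limit only sees the kernel outside a large cube.
\<close>

locale covariance_kernel =
  fixes \<kappa> :: "real^'d \<Rightarrow> real"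
  assumes nonneg: "0 \<le> \<kappa> t" and bounded: "\<exists>B. \<forall>t. \<kappa> t \<le> B"
    and continuous: "s \<longlonglongrightarrow> t \<Longrightarrow> (\<lambda>n. \<kappa> (s n)) \<longlonglongrightarrow> \<kappa> t"
    and integrable: "integrable lborel \<kappa>"
begin

lemma measurable_kernel[measurable]: "\<kappa> \<in> borel_measurable borel"
  using integrable by auto

definition tail :: "nat \<Rightarrow> real" where
  "tail r = (\<integral>v. indicator {v. \<exists>i. real r < \<bar>v $ i\<bar>} v * \<kappa> v \<partial>lborel)"

lemma tail_nonneg: "0 \<le> tail r"
  unfolding tail_def using nonneg by (intro integral_nonneg_AE) auto

lemma tail_tendsto: "tail \<longlonglongrightarrow> 0"
proof -
  have "(\<lambda>r. \<integral>v. indicator {v. \<exists>i. real r < \<bar>v $ i\<bar>} v * \<kappa> v \<partial>lborel) \<longlonglongrightarrow> (\<integral>v. 0 \<partial>(lborel :: (real^'d) measure))"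
  proof (rule integral_dominated_convergence[where w=\<kappa>])
    show "AE v in lborel. (\<lambda>r. indicator {v. \<exists>i. real r < \<bar>v $ i\<bar>} v * \<kappa> v) \<longlonglongrightarrow> 0"
      by (intro AE_I2 tendsto_mult_left_zero outside_box_tendsto)
  qed (use integrable nonneg in \<open>auto simp: indicator_def\<close>)
  then show ?thesis by (simp add: tail_def[abs_def])
qed

text \<open>
  The double Riemann sum is the double integral of the kernel evaluated at rounded points. By continuity and
  boundedness of the kernel it converges to the double integral of \<open>\<kappa> (t - s)\<close>, and separation confines
  \<open>t - s\<close> to the domain of the tail integral.
\<close>

lemma double_riemann:
  assumes U: "grid_region U" and V: "grid_region V" and sep: "separated r U V"
  defines "w \<equiv> \<lambda>n. (1 / real (n + 2)) ^ CARD('d)"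
  shows "\<exists>\<beta>. (\<lambda>n. \<Sum>s\<in>grid_pts n U. \<Sum>t\<in>grid_pts n V. w n * w n * \<kappa> (t - s)) \<longlonglongrightarrow> \<beta> \<and> \<beta> \<le> measure lborel V * tail r"
proof -
  note Ud = grid_regionD[OF U] and Vd = grid_regionD[OF V]
  note [measurable] = Ud(1) Vd(1)
  obtain B where B: "\<And>t. \<kappa> t \<le> B" using bounded by blast
  interpret LU: finite_measure "lborel_on U"
    by (rule finite_measure_lborel_on) (use Ud in \<open>auto intro: emeasure_lborel_bounded\<close>)
  interpret LV: finite_measure "lborel_on V"
    by (rule finite_measure_lborel_on) (use Vd in \<open>auto intro: emeasure_lborel_bounded\<close>)
  have iU: "Bochner_Integration.integrable (lborel_on U) (\<lambda>s. \<kappa> (g s))"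
    if [measurable]: "g \<in> borel_measurable borel" for g
    by (rule LU.integrable_const_bound[where B=B]) (use B nonneg in auto)
  have inner_le: "(\<integral>s. \<kappa> (g s) \<partial>lborel_on U) \<le> B * measure lborel U"
    if [measurable]: "g \<in> borel_measurable borel" for g
  proof -
    have "(\<integral>s. \<kappa> (g s) \<partial>lborel_on U) \<le> (\<integral>s. B \<partial>lborel_on U)"
      using iU[of g] B by (intro integral_mono) auto
    then show ?thesis by (simp add: measure_lborel_on mult.commute)
  qed
  have inner_nonneg: "0 \<le> (\<integral>s. \<kappa> (g s) \<partial>lborel_on U)" for g
    using nonneg by simp
  let ?gf = "\<lambda>n. grid_floor (real (n + 2))"
  have eq: "(\<Sum>s\<in>grid_pts n U. \<Sum>t\<in>grid_pts n V. w n * w n * \<kappa> (t - s))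
      = (\<integral>t. (\<integral>s. \<kappa> (?gf n t - ?gf n s) \<partial>lborel_on U) \<partial>lborel_on V)" for n
  proof -
    have "(\<integral>s. \<kappa> (a - ?gf n s) \<partial>lborel_on U) = w n * (\<Sum>s\<in>grid_pts n U. \<kappa> (a - s))" for a
    proof -
      have "(\<integral>s. \<kappa> (a - ?gf n s) \<partial>lborel_on U) = (LINT s:U|lborel. \<kappa> (a - ?gf n s))"
        by (rule integral_lborel_on) measurable
      also have "\<dots> = w n * (\<Sum>s\<in>grid_pts n U. \<kappa> (a - s))"
        unfolding w_def by (rule integral_grid_floor(1)[OF Ud(1,2,3)]) simp
      finally show ?thesis .
    qed
    then have "(\<integral>t. (\<integral>s. \<kappa> (?gf n t - ?gf n s) \<partial>lborel_on U) \<partial>lborel_on V)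
        = (\<integral>t. w n * (\<Sum>s\<in>grid_pts n U. \<kappa> (?gf n t - s)) \<partial>lborel_on V)" by simp
    also have "\<dots> = w n * (\<Sum>t\<in>grid_pts n V. w n * (\<Sum>s\<in>grid_pts n U. \<kappa> (t - s)))"
    proof -
      have "(\<integral>t. w n * (\<Sum>s\<in>grid_pts n U. \<kappa> (?gf n t - s)) \<partial>lborel_on V)
          = (LINT t:V|lborel. w n * (\<Sum>s\<in>grid_pts n U. \<kappa> (?gf n t - s)))"
        by (rule integral_lborel_on) measurable
      also have "\<dots> = w n * (\<Sum>t\<in>grid_pts n V. w n * (\<Sum>s\<in>grid_pts n U. \<kappa> (t - s)))"
        unfolding w_def by (rule integral_grid_floor(1)[OF Vd(1,2,3)]) simp
      finally show ?thesis .
    qed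
    also have "\<dots> = (\<Sum>s\<in>grid_pts n U. \<Sum>t\<in>grid_pts n V. w n * w n * \<kappa> (t - s))"
      by (subst sum.swap) (simp add: sum_distrib_left mult.assoc)
    finally show ?thesis by simp
  qed
  have gf_lim: "(\<lambda>n. ?gf n x) \<longlonglongrightarrow> x" for x :: "real^'d"
    by (rule grid_floor_tendsto[OF _ mesh_at_top]) simp
  have inner_lim: "(\<lambda>n. \<integral>s. \<kappa> (?gf n t - ?gf n s) \<partial>lborel_on U) \<longlonglongrightarrow> (\<integral>s. \<kappa> (t - s) \<partial>lborel_on U)" for t
  proof (rule integral_dominated_convergence[where w="\<lambda>_. B"])
    show "AE s in lborel_on U. (\<lambda>n. \<kappa> (?gf n t - ?gf n s)) \<longlonglongrightarrow> \<kappa> (t - s)"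
      by (intro AE_I2 continuous tendsto_intros gf_lim)
  qed (use B nonneg in auto)
  have lim: "(\<lambda>n. \<integral>t. (\<integral>s. \<kappa> (?gf n t - ?gf n s) \<partial>lborel_on U) \<partial>lborel_on V)
     \<longlonglongrightarrow> (\<integral>t. (\<integral>s. \<kappa> (t - s) \<partial>lborel_on U) \<partial>lborel_on V)"
  proof (rule integral_dominated_convergence[where w="\<lambda>_. B * measure lborel U"])
    show "AE t in lborel_on V. (\<lambda>n. \<integral>s. \<kappa> (?gf n t - ?gf n s) \<partial>lborel_on U) \<longlonglongrightarrow> (\<integral>s. \<kappa> (t - s) \<partial>lborel_on U)"
      by (intro AE_I2 inner_lim)
    show "AE t in lborel_on V. norm (\<integral>s. \<kappa> (?gf n t - ?gf n s) \<partial>lborel_on U) \<le> B * measure lborel U" for n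
      using inner_le[of "\<lambda>s. ?gf n _ - ?gf n s"] inner_nonneg by (intro AE_I2) simp
  qed auto
  have tl: "(\<integral>s. \<kappa> (t - s) \<partial>lborel_on U) \<le> tail r" if t: "t \<in> V" for t
  proof -
    let ?T = "{v :: real^'d. \<exists>i. real r < \<bar>v $ i\<bar>}"
    have i: "Bochner_Integration.integrable lborel (\<lambda>v. indicator ?T v * \<kappa> v)"
      using integrable_mult_indicator[OF _ integrable, of ?T] by simp
    have "(\<integral>s. \<kappa> (t - s) \<partial>lborel_on U) = (\<integral>s. indicator U s * \<kappa> (t - s) \<partial>lborel)"
      by (subst integral_lborel_on) (auto simp: set_lebesgue_integral_def)
    also have "\<dots> \<le> (\<integral>s. indicator ?T (t - s) * \<kappa> (t - s) \<partial>lborel)"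
    proof (rule integral_mono)
      show "Bochner_Integration.integrable lborel (\<lambda>s. indicator U s * \<kappa> (t - s))"
        using integrable_mult_indicator[OF _ lborel_integrable_reflect[OF integrable], of U] by simp
      show "Bochner_Integration.integrable lborel (\<lambda>s. indicator ?T (t - s) * \<kappa> (t - s))" by (rule lborel_integrable_reflect[OF i])
      fix s
      have "t - s \<in> ?T" if "s \<in> U"
        using sep that t by (auto simp: separated_def abs_minus_commute)
      then show "indicator U s * \<kappa> (t - s) \<le> indicator ?T (t - s) * \<kappa> (t - s)"
        using nonneg[of "t - s"] by (cases "s \<in> U") (simp_all add: zero_le_mult_iff)
    qed
    also have "\<dots> = tail r" unfolding tail_def by (rule lborel_integral_reflect[OF i])
    finally show ?thesis .
  qed
  have "(\<integral>t. (\<integral>s. \<kappa> (t - s) \<partial>lborel_on U) \<partial>lborel_on V) \<le> (\<integral>t. tail r \<partial>lborel_on V)"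
  proof (rule integral_mono_AE)
    show "Bochner_Integration.integrable (lborel_on V) (\<lambda>t. \<integral>s. \<kappa> (t - s) \<partial>lborel_on U)"
      by (rule LV.integrable_const_bound[where B="B * measure lborel U"])
         (use inner_le[of "\<lambda>s. _ - s"] inner_nonneg in auto)
    show "AE t in lborel_on V. (\<integral>s. \<kappa> (t - s) \<partial>lborel_on U) \<le> tail r"
      by (rule AE_lborel_on) (use tl in auto)
  qed simp
  then have "(\<integral>t. (\<integral>s. \<kappa> (t - s) \<partial>lborel_on U) \<partial>lborel_on V) \<le> measure lborel V * tail r"
    by (simp add: measure_lborel_on)
  then show ?thesis using lim unfolding eq by blast
qed

end

section \<open>Mixing under the three dependence conditions\<close>

lemma (in L2_field) covariance_kernel_abs_C:
  assumes "integrable lborel C"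
  shows "covariance_kernel (\<lambda>t. \<bar>C t\<bar>)"
proof
  show "\<exists>B. \<forall>t. \<bar>C t\<bar> \<le> B" using abs_C_le by blast
  show "(\<lambda>n. \<bar>C (s n)\<bar>) \<longlonglongrightarrow> \<bar>C t\<bar>" if "s \<longlonglongrightarrow> t" for s t
    by (intro tendsto_intros C_tendsto that)
qed (use assms in auto)

lemma ne_emptyI: "x \<in> A \<Longrightarrow> A \<noteq> {}"
  by blast

text \<open>
  The index set must not be empty, as the supremum over the empty set is unspecified.
\<close>

lemma lip_const_bounds:
  assumes I: "finite I" "I \<noteq> {}"
    and F: "\<And>x y. x \<in> I \<rightarrow>\<^sub>E UNIV \<Longrightarrow> y \<in> I \<rightarrow>\<^sub>E UNIV \<Longrightarrow> \<bar>F x - F y\<bar> \<le> L * l1_dist I x y"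
  shows "0 \<le> lip_const I F" "lip_const I F \<le> L" "is_lipschitz I F"
proof -
  let ?S = "{\<bar>F x - F y\<bar> / l1_dist I x y | x y. x \<in> I \<rightarrow>\<^sub>E UNIV \<and> y \<in> I \<rightarrow>\<^sub>E UNIV \<and> x \<noteq> y}"
  have le: "q \<le> L" if "q \<in> ?S" for q
  proof -
    obtain x y where q: "q = \<bar>F x - F y\<bar> / l1_dist I x y" "x \<in> I \<rightarrow>\<^sub>E UNIV" "y \<in> I \<rightarrow>\<^sub>E UNIV" "x \<noteq> y"
      using \<open>q \<in> ?S\<close> by blast
    obtain t where "t \<in> I" "x t \<noteq> y t" using q(2-4) by (metis PiE_ext)
    then have "0 < l1_dist I x y" unfolding l1_dist_def using I(1) by (intro sum_pos2[of I t]) auto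
    then show ?thesis using F[OF q(2,3)] by (simp add: q(1) divide_le_eq)
  qed
  define x y :: "'a \<Rightarrow> real" where "x = (\<lambda>t\<in>I. 0)" and "y = (\<lambda>t\<in>I. 1)"
  have xy: "x \<in> I \<rightarrow>\<^sub>E UNIV" "y \<in> I \<rightarrow>\<^sub>E UNIV" by (auto simp: x_def y_def)
  obtain t where "t \<in> I" using I(2) by blast
  then have "x t \<noteq> y t" by (simp add: x_def y_def)
  then have e: "\<bar>F x - F y\<bar> / l1_dist I x y \<in> ?S" using xy by auto
  then have ne: "?S \<noteq> {}" by (rule ne_emptyI)
  have "0 \<le> \<bar>F x - F y\<bar> / l1_dist I x y" by (simp add: l1_dist_def sum_nonneg)
  also have "\<dots> \<le> Sup ?S" using le by (intro cSup_upper[OF e]) (auto intro!: bdd_aboveI)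
  finally show "0 \<le> lip_const I F" by (simp add: lip_const_def)
  show "lip_const I F \<le> L" unfolding lip_const_def by (rule cSup_least[OF _ le]) (rule ne)
  show "is_lipschitz I F" unfolding is_lipschitz_def using F by blast
qed

text \<open>
  For arguments that differ in one coordinate only, the \<open>l1\<close>-distance is the distance in this coordinate.
\<close>

lemma lip_coord_bounds:
  assumes I: "finite I" "k \<in> I"
    and F: "\<And>x y. x \<in> I \<rightarrow>\<^sub>E UNIV \<Longrightarrow> y \<in> I \<rightarrow>\<^sub>E UNIV \<Longrightarrow> \<bar>F x - F y\<bar> \<le> L * l1_dist I x y"
  shows "0 \<le> lip_coord I k F" "lip_coord I k F \<le> L"
proof -
  let ?S = "{\<bar>F x - F y\<bar> / \<bar>x k - y k\<bar> | x y. x \<in> I \<rightarrow>\<^sub>E UNIV \<and> y \<in> I \<rightarrow>\<^sub>E UNIV \<and>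
            x k \<noteq> y k \<and> (\<forall>t\<in>I - {k}. x t = y t)}"
  have le: "q \<le> L" if "q \<in> ?S" for q
  proof -
    obtain x y where q: "q = \<bar>F x - F y\<bar> / \<bar>x k - y k\<bar>" "x \<in> I \<rightarrow>\<^sub>E UNIV" "y \<in> I \<rightarrow>\<^sub>E UNIV"
      "x k \<noteq> y k" "\<forall>t\<in>I - {k}. x t = y t" using \<open>q \<in> ?S\<close> by blast
    have "l1_dist I x y = \<bar>x k - y k\<bar>"
      unfolding l1_dist_def using I q(5) by (subst sum.remove[OF I]) auto
    then show ?thesis using F[OF q(2,3)] q(4) by (simp add: q(1) divide_le_eq)
  qed
  define x y :: "'a \<Rightarrow> real" where "x = (\<lambda>t\<in>I. 0)" and "y = (\<lambda>t\<in>I. if t = k then 1 else 0)"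
  have xy: "x \<in> I \<rightarrow>\<^sub>E UNIV" "y \<in> I \<rightarrow>\<^sub>E UNIV" by (auto simp: x_def y_def)
  have "x k \<noteq> y k \<and> (\<forall>t\<in>I - {k}. x t = y t)" using I by (simp add: x_def y_def)
  then have e: "\<bar>F x - F y\<bar> / \<bar>x k - y k\<bar> \<in> ?S" using xy by blast
  then have ne: "?S \<noteq> {}" by (rule ne_emptyI)
  have "0 \<le> \<bar>F x - F y\<bar> / \<bar>x k - y k\<bar>" by simp
  also have "\<dots> \<le> Sup ?S" using le by (intro cSup_upper[OF e]) (auto intro!: bdd_aboveI)
  finally show "0 \<le> lip_coord I k F" by (simp add: lip_coord_def)
  show "lip_coord I k F \<le> L" unfolding lip_coord_def by (rule cSup_least[OF _ le]) (rule ne)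
qed

lemma test_function_lipschitz:
  assumes \<phi>: "bdd_lipschitz L \<phi>" and g: "\<And>x y. \<bar>g x - g y\<bar> \<le> Lg * \<bar>x - y\<bar>" and "0 \<le> w"
  shows "\<bar>\<phi> (\<Sum>s\<in>I. w * g (x s)) - \<phi> (\<Sum>s\<in>I. w * g (y s))\<bar> \<le> (L * (w * Lg)) * l1_dist I x y"
proof -
  note L = bdd_lipschitzD(2,3)[OF \<phi>]
  have "\<bar>\<phi> (\<Sum>s\<in>I. w * g (x s)) - \<phi> (\<Sum>s\<in>I. w * g (y s))\<bar> \<le> L * \<bar>(\<Sum>s\<in>I. w * g (x s)) - (\<Sum>s\<in>I. w * g (y s))\<bar>"
    by (rule L(1))
  also have "(\<Sum>s\<in>I. w * g (x s)) - (\<Sum>s\<in>I. w * g (y s)) = (\<Sum>s\<in>I. w * (g (x s) - g (y s)))"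
    by (simp add: sum_subtractf right_diff_distrib)
  also have "L * \<bar>\<dots>\<bar> \<le> L * (\<Sum>s\<in>I. \<bar>w * (g (x s) - g (y s))\<bar>)"
    by (intro mult_left_mono sum_abs L)
  also have "\<dots> \<le> L * (\<Sum>s\<in>I. w * (Lg * \<bar>x s - y s\<bar>))"
    using assms(3) by (intro mult_left_mono sum_mono L) (simp add: abs_mult mult_left_mono[OF g])
  finally show ?thesis by (simp add: l1_dist_def sum_distrib_left mult.assoc)
qed

text \<open>
  A Riemann sum with mesh \<open>1 / \<Delta>\<close> weights every point by \<open>\<Delta> ^ (- d)\<close>. The two Lipschitz constants contribute
  this factor twice; one of them cancels the factor \<open>\<Delta> ^ d\<close> of the dependence bound, the other one turns
  the number of points in the smaller region into its volume.
\<close>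

lemma BL_mixing:
  fixes X :: "real^'d \<Rightarrow> 'w \<Rightarrow> real"
  assumes Z: "L2_field M (\<lambda>t \<omega>. g (X t \<omega>))" and BL: "BL_dependent M X \<theta>"
    and \<theta>: "antimono_on {1..} \<theta>" "\<theta> \<longlonglongrightarrow> 0" and g: "\<And>x y. \<bar>g x - g y\<bar> \<le> Lg * \<bar>x - y\<bar>"
  shows "L2_field.mixing M (\<lambda>t \<omega>. g (X t \<omega>)) (\<lambda>r. Lg\<^sup>2 * \<theta> r)"
proof -
  interpret Z: L2_field M "\<lambda>t \<omega>. g (X t \<omega>)" by (rule Z)
  have \<theta>0: "0 \<le> \<theta> r" if "1 \<le> r" for r
  proof (rule LIMSEQ_le_const2[OF \<theta>(2)])
    show "\<exists>N. \<forall>n\<ge>N. \<theta> n \<le> \<theta> r"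
      using \<theta>(1) that by (intro exI[of _ r]) (auto simp: monotone_on_def)
  qed
  show ?thesis
  proof (rule Z.mixingI)
    show "0 \<le> Lg\<^sup>2 * \<theta> r" if "1 \<le> r" for r using \<theta>0[OF that] by simp
    fix r :: nat and U V :: "(real^'d) set" and L L' \<phi> \<psi>
    assume r: "1 \<le> r" and U: "grid_region U" and V: "grid_region V" and sep: "separated r U V"
      and \<phi>: "bdd_lipschitz L \<phi>" and \<psi>: "bdd_lipschitz L' \<psi>"
    note L = bdd_lipschitzD(3)[OF \<phi>] bdd_lipschitzD(3)[OF \<psi>]
    have Lg: "0 \<le> Lg" using g[of 1 0] by simp
    let ?b = "L * L' * measure lborel V * (Lg\<^sup>2 * \<theta> r)"
    have main: "cov M (\<lambda>\<omega>. \<phi> (Z.riemann (real (n + 2)) U \<omega>)) (\<lambda>\<omega>. \<psi> (Z.riemann (real (n + 2)) V \<omega>)) \<le> ?b"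
      if \<phi>: "bdd_lipschitz L \<phi>" for \<phi> n
    proof -
      let ?I = "grid_pts n U" and ?J = "grid_pts n V" and ?\<Delta> = "real (n + 2)"
      define w where "w = (1 / ?\<Delta>) ^ CARD('d)"
      have w: "0 \<le> w" "w * ?\<Delta> ^ CARD('d) = 1" by (simp_all add: w_def power_divide)
      note Ud = grid_regionD[OF U] and Vd = grid_regionD[OF V]
      define F G where "F x = \<phi> (\<Sum>s\<in>?I. w * g (x s))" and "G x = \<psi> (\<Sum>s\<in>?J. w * g (x s))" for x
      have lF: "\<bar>F x - F y\<bar> \<le> (L * (w * Lg)) * l1_dist ?I x y" for x y
        unfolding F_def by (rule test_function_lipschitz[OF \<phi> g w(1)])
      have lG: "\<bar>G x - G y\<bar> \<le> (L' * (w * Lg)) * l1_dist ?J x y" for x y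
        unfolding G_def by (rule test_function_lipschitz[OF \<psi> g w(1)])
      note F = lip_const_bounds[OF Ud(4,5) lF] and G = lip_const_bounds[OF Vd(4,5) lG]
      have sep': "real r < (\<Sum>k\<in>UNIV. \<bar>x $ k - y $ k\<bar>)" if xy: "x \<in> ?I" "y \<in> ?J" for x y
      proof -
        obtain i where "real r < \<bar>x $ i - y $ i\<bar>" using sep xy unfolding separated_def by blast
        also have "\<dots> \<le> (\<Sum>k\<in>UNIV. \<bar>x $ k - y $ k\<bar>)" by (rule member_le_sum) auto
        finally show ?thesis .
      qed
      have disj: "?I \<inter> ?J = {}"
      proof (rule ccontr)
        assume "?I \<inter> ?J \<noteq> {}"
        then obtain x where "x \<in> ?I" "x \<in> ?J" by blast
        from sep'[OF this] show False by simp
      qed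
      have dist: "real r \<le> l1_setdist ?I ?J"
        unfolding l1_setdist_def
      proof (subst Min_ge_iff)
        have "{\<Sum>k\<in>UNIV. \<bar>x $ k - y $ k\<bar> | x y. x \<in> ?I \<and> y \<in> ?J} = (\<lambda>(x, y). \<Sum>k\<in>UNIV. \<bar>x $ k - y $ k\<bar>) ` (?I \<times> ?J)"
          by auto
        then show "finite {\<Sum>k\<in>UNIV. \<bar>x $ k - y $ k\<bar> | x y. x \<in> ?I \<and> y \<in> ?J}"
          and "{\<Sum>k\<in>UNIV. \<bar>x $ k - y $ k\<bar> | x y. x \<in> ?I \<and> y \<in> ?J} \<noteq> {}"
          using Ud(4)[of n] Vd(4)[of n] Ud(5)[of n] Vd(5)[of n] by (simp_all only: finite_imageI finite_cartesian_product image_is_empty) auto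
        show "\<forall>a\<in>{\<Sum>k\<in>UNIV. \<bar>x $ k - y $ k\<bar> | x y. x \<in> ?I \<and> y \<in> ?J}. real r \<le> a"
          using sep' by (auto intro: less_imp_le)
      qed
      have bd: "bounded (F ` (?I \<rightarrow>\<^sub>E UNIV))" "bounded (G ` (?J \<rightarrow>\<^sub>E UNIV))"
        unfolding bounded_iff F_def G_def using bdd_lipschitzD(1)[OF \<phi>] bdd_lipschitzD(1)[OF \<psi>] by auto
      have e: "F (field_at X ?I \<omega>) = \<phi> (Z.riemann ?\<Delta> U \<omega>)" "G (field_at X ?J \<omega>) = \<psi> (Z.riemann ?\<Delta> V \<omega>)" for \<omega>
        by (simp_all add: F_def G_def field_at_def Z.riemann_def w_def)
      have "cov M (\<lambda>\<omega>. F (field_at X ?I \<omega>)) (\<lambda>\<omega>. G (field_at X ?J \<omega>))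
          \<le> real (min (card ?I) (card ?J)) * lip_const ?I F * lip_const ?J G * ?\<Delta> ^ CARD('d) * \<theta> r"
      proof (rule BL[unfolded BL_dependent_def, rule_format, OF r])
        show "1 < real (n + 2)" by simp
        show "finite ?I \<and> finite ?J \<and> ?I \<noteq> {} \<and> ?J \<noteq> {} \<and> ?I \<inter> ?J = {} \<and>
          ?I \<subseteq> lattice_pts (real (n + 2)) \<and> ?J \<subseteq> lattice_pts (real (n + 2)) \<and> real r \<le> l1_setdist ?I ?J \<and>
          is_lipschitz ?I F \<and> bounded (F ` (?I \<rightarrow>\<^sub>E UNIV)) \<and>
          is_lipschitz ?J G \<and> bounded (G ` (?J \<rightarrow>\<^sub>E UNIV))"
          by (intro conjI) (rule Ud Vd disj dist F G bd Int_lower1)+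
      qed
      also have "\<dots> = real (min (card ?I) (card ?J)) * (lip_const ?I F * lip_const ?J G * (?\<Delta> ^ CARD('d) * \<theta> r))"
        by (simp only: mult.assoc)
      also have "\<dots> \<le> real (card ?J) * ((L * (w * Lg)) * (L' * (w * Lg)) * (?\<Delta> ^ CARD('d) * \<theta> r))"
        using F G L Lg w \<theta>0[OF r] by (intro mult_mono mult_nonneg_nonneg) auto
      also have "\<dots> = L * L' * (w * card ?J) * (Lg\<^sup>2 * \<theta> r) * (w * ?\<Delta> ^ CARD('d))"
        by (simp add: power2_eq_square)
      also have "\<dots> = ?b" using Vd(6)[of n] unfolding w(2) by (simp add: w_def)
      finally show ?thesis unfolding e .
    qed
    have "\<bar>cov M (\<lambda>\<omega>. \<phi> (Z.riemann (real (n + 2)) U \<omega>)) (\<lambda>\<omega>. \<psi> (Z.riemann (real (n + 2)) V \<omega>))\<bar> \<le> ?b" for n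
      using main[OF \<phi>, of n] main[OF bdd_lipschitz_minus[OF \<phi>], of n] by (simp add: cov_minus_left abs_le_iff)
    then show "\<exists>b \<beta>. b \<longlonglongrightarrow> \<beta> \<and> \<beta> \<le> ?b \<and>
        (\<forall>n. \<bar>cov M (\<lambda>\<omega>. \<phi> (Z.riemann (real (n + 2)) U \<omega>)) (\<lambda>\<omega>. \<psi> (Z.riemann (real (n + 2)) V \<omega>))\<bar> \<le> b n)"
      by (intro exI[of _ "\<lambda>_. ?b"] exI[of _ ?b]) auto
  qed
qed

text \<open>
  Each Lipschitz constant contributes the weight of the Riemann sum, which leaves a double Riemann sum of the
  covariance function of \<open>X\<close>.
\<close>

lemma QA_mixing:
  fixes X :: "real^'d \<Rightarrow> 'w \<Rightarrow> real"
  assumes Z: "L2_field M (\<lambda>t \<omega>. g (X t \<omega>))" and X: "L2_field M X" and QA: "QA M X"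
    and C: "integrable lborel (L2_field.C M X)" and g: "\<And>x y. \<bar>g x - g y\<bar> \<le> Lg * \<bar>x - y\<bar>"
  shows "\<exists>\<theta>. \<theta> \<longlonglongrightarrow> 0 \<and> L2_field.mixing M (\<lambda>t \<omega>. g (X t \<omega>)) \<theta>"
proof -
  interpret Z: L2_field M "\<lambda>t \<omega>. g (X t \<omega>)" by (rule Z)
  interpret X: L2_field M X by (rule X)
  interpret k: covariance_kernel "\<lambda>t. \<bar>X.C t\<bar>" by (rule X.covariance_kernel_abs_C[OF C])
  have "Z.mixing (\<lambda>r. Lg\<^sup>2 * k.tail r)"
  proof (rule Z.mixingI)
    show "0 \<le> Lg\<^sup>2 * k.tail r" for r using k.tail_nonneg by simp
    fix r :: nat and U V :: "(real^'d) set" and L L' \<phi> \<psi>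
    assume r: "1 \<le> r" and U: "grid_region U" and V: "grid_region V" and sep: "separated r U V"
      and \<phi>: "bdd_lipschitz L \<phi>" and \<psi>: "bdd_lipschitz L' \<psi>"
    note L = bdd_lipschitzD(3)[OF \<phi>] bdd_lipschitzD(3)[OF \<psi>]
    have Lg: "0 \<le> Lg" using g[of 1 0] by simp
    define w where "w n = (1 / real (n + 2)) ^ CARD('d)" for n
    define b where "b n = (\<Sum>s\<in>grid_pts n U. \<Sum>t\<in>grid_pts n V. w n * w n * \<bar>X.C (t - s)\<bar>)" for n
    obtain \<beta> where \<beta>: "b \<longlonglongrightarrow> \<beta>" "\<beta> \<le> measure lborel V * k.tail r"
      using k.double_riemann[OF U V sep] unfolding b_def w_def by blast
    have "\<bar>cov M (\<lambda>\<omega>. \<phi> (Z.riemann (real (n + 2)) U \<omega>)) (\<lambda>\<omega>. \<psi> (Z.riemann (real (n + 2)) V \<omega>))\<bar> \<le> L * L' * Lg\<^sup>2 * b n" for n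
    proof -
      let ?I = "grid_pts n U" and ?J = "grid_pts n V"
      have w: "0 \<le> w n" by (simp add: w_def)
      note Ud = grid_regionD[OF U] and Vd = grid_regionD[OF V]
      define F G where "F x = \<phi> (\<Sum>s\<in>?I. w n * g (x s))" and "G x = \<psi> (\<Sum>s\<in>?J. w n * g (x s))" for x
      have lF: "\<bar>F x - F y\<bar> \<le> (L * (w n * Lg)) * l1_dist ?I x y" for x y
        unfolding F_def by (rule test_function_lipschitz[OF \<phi> g w])
      have lG: "\<bar>G x - G y\<bar> \<le> (L' * (w n * Lg)) * l1_dist ?J x y" for x y
        unfolding G_def by (rule test_function_lipschitz[OF \<psi> g w])
      have e: "F (field_at X ?I \<omega>) = \<phi> (Z.riemann (real (n + 2)) U \<omega>)" "G (field_at X ?J \<omega>) = \<psi> (Z.riemann (real (n + 2)) V \<omega>)" for \<omega>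
        by (simp_all add: F_def G_def field_at_def Z.riemann_def w_def)
      have "\<bar>cov M (\<lambda>\<omega>. F (field_at X ?I \<omega>)) (\<lambda>\<omega>. G (field_at X ?J \<omega>))\<bar>
          \<le> (\<Sum>s\<in>?I. \<Sum>t\<in>?J. lip_coord ?I s F * lip_coord ?J t G * \<bar>cov M (X s) (X t)\<bar>)"
        using QA Ud(4)[of n] Vd(4)[of n] lip_const_bounds(3)[OF Ud(4,5) lF] lip_const_bounds(3)[OF Vd(4,5) lG]
        unfolding QA_def by blast
      also have "\<dots> \<le> (\<Sum>s\<in>?I. \<Sum>t\<in>?J. (L * (w n * Lg)) * (L' * (w n * Lg)) * \<bar>X.C (t - s)\<bar>)"
        using lip_coord_bounds[OF Ud(4) _ lF] lip_coord_bounds[OF Vd(4) _ lG] L Lg w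
        by (intro sum_mono mult_mono mult_nonneg_nonneg) (auto simp: X.cov_eq_C)
      also have "\<dots> = L * L' * Lg\<^sup>2 * b n"
        by (simp add: b_def sum_distrib_left power2_eq_square algebra_simps)
      finally show ?thesis unfolding e .
    qed
    moreover have "(\<lambda>n. L * L' * Lg\<^sup>2 * b n) \<longlonglongrightarrow> L * L' * Lg\<^sup>2 * \<beta>" by (intro tendsto_intros \<beta>)
    moreover have "L * L' * Lg\<^sup>2 * \<beta> \<le> L * L' * Lg\<^sup>2 * (measure lborel V * k.tail r)"
      using L by (intro mult_left_mono \<beta>) auto
    then have "L * L' * Lg\<^sup>2 * \<beta> \<le> L * L' * measure lborel V * (Lg\<^sup>2 * k.tail r)" by (simp add: algebra_simps)
    ultimately show "\<exists>b \<beta>. b \<longlonglongrightarrow> \<beta> \<and> \<beta> \<le> L * L' * measure lborel V * (Lg\<^sup>2 * k.tail r) \<and>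
        (\<forall>n. \<bar>cov M (\<lambda>\<omega>. \<phi> (Z.riemann (real (n + 2)) U \<omega>)) (\<lambda>\<omega>. \<psi> (Z.riemann (real (n + 2)) V \<omega>))\<bar> \<le> b n)"
      by (intro exI[of _ "\<lambda>n. L * L' * Lg\<^sup>2 * b n"] exI[of _ "L * L' * Lg\<^sup>2 * \<beta>"]) auto
  qed
  moreover have "(\<lambda>r. Lg\<^sup>2 * k.tail r) \<longlonglongrightarrow> 0" using tendsto_mult_left[OF k.tail_tendsto, of "Lg\<^sup>2"] by simp
  ultimately show ?thesis by blast
qed

text \<open>Truncation extends positive association from bounded to square integrable test functions.\<close>

lemma PA_cov_nonneg:
  assumes "prob_space M" and PA: "PA M X" and X: "measurable_field M X" and I: "finite I" "finite J"
    and F[measurable]: "F \<in> borel_measurable (\<Pi>\<^sub>M t\<in>I. borel)" and G[measurable]: "G \<in> borel_measurable (\<Pi>\<^sub>M t\<in>J. borel)"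
    and mF: "\<And>x k. x \<in> I \<rightarrow>\<^sub>E UNIV \<Longrightarrow> k \<in> I \<Longrightarrow> mono (\<lambda>a. F (x(k := a)))"
    and mG: "\<And>x k. x \<in> J \<rightarrow>\<^sub>E UNIV \<Longrightarrow> k \<in> J \<Longrightarrow> mono (\<lambda>a. G (x(k := a)))"
    and L2: "integrable M (\<lambda>\<omega>. (F (field_at X I \<omega>))\<^sup>2)" "integrable M (\<lambda>\<omega>. (G (field_at X J \<omega>))\<^sup>2)"
  shows "0 \<le> cov M (\<lambda>\<omega>. F (field_at X I \<omega>)) (\<lambda>\<omega>. G (field_at X J \<omega>))"
proof -
  interpret prob_space M by fact
  have [measurable]: "field_at X K \<in> M \<rightarrow>\<^sub>M (\<Pi>\<^sub>M t\<in>K. borel)" for K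
    using measurable_field_at_set[OF X, of "\<lambda>t. t" K] by simp
  let ?F = "\<lambda>\<omega>. F (field_at X I \<omega>)" and ?G = "\<lambda>\<omega>. G (field_at X J \<omega>)"
  have c0: "0 \<le> cov M (\<lambda>\<omega>. truncation n (?F \<omega>)) (\<lambda>\<omega>. truncation n (?G \<omega>))" for n
  proof (rule PA[unfolded PA_def, rule_format, of I J "\<lambda>x. truncation n (F x)" "\<lambda>x. truncation n (G x)"], intro conjI ballI)
    show "bounded ((\<lambda>x. truncation n (F x)) ` (I \<rightarrow>\<^sub>E UNIV))" "bounded ((\<lambda>x. truncation n (G x)) ` (J \<rightarrow>\<^sub>E UNIV))"
      unfolding bounded_iff using truncation_bounds(1)[of n] by auto
    show "mono (\<lambda>a. truncation n (F (x(k := a))))" if "x \<in> I \<rightarrow>\<^sub>E UNIV" "k \<in> I" for x k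
      using mF[OF that] mono_truncation[of n] by (auto simp: mono_def)
    show "mono (\<lambda>a. truncation n (G (x(k := a))))" if "x \<in> J \<rightarrow>\<^sub>E UNIV" "k \<in> J" for x k
      using mG[OF that] mono_truncation[of n] by (auto simp: mono_def)
  qed (use I in measurable)
  have Fm: "?F \<in> borel_measurable M" "?G \<in> borel_measurable M" by measurable
  note i = integrable_of_L2[OF Fm(1) L2(1)] integrable_of_L2[OF Fm(2) L2(2)] integrable_mult_L2[OF Fm L2]
  have "(\<lambda>n. expectation (\<lambda>\<omega>. truncation n (?F \<omega>) * truncation n (?G \<omega>))) \<longlonglongrightarrow> expectation (\<lambda>\<omega>. ?F \<omega> * ?G \<omega>)"
  proof (rule integral_dominated_convergence[where w="\<lambda>\<omega>. \<bar>?F \<omega> * ?G \<omega>\<bar>"])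
    show "AE \<omega> in M. norm (truncation n (?F \<omega>) * truncation n (?G \<omega>)) \<le> \<bar>?F \<omega> * ?G \<omega>\<bar>" for n
      unfolding real_norm_def abs_mult by (intro AE_I2 mult_mono truncation_bounds(2)) auto
  qed (use i in \<open>auto intro!: tendsto_intros truncation_tendsto\<close>)
  moreover have "(\<lambda>n. expectation (\<lambda>\<omega>. truncation n (?F \<omega>))) \<longlonglongrightarrow> expectation ?F"
    by (rule integral_dominated_convergence[where w="\<lambda>\<omega>. \<bar>?F \<omega>\<bar>"]) (use i in \<open>auto intro!: truncation_tendsto truncation_bounds(2)\<close>)
  moreover have "(\<lambda>n. expectation (\<lambda>\<omega>. truncation n (?G \<omega>))) \<longlonglongrightarrow> expectation ?G"
    by (rule integral_dominated_convergence[where w="\<lambda>\<omega>. \<bar>?G \<omega>\<bar>"]) (use i in \<open>auto intro!: truncation_tendsto truncation_bounds(2)\<close>)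
  ultimately have "(\<lambda>n. expectation (\<lambda>\<omega>. truncation n (?F \<omega>) * truncation n (?G \<omega>)) - expectation (\<lambda>\<omega>. truncation n (?F \<omega>)) * expectation (\<lambda>\<omega>. truncation n (?G \<omega>)))
      \<longlonglongrightarrow> expectation (\<lambda>\<omega>. ?F \<omega> * ?G \<omega>) - expectation ?F * expectation ?G"
    by (intro tendsto_intros)
  moreover have "cov M (\<lambda>\<omega>. truncation n (?F \<omega>)) (\<lambda>\<omega>. truncation n (?G \<omega>))
      = expectation (\<lambda>\<omega>. truncation n (?F \<omega>) * truncation n (?G \<omega>)) - expectation (\<lambda>\<omega>. truncation n (?F \<omega>)) * expectation (\<lambda>\<omega>. truncation n (?G \<omega>))" for n
    by (rule cov_eq) (auto intro!: L2_bounded[OF _ truncation_bounds(1)])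
  ultimately have "(\<lambda>n. cov M (\<lambda>\<omega>. truncation n (?F \<omega>)) (\<lambda>\<omega>. truncation n (?G \<omega>))) \<longlonglongrightarrow> cov M ?F ?G"
    by (simp add: cov_eq[OF Fm L2])
  then show ?thesis by (rule LIMSEQ_le_const) (use c0 in blast)
qed

text \<open>
  If \<open>P\<close> dominates the increments of \<open>F\<close> and \<open>Q\<close> those of \<open>G\<close>, then expanding the nonnegative
  covariances of \<open>P \<plusminus> F\<close> and \<open>Q \<mp> G\<close> bounds the covariance of \<open>F\<close> and \<open>G\<close>.
\<close>

lemma PA_cov_bound:
  assumes M: "prob_space M" and PA: "PA M X" and X: "measurable_field M X" and I: "finite I" "finite J"
    and m[measurable]: "F \<in> borel_measurable (\<Pi>\<^sub>M t\<in>I. borel)" "P \<in> borel_measurable (\<Pi>\<^sub>M t\<in>I. borel)"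
      "G \<in> borel_measurable (\<Pi>\<^sub>M t\<in>J. borel)" "Q \<in> borel_measurable (\<Pi>\<^sub>M t\<in>J. borel)"
    and mF: "\<And>x k a b. x \<in> I \<rightarrow>\<^sub>E UNIV \<Longrightarrow> k \<in> I \<Longrightarrow> a \<le> b \<Longrightarrow> \<bar>F (x(k := b)) - F (x(k := a))\<bar> \<le> P (x(k := b)) - P (x(k := a))"
    and mG: "\<And>x k a b. x \<in> J \<rightarrow>\<^sub>E UNIV \<Longrightarrow> k \<in> J \<Longrightarrow> a \<le> b \<Longrightarrow> \<bar>G (x(k := b)) - G (x(k := a))\<bar> \<le> Q (x(k := b)) - Q (x(k := a))"
    and L2: "integrable M (\<lambda>\<omega>. (F (field_at X I \<omega>))\<^sup>2)" "integrable M (\<lambda>\<omega>. (P (field_at X I \<omega>))\<^sup>2)"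
       "integrable M (\<lambda>\<omega>. (G (field_at X J \<omega>))\<^sup>2)" "integrable M (\<lambda>\<omega>. (Q (field_at X J \<omega>))\<^sup>2)"
  shows "\<bar>cov M (\<lambda>\<omega>. F (field_at X I \<omega>)) (\<lambda>\<omega>. G (field_at X J \<omega>))\<bar>
     \<le> cov M (\<lambda>\<omega>. P (field_at X I \<omega>)) (\<lambda>\<omega>. Q (field_at X J \<omega>))"
proof -
  interpret prob_space M by fact
  have [measurable]: "field_at X K \<in> M \<rightarrow>\<^sub>M (\<Pi>\<^sub>M t\<in>K. borel)" for K
    using measurable_field_at_set[OF X, of "\<lambda>t. t" K] by simp
  let ?F = "\<lambda>\<omega>. F (field_at X I \<omega>)" and ?P = "\<lambda>\<omega>. P (field_at X I \<omega>)"
    and ?G = "\<lambda>\<omega>. G (field_at X J \<omega>)" and ?Q = "\<lambda>\<omega>. Q (field_at X J \<omega>)"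
  have Fm: "?F \<in> borel_measurable M" "?P \<in> borel_measurable M" "?G \<in> borel_measurable M" "?Q \<in> borel_measurable M"
    by measurable
  have key: "0 \<le> cov M (\<lambda>\<omega>. ?P \<omega> + \<epsilon> * ?F \<omega>) (\<lambda>\<omega>. ?Q \<omega> + \<delta> * ?G \<omega>)"
    if \<epsilon>: "\<epsilon> = 1 \<or> \<epsilon> = -1" "\<delta> = 1 \<or> \<delta> = -1" for \<epsilon> \<delta> :: real
  proof (rule PA_cov_nonneg[OF M PA X I, of "\<lambda>x. P x + \<epsilon> * F x" "\<lambda>x. Q x + \<delta> * G x"])
    show "mono (\<lambda>a. P (x(k := a)) + \<epsilon> * F (x(k := a)))" if "x \<in> I \<rightarrow>\<^sub>E UNIV" "k \<in> I" for x k
      using mF[OF that] \<epsilon>(1) by (intro monoI) (fastforce simp: abs_le_iff)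
    show "mono (\<lambda>a. Q (x(k := a)) + \<delta> * G (x(k := a)))" if "x \<in> J \<rightarrow>\<^sub>E UNIV" "k \<in> J" for x k
      using mG[OF that] \<epsilon>(2) by (intro monoI) (fastforce simp: abs_le_iff)
    show "integrable M (\<lambda>\<omega>. (?P \<omega> + \<epsilon> * ?F \<omega>)\<^sup>2)" by (intro L2_add L2_cmult L2) (use Fm in auto)
    show "integrable M (\<lambda>\<omega>. (?Q \<omega> + \<delta> * ?G \<omega>)\<^sup>2)" by (intro L2_add L2_cmult L2) (use Fm in auto)
  qed measurable
  have expand: "cov M (\<lambda>\<omega>. ?P \<omega> + \<epsilon> * ?F \<omega>) (\<lambda>\<omega>. ?Q \<omega> + \<delta> * ?G \<omega>)
      = cov M ?P ?Q + \<delta> * cov M ?P ?G + \<epsilon> * cov M ?F ?Q + \<epsilon> * \<delta> * cov M ?F ?G" for \<epsilon> \<delta> :: real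
  proof -
    have L: "integrable M (\<lambda>\<omega>. (?P \<omega> + \<epsilon> * ?F \<omega>)\<^sup>2)" "integrable M (\<lambda>\<omega>. (?Q \<omega> + \<delta> * ?G \<omega>)\<^sup>2)"
      by (intro L2_add L2_cmult L2; use Fm in auto)+
    note i = integrable_of_L2[OF Fm(1) L2(1)] integrable_of_L2[OF Fm(2) L2(2)] integrable_of_L2[OF Fm(3) L2(3)]
      integrable_of_L2[OF Fm(4) L2(4)] integrable_mult_L2[OF Fm(1,3) L2(1,3)] integrable_mult_L2[OF Fm(1,4) L2(1,4)]
      integrable_mult_L2[OF Fm(2,3) L2(2,3)] integrable_mult_L2[OF Fm(2,4) L2(2,4)]
    have "expectation (\<lambda>\<omega>. (?P \<omega> + \<epsilon> * ?F \<omega>) * (?Q \<omega> + \<delta> * ?G \<omega>))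
        = expectation (\<lambda>\<omega>. ?P \<omega> * ?Q \<omega> + \<delta> * (?P \<omega> * ?G \<omega>) + \<epsilon> * (?F \<omega> * ?Q \<omega>) + \<epsilon> * \<delta> * (?F \<omega> * ?G \<omega>))"
      by (rule Bochner_Integration.integral_cong) (auto simp: algebra_simps)
    also have "\<dots> = expectation (\<lambda>\<omega>. ?P \<omega> * ?Q \<omega>) + \<delta> * expectation (\<lambda>\<omega>. ?P \<omega> * ?G \<omega>)
        + \<epsilon> * expectation (\<lambda>\<omega>. ?F \<omega> * ?Q \<omega>) + \<epsilon> * \<delta> * expectation (\<lambda>\<omega>. ?F \<omega> * ?G \<omega>)"
      using i by simp
    finally show ?thesis
      using i L Fm L2 by (simp add: cov_eq algebra_simps)
  qed
  from key[of 1 "-1"] key[of "-1" 1] key[of 1 1] key[of "-1" "-1"] show ?thesis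
    unfolding expand by (simp add: abs_le_iff)
qed

text \<open>
  The sum of \<open>h\<close> over the points of a grid, multiplied by the Lipschitz constant of the test function, dominates
  the increments of the test function of the Riemann sum of \<open>g\<close>.
\<close>

lemma PA_mixing:
  fixes X :: "real^'d \<Rightarrow> 'w \<Rightarrow> real"
  assumes X: "measurable_field M X" and Z: "L2_field M (\<lambda>t \<omega>. g (X t \<omega>))" and H: "L2_field M (\<lambda>t \<omega>. h (X t \<omega>))" and PA: "PA M X"
    and C: "integrable lborel (L2_field.C M (\<lambda>t \<omega>. h (X t \<omega>)))"
    and [measurable]: "g \<in> borel_measurable borel" "h \<in> borel_measurable borel"
    and gh: "\<And>x y. x \<le> y \<Longrightarrow> \<bar>g y - g x\<bar> \<le> h y - h x"
  shows "\<exists>\<theta>. \<theta> \<longlonglongrightarrow> 0 \<and> L2_field.mixing M (\<lambda>t \<omega>. g (X t \<omega>)) \<theta>"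
proof -
  interpret Z: L2_field M "\<lambda>t \<omega>. g (X t \<omega>)" by (rule Z)
  interpret H: L2_field M "\<lambda>t \<omega>. h (X t \<omega>)" by (rule H)
  interpret k: covariance_kernel "\<lambda>t. \<bar>H.C t\<bar>" by (rule H.covariance_kernel_abs_C[OF C])
  have "Z.mixing k.tail"
  proof (rule Z.mixingI)
    show "0 \<le> k.tail r" for r by (rule k.tail_nonneg)
    fix r :: nat and U V :: "(real^'d) set" and L L' \<phi> \<psi>
    assume r: "1 \<le> r" and U: "grid_region U" and V: "grid_region V" and sep: "separated r U V"
      and \<phi>: "bdd_lipschitz L \<phi>" and \<psi>: "bdd_lipschitz L' \<psi>"
    note L = bdd_lipschitzD(3)[OF \<phi>] bdd_lipschitzD(3)[OF \<psi>]
    note [measurable] = bdd_lipschitzD(4)[OF \<phi>] bdd_lipschitzD(4)[OF \<psi>]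
    define w where "w n = (1 / real (n + 2)) ^ CARD('d)" for n
    define b where "b n = (\<Sum>s\<in>grid_pts n U. \<Sum>t\<in>grid_pts n V. w n * w n * \<bar>H.C (t - s)\<bar>)" for n
    obtain \<beta> where \<beta>: "b \<longlonglongrightarrow> \<beta>" "\<beta> \<le> measure lborel V * k.tail r"
      using k.double_riemann[OF U V sep] unfolding b_def w_def by blast
    have incr: "\<bar>\<phi> (\<Sum>s\<in>I. v * g ((x(k := b)) s)) - \<phi> (\<Sum>s\<in>I. v * g ((x(k := a)) s))\<bar>
        \<le> (\<Sum>s\<in>I. L * v * h ((x(k := b)) s)) - (\<Sum>s\<in>I. L * v * h ((x(k := a)) s))"
      if \<phi>: "bdd_lipschitz L \<phi>" and I: "finite I" "k \<in> I" and ab: "a \<le> b" and v: "0 \<le> v"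
      for L \<phi> and I :: "(real^'d) set" and k a b v x
    proof -
      have r: "(\<Sum>s\<in>I. f ((x(k := b)) s)) - (\<Sum>s\<in>I. f ((x(k := a)) s)) = f b - f a" for f :: "real \<Rightarrow> real"
        using I by (simp add: sum.remove[OF I])
      have "\<bar>\<phi> (\<Sum>s\<in>I. v * g ((x(k := b)) s)) - \<phi> (\<Sum>s\<in>I. v * g ((x(k := a)) s))\<bar>
          \<le> L * \<bar>(\<Sum>s\<in>I. v * g ((x(k := b)) s)) - (\<Sum>s\<in>I. v * g ((x(k := a)) s))\<bar>"
        by (rule bdd_lipschitzD(2)[OF \<phi>])
      also have "\<dots> = L * (v * \<bar>g b - g a\<bar>)"
        using v r[of "\<lambda>y. v * g y"] by (simp add: right_diff_distrib[symmetric] abs_mult)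
      also have "\<dots> \<le> L * (v * (h b - h a))"
        using v bdd_lipschitzD(3)[OF \<phi>] gh[OF ab] by (intro mult_left_mono) auto
      also have "\<dots> = L * v * h b - L * v * h a" by (simp add: algebra_simps)
      also have "\<dots> = (\<Sum>s\<in>I. L * v * h ((x(k := b)) s)) - (\<Sum>s\<in>I. L * v * h ((x(k := a)) s))"
        using r[of "\<lambda>y. L * v * h y"] by simp
      finally show ?thesis .
    qed
    have "\<bar>cov M (\<lambda>\<omega>. \<phi> (Z.riemann (real (n + 2)) U \<omega>)) (\<lambda>\<omega>. \<psi> (Z.riemann (real (n + 2)) V \<omega>))\<bar> \<le> L * L' * b n" for n
    proof -
      let ?I = "grid_pts n U" and ?J = "grid_pts n V"
      have w: "0 \<le> w n" by (simp add: w_def)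
      note Ud = grid_regionD[OF U] and Vd = grid_regionD[OF V]
      define F G where "F x = \<phi> (\<Sum>s\<in>?I. w n * g (x s))" and "G x = \<psi> (\<Sum>s\<in>?J. w n * g (x s))" for x
      define P Q where "P x = (\<Sum>s\<in>?I. L * w n * h (x s))" and "Q x = (\<Sum>s\<in>?J. L' * w n * h (x s))" for x
      have e: "F (field_at X ?I \<omega>) = \<phi> (Z.riemann (real (n + 2)) U \<omega>)" "G (field_at X ?J \<omega>) = \<psi> (Z.riemann (real (n + 2)) V \<omega>)"
        "P (field_at X ?I \<omega>) = (\<Sum>s\<in>?I. L * w n * h (X s \<omega>))" "Q (field_at X ?J \<omega>) = (\<Sum>s\<in>?J. L' * w n * h (X s \<omega>))" for \<omega>
        by (simp_all add: F_def G_def P_def Q_def field_at_def Z.riemann_def w_def)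
      have "\<bar>cov M (\<lambda>\<omega>. F (field_at X ?I \<omega>)) (\<lambda>\<omega>. G (field_at X ?J \<omega>))\<bar>
          \<le> cov M (\<lambda>\<omega>. P (field_at X ?I \<omega>)) (\<lambda>\<omega>. Q (field_at X ?J \<omega>))"
      proof (rule PA_cov_bound[OF Z.prob_space_axioms PA X Ud(4) Vd(4)])
        show "F \<in> borel_measurable (\<Pi>\<^sub>M t\<in>?I. borel)" "P \<in> borel_measurable (\<Pi>\<^sub>M t\<in>?I. borel)"
          "G \<in> borel_measurable (\<Pi>\<^sub>M t\<in>?J. borel)" "Q \<in> borel_measurable (\<Pi>\<^sub>M t\<in>?J. borel)"
          unfolding F_def[abs_def] G_def[abs_def] P_def[abs_def] Q_def[abs_def] by measurable
        show "\<bar>F (x(k := b)) - F (x(k := a))\<bar> \<le> P (x(k := b)) - P (x(k := a))" if "k \<in> ?I" "a \<le> b" for x k a b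
          unfolding F_def P_def by (rule incr[OF \<phi> Ud(4) that w])
        show "\<bar>G (x(k := b)) - G (x(k := a))\<bar> \<le> Q (x(k := b)) - Q (x(k := a))" if "k \<in> ?J" "a \<le> b" for x k a b
          unfolding G_def Q_def by (rule incr[OF \<psi> Vd(4) that w])
        show "integrable M (\<lambda>\<omega>. (F (field_at X ?I \<omega>))\<^sup>2)" "integrable M (\<lambda>\<omega>. (G (field_at X ?J \<omega>))\<^sup>2)"
          unfolding e using bdd_lipschitzD(1)[OF \<phi>] bdd_lipschitzD(1)[OF \<psi>]
          by (auto intro!: Z.L2_bounded[where B=1])
        show "integrable M (\<lambda>\<omega>. (P (field_at X ?I \<omega>))\<^sup>2)" "integrable M (\<lambda>\<omega>. (Q (field_at X ?J \<omega>))\<^sup>2)"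
          unfolding e by (rule Z.L2_sum, measurable, rule Z.L2_cmult, rule H.L2)+
      qed
      also have "\<dots> = (\<Sum>s\<in>?I. \<Sum>t\<in>?J. (L * w n) * (L' * w n) * H.C (t - s))"
        unfolding e using Ud(4)[of n] Vd(4)[of n]
        by (subst Z.cov_sum_sum) (auto simp: H.L2 H.cov_eq_C)
      also have "\<dots> \<le> (\<Sum>s\<in>?I. \<Sum>t\<in>?J. (L * w n) * (L' * w n) * \<bar>H.C (t - s)\<bar>)"
        using L w by (intro sum_mono mult_left_mono) auto
      also have "\<dots> = L * L' * b n" by (simp add: b_def sum_distrib_left algebra_simps)
      finally show ?thesis unfolding e .
    qed
    moreover have "(\<lambda>n. L * L' * b n) \<longlonglongrightarrow> L * L' * \<beta>" by (intro tendsto_intros \<beta>)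
    moreover have "L * L' * \<beta> \<le> L * L' * (measure lborel V * k.tail r)"
      using L by (intro mult_left_mono \<beta>) auto
    ultimately show "\<exists>b \<beta>. b \<longlonglongrightarrow> \<beta> \<and> \<beta> \<le> L * L' * measure lborel V * k.tail r \<and>
        (\<forall>n. \<bar>cov M (\<lambda>\<omega>. \<phi> (Z.riemann (real (n + 2)) U \<omega>)) (\<lambda>\<omega>. \<psi> (Z.riemann (real (n + 2)) V \<omega>))\<bar> \<le> b n)"
      by (intro exI[of _ "\<lambda>n. L * L' * b n"] exI[of _ "L * L' * \<beta>"]) (auto simp: mult.assoc)
  qed
  then show ?thesis using k.tail_tendsto by blast
qed

section \<open>Multivariate normal distributions\<close>

text \<open>
  One Cholesky step removes a row and a column from the support of the matrix; the Schur
  complement that remains is again positive semidefinite.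
\<close>

lemma psd_factorization_fun:
  fixes c :: "'s::finite \<Rightarrow> 's \<Rightarrow> real"
  assumes "finite F" "\<And>i j. c i j = c j i" "\<And>x. 0 \<le> (\<Sum>i\<in>UNIV. \<Sum>j\<in>UNIV. x i * c i j * x j)"
    "\<And>i j. i \<notin> F \<Longrightarrow> c i j = 0"
  shows "\<exists>a. (\<forall>i j. c i j = (\<Sum>l\<in>UNIV. a i l * a j l)) \<and> (\<forall>i j. j \<notin> F \<longrightarrow> a i j = 0)"
  using assms
proof (induction F arbitrary: c)
  case empty
  then show ?case by (intro exI[of _ "\<lambda>_ _. 0"]) auto
next
  case (insert k F)
  note sym = insert.prems(1) and psd = insert.prems(2) and supp = insert.prems(3)
  define q where "q x = (\<Sum>i\<in>UNIV. \<Sum>j\<in>UNIV. x i * c i j * x j)" for x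
  define e :: "'s \<Rightarrow> real" where "e i = (if i = k then 1 else 0)" for i
  have pick: "(\<Sum>i\<in>UNIV. h i * e i) = h k" for h
  proof -
    have "(\<Sum>i\<in>UNIV. h i * e i) = (\<Sum>i\<in>UNIV. if i = k then h i else 0)"
      by (rule sum.cong) (auto simp: e_def)
    then show ?thesis by simp
  qed
  have expand: "q (\<lambda>i. x i + t * e i) = q x + 2 * t * (\<Sum>i\<in>UNIV. c k i * x i) + t\<^sup>2 * c k k" for x t
  proof -
    have "q (\<lambda>i. x i + t * e i)
        = (\<Sum>i\<in>UNIV. \<Sum>j\<in>UNIV. x i * c i j * x j + t * (x i * c i j * e j) + t * (x j * c i j * e i) + t\<^sup>2 * (c i j * e j * e i))"
      unfolding q_def by (intro sum.cong refl) (simp add: algebra_simps power2_eq_square)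
    also have "\<dots> = q x + t * (\<Sum>i\<in>UNIV. \<Sum>j\<in>UNIV. x i * c i j * e j)
        + t * (\<Sum>i\<in>UNIV. \<Sum>j\<in>UNIV. x j * c i j * e i) + t\<^sup>2 * (\<Sum>i\<in>UNIV. \<Sum>j\<in>UNIV. c i j * e j * e i)"
      unfolding q_def by (simp add: sum.distrib sum_distrib_left)
    also have "(\<Sum>i\<in>UNIV. \<Sum>j\<in>UNIV. x i * c i j * e j) = (\<Sum>i\<in>UNIV. c k i * x i)"
      unfolding pick by (intro sum.cong refl) (simp add: sym[of _ k])
    also have "(\<Sum>i\<in>UNIV. \<Sum>j\<in>UNIV. x j * c i j * e i) = (\<Sum>i\<in>UNIV. c k i * x i)"
      by (subst sum.swap, unfold pick, intro sum.cong refl) simp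
    also have "(\<Sum>i\<in>UNIV. \<Sum>j\<in>UNIV. c i j * e j * e i) = c k k"
      by (simp add: sum_distrib_right[symmetric] pick)
    finally show ?thesis by simp
  qed
  have q0: "0 \<le> q x" for x using psd by (simp add: q_def)
  have ckk: "0 \<le> c k k"
    using q0[of "\<lambda>i. 0 + 1 * e i"] unfolding expand by (simp add: q_def)
  show ?case
  proof (cases "c k k = 0")
    case True
    \<comment> \<open>a vanishing diagonal entry forces its row to vanish: otherwise the form is affine and not constant in
      direction \<open>e\<close>\<close>
    have "c k j = 0" for j
    proof (rule ccontr)
      assume nz: "c k j \<noteq> 0"
      define x :: "'s \<Rightarrow> real" where "x i = (if i = j then 1 else 0)" for i
      have "(\<Sum>i\<in>UNIV. c k i * x i) = (\<Sum>i\<in>UNIV. if i = j then c k i else 0)"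
        by (rule sum.cong) (auto simp: x_def)
      then have "(\<Sum>i\<in>UNIV. c k i * x i) = c k j" by simp
      moreover define t where "t = - (q x + 1) / (2 * c k j)"
      then have "2 * t * c k j = - (q x + 1)" using nz by simp
      ultimately show False using q0[of "\<lambda>i. x i + t * e i"] True unfolding expand by simp
    qed
    then have supp': "i \<notin> F \<Longrightarrow> c i j = 0" for i j
      using supp[of i j] by (cases "i = k") auto
    show ?thesis using insert.IH[OF sym psd supp'] by auto
  next
    case False
    \<comment> \<open>\<open>v\<close> becomes the column \<open>k\<close> of the factor, and \<open>c'\<close> is the Schur complement\<close>
    then have pos: "0 < c k k" using ckk by simp
    define v where "v i = c k i / sqrt (c k k)" for i
    have vv: "v i * v j = c k i * c k j / c k k" for i j using pos by (simp add: v_def)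
    define c' where "c' i j = c i j - v i * v j" for i j
    have sym': "c' i j = c' j i" for i j using sym[of i j] by (simp add: c'_def mult.commute)
    have psd': "0 \<le> (\<Sum>i\<in>UNIV. \<Sum>j\<in>UNIV. x i * c' i j * x j)" for x
    proof -
      let ?s = "\<Sum>i\<in>UNIV. c k i * x i"
      have "(\<Sum>i\<in>UNIV. \<Sum>j\<in>UNIV. x i * c' i j * x j)
          = q x - (\<Sum>i\<in>UNIV. \<Sum>j\<in>UNIV. (c k i * x i) * (c k j * x j)) / c k k"
        unfolding q_def sum_divide_distrib sum_subtractf[symmetric]
        by (intro sum.cong refl) (simp add: c'_def vv algebra_simps)
      also have "(\<Sum>i\<in>UNIV. \<Sum>j\<in>UNIV. (c k i * x i) * (c k j * x j)) = ?s * ?s"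
        by (simp add: sum_product)
      \<comment> \<open>the value of the Schur complement at \<open>x\<close> is the minimum of the form over the line \<open>x + t e\<close>\<close>
      also have "q x - ?s * ?s / c k k = q (\<lambda>i. x i + (- ?s / c k k) * e i)"
        unfolding expand using pos by (simp add: power2_eq_square field_simps)
      finally show ?thesis using q0 by simp
    qed
    have supp': "c' i j = 0" if "i \<notin> F" for i j
    proof (cases "i = k")
      case True
      then show ?thesis using pos by (simp add: c'_def vv)
    next
      case False
      then show ?thesis using supp[of i] that sym[of k i] by (simp add: c'_def vv)
    qed
    obtain a where a: "\<And>i j. c' i j = (\<Sum>l\<in>UNIV. a i l * a j l)" "\<And>i j. j \<notin> F \<Longrightarrow> a i j = 0"
      using insert.IH[OF sym' psd' supp'] by blast
    define b where "b i l = a i l + v i * e l" for i l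
    have ak: "a i k = 0" for i using a(2) insert.hyps by simp
    have "(\<Sum>l\<in>UNIV. b i l * b j l) = c i j" for i j
    proof -
      have "(\<Sum>l\<in>UNIV. b i l * b j l)
          = (\<Sum>l\<in>UNIV. a i l * a j l + v j * a i l * e l + v i * a j l * e l + (v i * v j) * e l * e l)"
        by (intro sum.cong refl) (simp add: b_def algebra_simps)
      also have "\<dots> = c' i j + v j * a i k + v i * a j k + (v i * v j) * e k"
        by (simp only: sum.distrib pick a(1))
      finally show ?thesis by (simp add: ak e_def c'_def)
    qed
    moreover have "b i l = 0" if "l \<notin> insert k F" for i l
      using that a(2)[of l i] by (simp add: b_def e_def)
    ultimately show ?thesis by (intro exI[of _ b]) auto
  qed
qed

lemma psd_factorization:
  fixes C :: "real^'s^'s"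
  assumes sym: "\<And>i j. C $ i $ j = C $ j $ i"
    and psd: "\<And>x. 0 \<le> (\<Sum>i\<in>UNIV. \<Sum>j\<in>UNIV. x i * C $ i $ j * x j)"
  shows "\<exists>A :: real^'s^'s. A ** transpose A = C"
proof -
  have "\<exists>a. (\<forall>i j. C $ i $ j = (\<Sum>l\<in>UNIV. a i l * a j l)) \<and> (\<forall>i j. j \<notin> (UNIV :: 's set) \<longrightarrow> a i j = 0)"
    by (rule psd_factorization_fun[OF finite sym psd]) simp
  then obtain a :: "'s \<Rightarrow> 's \<Rightarrow> real" where a: "\<forall>i j. C $ i $ j = (\<Sum>l\<in>UNIV. a i l * a j l)" by blast
  have "(\<chi> i l. a i l) ** transpose (\<chi> i l. a i l) = C"
    by (simp add: vec_eq_iff matrix_matrix_mult_def transpose_def a)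
  then show ?thesis by blast
qed

text \<open>
  Lebesgue measure on \<open>real^'s\<close> is the image of the product measure over the standard basis; only the indexing of
  the coordinates by basis vectors has to be translated.
\<close>

lemma
  fixes g :: "'s::finite \<Rightarrow> real \<Rightarrow> complex"
  assumes g: "\<And>i. integrable lborel (g i)"
  shows lborel_vec_integrable_prod: "integrable lborel (\<lambda>x::real^'s. \<Prod>i\<in>UNIV. g i (x $ i))"
    and lborel_vec_integral_prod: "(\<integral>x. (\<Prod>i\<in>UNIV. g i (x $ i)) \<partial>(lborel :: (real^'s) measure)) = (\<Prod>i\<in>UNIV. \<integral>y. g i y \<partial>lborel)"
proof -
  define ax :: "'s \<Rightarrow> real^'s" where "ax i = axis i 1" for i
  have inj: "inj ax" by (auto simp: inj_def ax_def axis_eq_axis)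
  have Basis: "Basis = range ax" by (auto simp: Basis_vec_def ax_def)
  define f where "f b = g (inv ax b)" for b
  have f_ax: "f (ax i) = g i" for i using inj by (simp add: f_def)
  interpret product_sigma_finite "\<lambda>_::real^'s. lborel" ..
  define T where "T h = (\<Sum>b\<in>Basis. h b *\<^sub>R b)" for h :: "real^'s \<Rightarrow> real"
  have Tm[measurable]: "T \<in> (\<Pi>\<^sub>M b\<in>Basis. lborel) \<rightarrow>\<^sub>M borel" unfolding T_def[abs_def] by measurable
  have lb: "lborel = distr (\<Pi>\<^sub>M b\<in>Basis. lborel) borel T" unfolding T_def[abs_def] by (rule lborel_eq)
  have T_nth: "T h $ i = h (ax i)" for h i
  proof -
    have "T h $ i = (\<Sum>j\<in>UNIV. h (ax j) * (ax j $ i))"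
      unfolding T_def Basis by (subst sum.reindex[OF inj]) simp
    also have "\<dots> = (\<Sum>j\<in>UNIV. if j = i then h (ax j) else 0)"
      by (rule sum.cong) (auto simp: ax_def axis_def)
    finally show ?thesis by simp
  qed
  have gm[measurable]: "g i \<in> borel_measurable borel" for i using g[of i] by auto
  have eq: "(\<Prod>i\<in>UNIV. g i (T h $ i)) = (\<Prod>b\<in>Basis. f b (h b))" for h
    unfolding Basis T_nth by (subst prod.reindex[OF inj]) (simp add: f_ax)
  have fi: "integrable lborel (f b)" for b using g by (simp add: f_def)
  have P: "integrable (\<Pi>\<^sub>M b\<in>Basis. lborel) (\<lambda>h. \<Prod>i\<in>UNIV. g i (T h $ i))"
    unfolding eq by (rule product_integrable_prod) (use fi in auto)
  have Gm: "(\<lambda>x::real^'s. \<Prod>i\<in>UNIV. g i (x $ i)) \<in> borel_measurable borel" by measurable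
  show "integrable lborel (\<lambda>x::real^'s. \<Prod>i\<in>UNIV. g i (x $ i))"
    using P integrable_distr_eq[OF Tm Gm] by (subst lb) simp
  have "(\<integral>x. (\<Prod>i\<in>UNIV. g i (x $ i)) \<partial>(lborel :: (real^'s) measure)) = (\<integral>h. (\<Prod>i\<in>UNIV. g i (T h $ i)) \<partial>(\<Pi>\<^sub>M b\<in>Basis. lborel))"
    using integral_distr[OF Tm Gm] by (subst lb) simp
  also have "\<dots> = (\<Prod>b\<in>Basis. \<integral>y. f b y \<partial>lborel)"
    unfolding eq by (rule product_integral_prod) (use fi in auto)
  also have "\<dots> = (\<Prod>i\<in>UNIV. \<integral>y. g i y \<partial>lborel)"
    unfolding Basis by (subst prod.reindex[OF inj]) (simp add: f_ax)
  finally show "(\<integral>x. (\<Prod>i\<in>UNIV. g i (x $ i)) \<partial>(lborel :: (real^'s) measure)) = (\<Prod>i\<in>UNIV. \<integral>y. g i y \<partial>lborel)" .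
qed

text \<open>
  The characteristic function factorizes over the coordinates. At zero this gives the total mass.
\<close>

lemma
  fixes b :: "real^'s"
  shows char_std_normal_vec: "(\<integral>z. iexp (b \<bullet> z) \<partial>std_normal_vec) = of_real (exp (- (b \<bullet> b) / 2))"
    and prob_space_std_normal_vec: "prob_space (std_normal_vec :: (real^'s) measure)"
proof -
  define g where "g c i y = of_real (std_normal_density y) * iexp (c $ i * y)" for c :: "real^'s" and i y
  have char: "(\<integral>y. g c i y \<partial>lborel) = of_real (exp (- ((c $ i)\<^sup>2 / 2)))" for c i
  proof -
    have "(\<integral>y. g c i y \<partial>lborel) = char std_normal_distribution (c $ i)"
      unfolding char_def g_def by (subst integral_density) (auto simp: scaleR_conv_of_real)
    then show ?thesis by (simp add: char_std_normal_distribution exp_of_real)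
  qed
  have gi: "integrable lborel (g c i)" for c i
  proof (rule Bochner_Integration.integrable_bound[where f=std_normal_density])
    show "integrable lborel std_normal_density" using integrable_std_normal_moment[of 0] by simp
    show "AE y in lborel. norm (g c i y) \<le> norm (std_normal_density y)" by (simp add: g_def norm_mult)
  qed (simp add: g_def[abs_def])
  have p0: "0 \<le> (\<Prod>i\<in>UNIV. std_normal_density ((x::real^'s) $ i))" for x by (intro prod_nonneg) simp
  have prodeq: "(\<Prod>i\<in>UNIV. std_normal_density (x $ i)) *\<^sub>R iexp (c \<bullet> x) = (\<Prod>i\<in>UNIV. g c i (x $ i))" for x c
    by (simp add: g_def prod.distrib scaleR_conv_of_real inner_vec_def exp_sum[symmetric] sum_distrib_left)
  have int: "(\<integral>z. iexp (c \<bullet> z) \<partial>std_normal_vec) = of_real (exp (- (c \<bullet> c) / 2))" for c :: "real^'s"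
  proof -
    have "(\<integral>z. iexp (c \<bullet> z) \<partial>std_normal_vec) = (\<integral>x. (\<Prod>i\<in>UNIV. std_normal_density (x $ i)) *\<^sub>R iexp (c \<bullet> x) \<partial>lborel)"
      unfolding std_normal_vec_def by (subst integral_density) (auto simp: p0)
    also have "\<dots> = (\<Prod>i\<in>UNIV. of_real (exp (- ((c $ i)\<^sup>2 / 2))))"
      unfolding prodeq by (subst lborel_vec_integral_prod[OF gi]) (simp add: char)
    also have "\<dots> = of_real (exp (\<Sum>i\<in>UNIV. - ((c $ i)\<^sup>2 / 2)))"
      by (simp add: exp_sum)
    also have "(\<Sum>i\<in>UNIV. - ((c $ i)\<^sup>2 / 2)) = - (c \<bullet> c) / 2"
      by (simp add: inner_vec_def sum_negf sum_divide_distrib power2_eq_square)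
    finally show ?thesis .
  qed
  then show "(\<integral>z. iexp (b \<bullet> z) \<partial>std_normal_vec) = of_real (exp (- (b \<bullet> b) / 2))" .
  show "prob_space (std_normal_vec :: (real^'s) measure)"
  proof
    have i: "integrable lborel (\<lambda>x::real^'s. \<Prod>i\<in>UNIV. std_normal_density (x $ i))"
    proof -
      have "integrable lborel (\<lambda>x::real^'s. norm (\<Prod>i\<in>UNIV. g 0 i (x $ i)))"
        by (rule integrable_norm[OF lborel_vec_integrable_prod[OF gi]])
      then show ?thesis by (simp add: g_def prod_norm[symmetric])
    qed
    have "emeasure (std_normal_vec :: (real^'s) measure) (space std_normal_vec)
        = (\<integral>\<^sup>+x. ennreal (\<Prod>i\<in>UNIV. std_normal_density ((x::real^'s) $ i)) \<partial>lborel)"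
      by (simp add: std_normal_vec_def emeasure_density)
    also have "\<dots> = ennreal (\<integral>x. (\<Prod>i\<in>UNIV. std_normal_density ((x::real^'s) $ i)) \<partial>lborel)"
      using i p0 by (intro nn_integral_eq_integral) auto
    also have "(\<integral>x. (\<Prod>i\<in>UNIV. std_normal_density ((x::real^'s) $ i)) \<partial>lborel) = 1"
    proof -
      have "of_real (\<integral>x. (\<Prod>i\<in>UNIV. std_normal_density ((x::real^'s) $ i)) \<partial>lborel)
          = (\<integral>x. (\<Prod>i\<in>UNIV. g 0 i ((x::real^'s) $ i)) \<partial>lborel)"
        unfolding integral_complex_of_real[symmetric] by (rule Bochner_Integration.integral_cong) (auto simp: g_def)
      also have "\<dots> = 1" by (subst lborel_vec_integral_prod[OF gi]) (simp add: char)
      finally show ?thesis by (simp only: of_real_eq_1_iff)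
    qed
    finally show "emeasure (std_normal_vec :: (real^'s) measure) (space std_normal_vec) = 1" by simp
  qed
qed

lemma
  fixes A :: "real^'s^'s"
  defines "N \<equiv> distr std_normal_vec borel (\<lambda>z. A *v z)"
  shows char_normal_vec: "(\<integral>x. iexp (a \<bullet> x) \<partial>N) = of_real (exp (- (a \<bullet> ((A ** transpose A) *v a)) / 2))"
    and prob_space_normal_vec: "prob_space N"
proof -
  have s: "sets std_normal_vec = sets (borel :: (real^'s) measure)" by (simp add: std_normal_vec_def)
  have m: "(\<lambda>z. A *v z) \<in> std_normal_vec \<rightarrow>\<^sub>M borel"
  proof -
    have "(\<lambda>z. A *v z) \<in> borel_measurable borel"
      by (intro borel_measurable_continuous_onI linear_continuous_on matrix_vector_mul_bounded_linear)
    then show ?thesis by (simp cong: measurable_cong_sets add: s)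
  qed
  show "prob_space N" unfolding N_def by (rule prob_space.prob_space_distr[OF prob_space_std_normal_vec m])
  have "(\<integral>x. iexp (a \<bullet> x) \<partial>N) = (\<integral>z. iexp (a \<bullet> (A *v z)) \<partial>std_normal_vec)"
    unfolding N_def by (rule integral_distr[OF m]) measurable
  also have "\<dots> = (\<integral>z. iexp ((transpose A *v a) \<bullet> z) \<partial>std_normal_vec)"
    by (simp add: dot_lmul_matrix[symmetric] transpose_matrix_vector)
  also have "\<dots> = of_real (exp (- ((transpose A *v a) \<bullet> (transpose A *v a)) / 2))"
    by (rule char_std_normal_vec)
  also have "(transpose A *v a) \<bullet> (transpose A *v a) = a \<bullet> ((A ** transpose A) *v a)"
    by (simp add: matrix_vector_mul_assoc[symmetric] dot_lmul_matrix[symmetric] transpose_matrix_vector)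
  finally show "(\<integral>x. iexp (a \<bullet> x) \<partial>N) = of_real (exp (- (a \<bullet> ((A ** transpose A) *v a)) / 2))" .
qed


section \<open>Convergence of characteristic functions\<close>

text \<open>
  The functions whose expectations are linear combinations of values of the characteristic function.
\<close>

inductive trig_poly :: "((real^'s) \<Rightarrow> complex) \<Rightarrow> bool" where
  base: "trig_poly (\<lambda>x. c * iexp (a \<bullet> x))"
| add: "trig_poly p \<Longrightarrow> trig_poly q \<Longrightarrow> trig_poly (\<lambda>x. p x + q x)"

lemma trig_poly_const: "trig_poly (\<lambda>x. c)"
  using trig_poly.base[of c 0] by simp

lemma trig_poly_base_mult: "trig_poly p \<Longrightarrow> trig_poly (\<lambda>x. c * iexp (a \<bullet> x) * p x)"
proof (induction rule: trig_poly.induct)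
  case (base d b)
  have "(\<lambda>x. c * iexp (a \<bullet> x) * (d * iexp (b \<bullet> x))) = (\<lambda>x. (c * d) * iexp ((a + b) \<bullet> x))"
    by (auto simp: inner_add_left exp_add distrib_left)
  then show ?case using trig_poly.base[of "c * d" "a + b"] by simp
next
  case (add p q)
  then show ?case by (simp add: distrib_left trig_poly.add)
qed

lemma trig_poly_mult: "trig_poly p \<Longrightarrow> trig_poly q \<Longrightarrow> trig_poly (\<lambda>x. p x * q x)"
proof (induction rule: trig_poly.induct)
  case (base c a)
  then show ?case by (rule trig_poly_base_mult)
next
  case (add p p')
  then show ?case by (simp add: distrib_right trig_poly.add)
qed

lemma trig_poly_sum: "finite A \<Longrightarrow> (\<And>i. i \<in> A \<Longrightarrow> trig_poly (p i)) \<Longrightarrow> trig_poly (\<lambda>x. \<Sum>i\<in>A. p i x)"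
  by (induction A rule: finite_induct) (auto intro: trig_poly_const trig_poly.add)

lemma trig_poly_sin: "trig_poly (\<lambda>x. of_real (sin (r * x $ i)))"
proof -
  have "of_real (sin (r * x $ i)) = 1 / (2 * \<i>) * iexp ((r *\<^sub>R axis i 1) \<bullet> x) + (- 1 / (2 * \<i>)) * iexp ((- r *\<^sub>R axis i 1) \<bullet> x)" for x :: "real^'a"
  proof -
    have "iexp t = of_real (cos t) + \<i> * of_real (sin t)" for t
      by (simp add: complex_eq_iff Re_exp Im_exp)
    note cs = this[of "r * x $ i"] this[of "- (r * x $ i)"]
    have ip: "(r *\<^sub>R axis i 1) \<bullet> x = r * x $ i" "(- r *\<^sub>R axis i 1) \<bullet> x = - (r * x $ i)"
      by (simp_all add: inner_axis inner_commute[of "axis _ _"])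
    show ?thesis unfolding ip cs by (simp add: field_simps)
  qed
  then show ?thesis by (simp only:) (intro trig_poly.intros)
qed

lemma trig_poly_polynomial_sin:
  assumes "real_polynomial_function (P :: real^'s \<Rightarrow> real)"
  shows "trig_poly (\<lambda>x. of_real (P (\<chi> i. sin (r * x $ i))))"
  using assms
proof (induction rule: real_polynomial_function.induct)
  case (linear f)
  interpret f: bounded_linear f by fact
  have "f (\<chi> i. sin (r * x $ i)) = (\<Sum>i\<in>UNIV. sin (r * x $ i) * f (axis i 1))" for x
  proof -
    have "f (\<chi> i. sin (r * x $ i)) = f (\<Sum>i\<in>UNIV. (\<chi> i. sin (r * x $ i)) $ i *s axis i 1)"
      by (simp only: basis_expansion)
    also have "\<dots> = (\<Sum>i\<in>UNIV. sin (r * x $ i) * f (axis i 1))"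
      by (simp add: f.sum f.scaleR scalar_mult_eq_scaleR)
    finally show ?thesis .
  qed
  then show ?case
    by (simp only: of_real_sum of_real_mult) (intro trig_poly_sum trig_poly_mult trig_poly_sin trig_poly_const finite)
next
  case (const c)
  then show ?case by (rule trig_poly_const)
next
  case (add f g)
  then show ?case using trig_poly.add by simp
next
  case (mult f g)
  then show ?case using trig_poly_mult by simp
qed

lemma trig_poly_measurable_bounded:
  "trig_poly p \<Longrightarrow> p \<in> borel_measurable borel \<and> (\<exists>B. \<forall>x. norm (p x) \<le> B)"
proof (induction rule: trig_poly.induct)
  case (base c a)
  have "norm (c * iexp (a \<bullet> x)) \<le> norm c" for x by (simp add: norm_mult)
  then show ?case by (intro conjI exI[of _ "norm c"]) auto
next
  case (add p q)
  then obtain B B' where "\<And>x. norm (p x) \<le> B" "\<And>x. norm (q x) \<le> B'" by blast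
  then have "norm (p x + q x) \<le> B + B'" for x by (rule norm_triangle_mono)
  then show ?case using add by auto
qed

text \<open>
  A continuous function is approximated on a box by polynomials in \<open>sin (x $ i / R)\<close>. These are
  trigonometric polynomials and, being polynomials on the fixed compact cube of sine values, are
  bounded on the whole space by about the same constant as the function; tightness then
  controls the rest.
\<close>

lemma bounded_trig_approximation:
  fixes g :: "real^'s \<Rightarrow> real"
  assumes g: "continuous_on UNIV g" and B: "\<And>x. \<bar>g x\<bar> \<le> B" and e: "0 < e" and R: "0 < R"
  obtains p where "trig_poly (\<lambda>x. of_real (p x))"
    "\<And>x. \<bar>g x - p x\<bar> \<le> e + (2 * B + e) * indicator {x. \<exists>i. R < \<bar>x $ i\<bar>} x"
proof -
  define K :: "(real^'s) set" where "K = cbox (\<chi> i. -1) (\<chi> i. 1)"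
  define G where "G u = g (\<chi> i. R * arcsin (u $ i))" for u :: "real^'s"
  have comp: "continuous_on K (\<lambda>u. R * arcsin (u $ i))" for i
    by (intro continuous_intros continuous_on_compose2[OF continuous_on_arcsin' continuous_on_component])
       (auto simp: K_def mem_box_cart)
  have "continuous_on K G"
    unfolding G_def by (rule continuous_on_compose2[OF g]) (auto intro: continuous_on_vec_lambda comp)
  then obtain P where P: "real_polynomial_function P" "\<And>u. u \<in> K \<Longrightarrow> \<bar>G u - P u\<bar> < e"
    using Stone_Weierstrass_real_polynomial_function[of K G e] e by (auto simp: K_def)
  define p where "p x = P (\<chi> i. sin ((1 / R) * x $ i))" for x
  have inK: "(\<chi> i. sin ((1 / R) * x $ i)) \<in> K" for x by (simp add: K_def mem_box_cart)
  have B0: "0 \<le> B" using B[of 0] by linarith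
  show thesis
  proof (rule that)
    show "trig_poly (\<lambda>x. of_real (p x))" unfolding p_def by (rule trig_poly_polynomial_sin[OF P(1)])
    fix x
    have near: "\<bar>G (\<chi> i. sin ((1 / R) * x $ i)) - p x\<bar> < e" unfolding p_def by (rule P(2)[OF inK])
    show "\<bar>g x - p x\<bar> \<le> e + (2 * B + e) * indicator {x. \<exists>i. R < \<bar>x $ i\<bar>} x"
    proof (cases "\<exists>i. R < \<bar>x $ i\<bar>")
      case True
      have "\<bar>G (\<chi> i. sin ((1 / R) * x $ i))\<bar> \<le> B" unfolding G_def by (rule B)
      then show ?thesis using True near B[of x] e by (simp add: indicator_def)
    next
      case False
      have "arcsin (sin ((1 / R) * x $ i)) = (1 / R) * x $ i" for i
      proof (rule arcsin_sin)
        have "\<bar>(1 / R) * x $ i\<bar> \<le> 1" using False R by (auto simp: abs_mult not_less field_simps)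
        then show "- (pi / 2) \<le> (1 / R) * x $ i" "(1 / R) * x $ i \<le> pi / 2"
          using pi_gt3 by linarith+
      qed
      then have "G (\<chi> i. sin ((1 / R) * x $ i)) = g x" using R by (simp add: G_def)
      then show ?thesis using near False by simp
    qed
  qed
qed

text \<open>
  Bounded second moments give tightness. Up to a small error a bounded continuous function may thus be replaced by
  a trigonometric polynomial with almost the same bound, and for these the convergence is assumed.
\<close>

lemma converges_of_char:
  fixes Y :: "nat \<Rightarrow> 'w \<Rightarrow> real^'s"
  assumes "prob_space M" and N: "prob_space N" "sets N = sets borel"
    and Y[measurable]: "\<And>n. Y n \<in> borel_measurable M"
    and L2: "\<And>n i. integrable M (\<lambda>\<omega>. (Y n \<omega> $ i)\<^sup>2)" "\<And>n i. (\<integral>\<omega>. (Y n \<omega> $ i)\<^sup>2 \<partial>M) \<le> K"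
    and char: "\<And>a. (\<lambda>n. \<integral>\<omega>. iexp (a \<bullet> Y n \<omega>) \<partial>M) \<longlonglongrightarrow> (\<integral>x. iexp (a \<bullet> x) \<partial>N)"
  shows "converges_in_distribution M Y N"
  unfolding converges_in_distribution_def
proof (intro conjI allI impI Y)
  fix g :: "real^'s \<Rightarrow> real" assume g: "continuous_on UNIV g \<and> bounded (range g)"
  interpret M: prob_space M by fact
  interpret N: prob_space N by fact
  note [measurable_cong] = N(2)
  have gm[measurable]: "g \<in> borel_measurable borel" using g by (intro borel_measurable_continuous_onI) simp
  obtain B where B: "\<And>x. \<bar>g x\<bar> \<le> B" using g by (auto simp: bounded_iff)
  have B0: "0 \<le> B" using B[of 0] by linarith
  have conv: "(\<lambda>n. \<integral>\<omega>. p (Y n \<omega>) \<partial>M) \<longlonglongrightarrow> (\<integral>x. p x \<partial>N)" if "trig_poly p" for p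
    using that
  proof (induction rule: trig_poly.induct)
    case (base c a)
    then show ?case using tendsto_mult_left[OF char[of a], of c] by simp
  next
    case (add p q)
    have i: "integrable M (\<lambda>\<omega>. p (Y n \<omega>))" "integrable N p" if tp: "trig_poly p" for p n
    proof -
      have [measurable]: "p \<in> borel_measurable borel" using trig_poly_measurable_bounded[OF tp] by simp
      obtain C where "\<And>x. norm (p x) \<le> C" using trig_poly_measurable_bounded[OF tp] by blast
      then show "integrable M (\<lambda>\<omega>. p (Y n \<omega>))" "integrable N p"
        by (auto intro!: M.integrable_const_bound[where B=C] N.integrable_const_bound[where B=C])
    qed
    show ?case using tendsto_add[OF add.IH] i[OF add.hyps(1)] i[OF add.hyps(2)] by simp
  qed
  let ?T = "\<lambda>R. {x :: real^'s. \<exists>i. R < \<bar>x $ i\<bar>}"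
  show "(\<lambda>n. \<integral>\<omega>. g (Y n \<omega>) \<partial>M) \<longlonglongrightarrow> (\<integral>x. g x \<partial>N)"
  proof (rule LIMSEQ_I)
    fix \<epsilon> :: real assume "0 < \<epsilon>"
    define e where "e = min 1 (\<epsilon> / 8)"
    have e: "0 < e" "e \<le> 1" "e \<le> \<epsilon> / 8" using \<open>0 < \<epsilon>\<close> by (auto simp: e_def)
    have NT: "(\<lambda>k. \<integral>x. indicat_real (?T (real k)) x \<partial>N) \<longlonglongrightarrow> (\<integral>x. 0 \<partial>N)"
    proof (rule integral_dominated_convergence[where w="\<lambda>_. 1"])
      show "AE x in N. (\<lambda>k. indicat_real (?T (real k)) x) \<longlonglongrightarrow> (0::real)"
        by (intro AE_I2 outside_box_tendsto)
    qed (auto simp: indicator_def)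
    have "(\<lambda>k. \<integral>x. indicat_real (?T (real k)) x \<partial>N) \<longlonglongrightarrow> 0" using NT by simp
    moreover have "0 < \<epsilon> / (8 * (2 * B + 1))" using \<open>0 < \<epsilon>\<close> B0 by simp
    ultimately have ev1: "\<forall>\<^sub>F k in sequentially. (\<integral>x. indicat_real (?T (real k)) x \<partial>N) < \<epsilon> / (8 * (2 * B + 1))"
      by (rule order_tendstoD(2))
    have "(\<lambda>k. CARD('s) * K / (real k)\<^sup>2) \<longlonglongrightarrow> 0"
      by (intro tendsto_divide_0[OF tendsto_const] filterlim_at_top_imp_at_infinity
            filterlim_pow_at_top[OF _ filterlim_real_sequentially]) simp
    then have ev2: "\<forall>\<^sub>F k in sequentially. CARD('s) * K / (real k)\<^sup>2 < \<epsilon> / (8 * (2 * B + 1))"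
      using \<open>0 < \<epsilon> / (8 * (2 * B + 1))\<close> by (rule order_tendstoD(2))
    obtain k :: nat where k: "0 < k" "(\<integral>x. indicat_real (?T (real k)) x \<partial>N) < \<epsilon> / (8 * (2 * B + 1))"
      "CARD('s) * K / (real k)\<^sup>2 < \<epsilon> / (8 * (2 * B + 1))"
      using eventually_happens[OF eventually_conj[OF eventually_gt_at_top[of "0::nat"] eventually_conj[OF ev1 ev2]]] by auto
    obtain p where p: "trig_poly (\<lambda>x. of_real (p x))"
      and near: "\<And>x. \<bar>g x - p x\<bar> \<le> e + (2 * B + e) * indicat_real (?T (real k)) x"
      using bounded_trig_approximation[of g B e "real k"] g B e k by auto
    have pm[measurable]: "p \<in> borel_measurable borel"
    proof -
      note [measurable] = trig_poly_measurable_bounded[OF p, THEN conjunct1]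
      have "(\<lambda>x. Re (of_real (p x))) \<in> borel_measurable borel" by measurable
      then show ?thesis by simp
    qed
    obtain Bp where Bp: "\<And>x. \<bar>p x\<bar> \<le> Bp" using trig_poly_measurable_bounded[OF p] by auto
    have approx: "\<bar>(\<integral>\<omega>. g (V \<omega>) \<partial>Q) - (\<integral>\<omega>. p (V \<omega>) \<partial>Q)\<bar> \<le> \<epsilon> / 4"
      if Q: "prob_space Q" and V[measurable]: "V \<in> borel_measurable Q"
        and t: "(\<integral>\<omega>. indicat_real (?T (real k)) (V \<omega>) \<partial>Q) \<le> \<epsilon> / (8 * (2 * B + 1))"
      for Q :: "'q measure" and V
    proof -
      interpret Q: prob_space Q by fact
      have i: "integrable Q (\<lambda>\<omega>. g (V \<omega>))" "integrable Q (\<lambda>\<omega>. p (V \<omega>))" "integrable Q (\<lambda>\<omega>. indicat_real (?T (real k)) (V \<omega>))"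
        by (rule Q.integrable_const_bound[where B=B], use B in simp, simp)
           (rule Q.integrable_const_bound[where B=Bp], use Bp in simp, simp,
            rule Q.integrable_const_bound[where B=1], simp add: indicator_def, simp)
      have "\<bar>(\<integral>\<omega>. g (V \<omega>) \<partial>Q) - (\<integral>\<omega>. p (V \<omega>) \<partial>Q)\<bar> = \<bar>\<integral>\<omega>. g (V \<omega>) - p (V \<omega>) \<partial>Q\<bar>" using i by simp
      also have "\<dots> \<le> (\<integral>\<omega>. \<bar>g (V \<omega>) - p (V \<omega>)\<bar> \<partial>Q)" by (rule integral_abs_bound)
      also have "\<dots> \<le> (\<integral>\<omega>. e + (2 * B + e) * indicat_real (?T (real k)) (V \<omega>) \<partial>Q)"
        by (rule integral_mono) (use i near in auto)
      also have "\<dots> = e + (2 * B + e) * (\<integral>\<omega>. indicat_real (?T (real k)) (V \<omega>) \<partial>Q)"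
        using i by (simp add: Q.prob_space)
      also have "\<dots> \<le> \<epsilon> / 8 + (2 * B + 1) * (\<epsilon> / (8 * (2 * B + 1)))"
        using e B0 t by (intro add_mono mult_mono) auto
      also have "\<dots> = \<epsilon> / 4" using B0 by (simp add: field_simps)
      finally show ?thesis .
    qed
    have aM: "\<bar>(\<integral>\<omega>. g (Y n \<omega>) \<partial>M) - (\<integral>\<omega>. p (Y n \<omega>) \<partial>M)\<bar> \<le> \<epsilon> / 4" for n
    proof (rule approx[OF assms(1) Y])
      have "(\<integral>\<omega>. indicat_real (?T (real k)) (Y n \<omega>) \<partial>M) \<le> (\<integral>\<omega>. (\<Sum>i\<in>UNIV. (Y n \<omega> $ i)\<^sup>2) / (real k)\<^sup>2 \<partial>M)"
      proof (rule integral_mono)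
        show "integrable M (\<lambda>\<omega>. indicat_real (?T (real k)) (Y n \<omega>))"
          by (rule M.integrable_const_bound[where B=1]) (auto simp: indicator_def)
        show "integrable M (\<lambda>\<omega>. (\<Sum>i\<in>UNIV. (Y n \<omega> $ i)\<^sup>2) / (real k)\<^sup>2)" using L2(1) by simp
        fix \<omega>
        show "indicat_real (?T (real k)) (Y n \<omega>) \<le> (\<Sum>i\<in>UNIV. (Y n \<omega> $ i)\<^sup>2) / (real k)\<^sup>2"
        proof (cases "Y n \<omega> \<in> ?T (real k)")
          case True
          then obtain i where "real k < \<bar>Y n \<omega> $ i\<bar>" by blast
          then have "(real k)\<^sup>2 \<le> (Y n \<omega> $ i)\<^sup>2" using power_mono[of "real k" "\<bar>Y n \<omega> $ i\<bar>" 2] by simp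
          also have "\<dots> \<le> (\<Sum>i\<in>UNIV. (Y n \<omega> $ i)\<^sup>2)" by (rule member_le_sum) auto
          finally show ?thesis using k(1) True by simp
        qed (simp add: sum_nonneg)
      qed
      also have "\<dots> = (\<Sum>i\<in>UNIV. \<integral>\<omega>. (Y n \<omega> $ i)\<^sup>2 \<partial>M) / (real k)\<^sup>2" using L2(1) by simp
      also have "\<dots> \<le> (\<Sum>i\<in>(UNIV::'s set). K) / (real k)\<^sup>2" using L2(2) by (intro divide_right_mono sum_mono) auto
      also have "\<dots> \<le> \<epsilon> / (8 * (2 * B + 1))" using k(3) by simp
      finally show "(\<integral>\<omega>. indicat_real (?T (real k)) (Y n \<omega>) \<partial>M) \<le> \<epsilon> / (8 * (2 * B + 1))" .
    qed
    have aN: "\<bar>(\<integral>x. g x \<partial>N) - (\<integral>x. p x \<partial>N)\<bar> \<le> \<epsilon> / 4"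
      by (rule approx[OF N(1), of "\<lambda>x. x"]) (use k(2) in auto)
    have "(\<lambda>n. \<integral>\<omega>. p (Y n \<omega>) \<partial>M) \<longlonglongrightarrow> (\<integral>x. p x \<partial>N)"
      using tendsto_Re[OF conv[OF p]] by simp
    then have "\<forall>\<^sub>F n in sequentially. dist (\<integral>\<omega>. p (Y n \<omega>) \<partial>M) (\<integral>x. p x \<partial>N) < \<epsilon> / 4"
      using \<open>0 < \<epsilon>\<close> by (intro tendstoD) auto
    then have "\<forall>\<^sub>F n in sequentially. norm ((\<integral>\<omega>. g (Y n \<omega>) \<partial>M) - (\<integral>x. g x \<partial>N)) < \<epsilon>"
    proof eventually_elim
      case (elim n)
      then show ?case using aM[of n] aN \<open>0 < \<epsilon>\<close> unfolding dist_real_def real_norm_def by linarith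
    qed
    then show "\<exists>no. \<forall>n\<ge>no. norm ((\<integral>\<omega>. g (Y n \<omega>) \<partial>M) - (\<integral>x. g x \<partial>N)) < \<epsilon>" by (simp add: eventually_sequentially)
  qed
qed

section \<open>Functions of locally bounded variation\<close>

definition normalized_parts :: "(real \<Rightarrow> real) \<Rightarrow> (real \<Rightarrow> real) set" where
  "normalized_parts f = {\<alpha>. \<alpha> \<in> incr_parts f \<and> \<alpha> 0 = f 0}"

text \<open>
  Monotonicity of \<open>\<alpha>\<close> and of \<open>\<alpha> - f\<close> survives infima and suprema, so \<open>pos_var f\<close> is itself an increasing part
  of \<open>f\<close>. Then \<open>pos_var f\<close> and \<open>- neg_var f\<close> are increasing; their sum is \<open>h_fun f\<close> and their difference is \<open>f\<close>,
  which bounds the increments of \<open>f\<close> by those of \<open>h_fun f\<close>.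
\<close>

context
  fixes f :: "real \<Rightarrow> real" assumes bv: "locally_bv f"
begin

lemma normalized_parts_nonempty: "normalized_parts f \<noteq> {}"
proof -
  obtain \<alpha> \<beta> where ab: "mono \<alpha>" "antimono \<beta>" "\<And>x. f x = \<alpha> x + \<beta> x"
    using bv by (auto simp: locally_bv_def)
  have "(\<lambda>x. \<alpha> x - \<alpha> 0 + f 0) \<in> normalized_parts f"
    using ab by (auto simp: normalized_parts_def incr_parts_def mono_def antimono_def)
  then show ?thesis by blast
qed

lemma normalized_partsD:
  assumes "\<alpha> \<in> normalized_parts f" "x \<le> y"
  shows "\<alpha> x \<le> \<alpha> y" "f y - f x \<le> \<alpha> y - \<alpha> x" "\<alpha> 0 = f 0"
proof -
  have "mono \<alpha>" "antimono (\<lambda>x. f x - \<alpha> x)" and 0: "\<alpha> 0 = f 0"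
    using assms(1) by (auto simp: normalized_parts_def incr_parts_def)
  then show "\<alpha> x \<le> \<alpha> y" "f y - f x \<le> \<alpha> y - \<alpha> x"
    using monoD[of \<alpha> x y] antimonoD[of "\<lambda>x. f x - \<alpha> x" x y] assms(2) by auto
  show "\<alpha> 0 = f 0" by (rule 0)
qed

lemma normalized_part_sign:
  assumes "\<alpha> \<in> normalized_parts f"
  shows "0 \<le> x \<Longrightarrow> f 0 \<le> \<alpha> x" "x \<le> 0 \<Longrightarrow> \<alpha> x \<le> f 0"
  using normalized_partsD(1)[OF assms, of 0 x] normalized_partsD(1)[OF assms, of x 0]
    normalized_partsD(3)[OF assms order_refl] by auto

lemma pos_var_eq:
  "0 < x \<Longrightarrow> pos_var f x = (INF \<alpha>\<in>normalized_parts f. \<alpha> x)"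
  "x < 0 \<Longrightarrow> pos_var f x = (SUP \<alpha>\<in>normalized_parts f. \<alpha> x)"
  "pos_var f 0 = f 0"
  by (auto simp: pos_var_def normalized_parts_def setcompr_eq_image)

lemma pos_var_le: "0 < x \<Longrightarrow> \<alpha> \<in> normalized_parts f \<Longrightarrow> pos_var f x \<le> \<alpha> x"
  unfolding pos_var_eq
  by (rule cINF_lower[of "\<lambda>\<alpha>. \<alpha> x"]) (auto intro!: bdd_belowI[of _ "f 0"] intro: normalized_part_sign)

lemma pos_var_ge: "x < 0 \<Longrightarrow> \<alpha> \<in> normalized_parts f \<Longrightarrow> \<alpha> x \<le> pos_var f x"
  unfolding pos_var_eq
  by (rule cSUP_upper[of _ _ "\<lambda>\<alpha>. \<alpha> x"]) (auto intro!: bdd_aboveI[of _ "f 0"] intro: normalized_part_sign)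

lemma pos_var_greatest: "0 < x \<Longrightarrow> (\<And>\<alpha>. \<alpha> \<in> normalized_parts f \<Longrightarrow> b \<le> \<alpha> x) \<Longrightarrow> b \<le> pos_var f x"
  unfolding pos_var_eq by (rule cINF_greatest[OF normalized_parts_nonempty])

lemma pos_var_least: "x < 0 \<Longrightarrow> (\<And>\<alpha>. \<alpha> \<in> normalized_parts f \<Longrightarrow> \<alpha> x \<le> b) \<Longrightarrow> pos_var f x \<le> b"
  unfolding pos_var_eq by (rule cSUP_least[OF normalized_parts_nonempty])

text \<open>
  The maximum with zero combines the two monotonicity properties. At \<open>0\<close> the function \<open>pos_var f\<close> is given by the
  normalization and not by an infimum, and so \<open>x = 0\<close> is a separate case.
\<close>

lemma pos_var_increment_from_0:
  assumes "0 \<le> x" "x \<le> y"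
  shows "max 0 (f y - f x) \<le> pos_var f y - pos_var f x"
proof (cases "x = y")
  case False
  then have y: "0 < y" using assms by simp
  have "pos_var f x + max 0 (f y - f x) \<le> \<alpha> y" if a: "\<alpha> \<in> normalized_parts f" for \<alpha>
  proof -
    have "pos_var f x \<le> \<alpha> x"
      using pos_var_le[OF _ a, of x] normalized_partsD(3)[OF a order_refl] assms pos_var_eq(3) by (cases "x = 0") auto
    then show ?thesis using normalized_partsD[OF a assms(2)] by simp
  qed
  then have "pos_var f x + max 0 (f y - f x) \<le> pos_var f y" by (rule pos_var_greatest[OF y])
  then show ?thesis by linarith
qed simp

lemma pos_var_increment_to_0:
  assumes "x \<le> y" "y \<le> 0"
  shows "max 0 (f y - f x) \<le> pos_var f y - pos_var f x"
proof (cases "x = y")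
  case False
  then have x: "x < 0" using assms by simp
  have "\<alpha> x \<le> pos_var f y - max 0 (f y - f x)" if a: "\<alpha> \<in> normalized_parts f" for \<alpha>
  proof -
    have "\<alpha> y \<le> pos_var f y"
      using pos_var_ge[OF _ a, of y] normalized_partsD(3)[OF a order_refl] assms pos_var_eq(3) by (cases "y = 0") auto
    then show ?thesis using normalized_partsD[OF a assms(1)] by simp
  qed
  then have "pos_var f x \<le> pos_var f y - max 0 (f y - f x)" by (rule pos_var_least[OF x])
  then show ?thesis by linarith
qed simp

lemma pos_var_increment:
  assumes "x \<le> y"
  shows "max 0 (f y - f x) \<le> pos_var f y - pos_var f x"
proof -
  consider "0 \<le> x" | "y \<le> 0" | "x < 0" "0 < y" by linarith
  then show ?thesis
  proof cases
    case 3
    then show ?thesis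
      using pos_var_increment_to_0[of x 0] pos_var_increment_from_0[of 0 y] by (simp add: max_def split: if_splits)
  qed (use assms pos_var_increment_from_0 pos_var_increment_to_0 in auto)
qed

lemma h_fun_increment:
  assumes "x \<le> y"
  shows "\<bar>f y - f x\<bar> \<le> h_fun f y - h_fun f x"
  using pos_var_increment[OF assms] by (auto simp: h_fun_def neg_var_def abs_le_iff)

lemma locally_bv_measurable: "f \<in> borel_measurable borel" "h_fun f \<in> borel_measurable borel"
proof -
  obtain \<alpha> \<beta> where ab: "mono \<alpha>" "antimono \<beta>" "\<And>x. f x = \<alpha> x + \<beta> x"
    using bv by (auto simp: locally_bv_def)
  have "mono (\<lambda>x. - \<beta> x)" using ab(2) by (auto simp: mono_def antimono_def)
  from borel_measurable_mono[OF this] borel_measurable_mono[OF ab(1)]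
  have [measurable]: "\<alpha> \<in> borel_measurable borel" "(\<lambda>x. - \<beta> x) \<in> borel_measurable borel" by auto
  have "(\<lambda>x. \<alpha> x - (- \<beta> x)) \<in> borel_measurable borel" by measurable
  moreover have "f = (\<lambda>x. \<alpha> x - (- \<beta> x))" using ab(3) by auto
  ultimately show "f \<in> borel_measurable borel" by simp
  have "mono (h_fun f)"
  proof (rule monoI)
    fix x y :: real assume "x \<le> y"
    then show "h_fun f x \<le> h_fun f y" using h_fun_increment[of x y] by linarith
  qed
  then show "h_fun f \<in> borel_measurable borel" by (rule borel_measurable_mono)
qed

end


section \<open>The joint limit theorem\<close>

lemma linear_combination_field:
  fixes X :: "real^'d \<Rightarrow> 'w \<Rightarrow> real" and f :: "'s::finite \<Rightarrow> real \<Rightarrow> real" and a :: "'s \<Rightarrow> real"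
  assumes "prob_space M" and X: "measurable_field M X" "stationary_field M X"
    and f[measurable]: "\<And>i. f i \<in> borel_measurable borel"
    and L2: "\<And>i. integrable M (\<lambda>\<omega>. (f i (X 0 \<omega>))\<^sup>2)"
  shows "L2_field M (\<lambda>t \<omega>. \<Sum>i\<in>UNIV. a i * f i (X t \<omega>))"
    and "L2_field.C M (\<lambda>t \<omega>. \<Sum>i\<in>UNIV. a i * f i (X t \<omega>)) t
      = (\<Sum>i\<in>UNIV. \<Sum>j\<in>UNIV. a i * a j * cov M (\<lambda>\<omega>. f i (X 0 \<omega>)) (\<lambda>\<omega>. f j (X t \<omega>)))"
proof -
  interpret prob_space M by fact
  have fi: "L2_field M (\<lambda>t \<omega>. f i (X t \<omega>))" for i
    by standard (use L2 measurable_field_compose[OF X(1) f] stationary_field_compose[OF X f] in auto)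
  have m[measurable]: "(\<lambda>\<omega>. f i (X t \<omega>)) \<in> borel_measurable M" for i t
    using measurable_compose[OF measurable_field_at[OF X(1)] f] .
  have L2t: "integrable M (\<lambda>\<omega>. (f i (X t \<omega>))\<^sup>2)" for i t by (rule L2_field.L2[OF fi])
  have g: "(\<lambda>x. \<Sum>i\<in>UNIV. a i * f i x) \<in> borel_measurable borel" by measurable
  show Z: "L2_field M (\<lambda>t \<omega>. \<Sum>i\<in>UNIV. a i * f i (X t \<omega>))"
  proof
    show "integrable M (\<lambda>\<omega>. (\<Sum>i\<in>UNIV. a i * f i (X 0 \<omega>))\<^sup>2)"
      by (rule L2_sum, measurable, rule L2_cmult, rule L2)
  qed (use measurable_field_compose[OF X(1) g] stationary_field_compose[OF X g] in auto)
  show "L2_field.C M (\<lambda>t \<omega>. \<Sum>i\<in>UNIV. a i * f i (X t \<omega>)) t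
      = (\<Sum>i\<in>UNIV. \<Sum>j\<in>UNIV. a i * a j * cov M (\<lambda>\<omega>. f i (X 0 \<omega>)) (\<lambda>\<omega>. f j (X t \<omega>)))"
    unfolding L2_field.C_def[OF Z] by (rule cov_sum_sum) (use L2t in auto)
qed

text \<open>
  The limits of the characteristic functions come from the theorem for scalar fields, applied to all linear combinations. The
  limit matrix is positive semidefinite because its quadratic form at \<open>a\<close> is the asymptotic variance of the
  linear combination with coefficients \<open>a\<close>, and it is symmetric because reversing the lag exchanges
  the two components.
\<close>

lemma joint_CLT:
  fixes X :: "real^'d \<Rightarrow> 'w \<Rightarrow> real" and f :: "'s::finite \<Rightarrow> real \<Rightarrow> real"
  assumes M: "prob_space M" and X: "measurable_field M X" "stationary_field M X" and VH: "VH_growing W"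
    and f[measurable]: "\<And>i. f i \<in> borel_measurable borel"
    and L2: "\<And>i. integrable M (\<lambda>\<omega>. (f i (X 0 \<omega>))\<^sup>2)"
    and C: "\<And>i j. integrable lborel (\<lambda>t. cov M (\<lambda>\<omega>. f i (X 0 \<omega>)) (\<lambda>\<omega>. f j (X t \<omega>)))"
    and mix: "\<And>a :: 's \<Rightarrow> real. \<exists>\<theta>. \<theta> \<longlonglongrightarrow> 0 \<and> L2_field.mixing M (\<lambda>t \<omega>. \<Sum>i\<in>UNIV. a i * f i (X t \<omega>)) \<theta>"
  shows "(\<forall>i. integrable M (\<lambda>\<omega>. (f i (X 0 \<omega>))\<^sup>2)) \<and>
         (\<forall>n i. AE \<omega> in M. set_integrable lborel (W n) (\<lambda>t. f i (X t \<omega>))) \<and>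
         (\<forall>i j. integrable lborel (\<lambda>t. cov M (\<lambda>\<omega>. f i (X 0 \<omega>)) (\<lambda>\<omega>. f j (X t \<omega>)))) \<and>
         (\<exists>N. is_centered_normal
                (\<chi> i j. LINT t|lborel. cov M (\<lambda>\<omega>. f i (X 0 \<omega>)) (\<lambda>\<omega>. f j (X t \<omega>))) N \<and>
              converges_in_distribution M
                (\<lambda>n \<omega>. \<chi> i.
                   ((LINT t:W n|lborel. f i (X t \<omega>))
                      - (LINT \<omega>'|M. f i (X 0 \<omega>')) * measure lborel (W n))
                   / sqrt (measure lborel (W n))) N)"
proof -
  interpret prob_space M by (rule M)
  have W: "compact (W n)" "0 < measure lborel (W n)" for n using VH by (auto simp: VH_growing_def)
  have Wb: "W n \<in> sets borel" "bounded (W n)" for n using W by (auto intro: borel_compact compact_imp_bounded)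
  define cv where "cv i j t = cov M (\<lambda>\<omega>. f i (X 0 \<omega>)) (\<lambda>\<omega>. f j (X t \<omega>))" for i j t
  define c where "c i j = (\<integral>t. cv i j t \<partial>lborel)" for i j
  define Z where "Z a t \<omega> = (\<Sum>i\<in>UNIV. a i * f i (X t \<omega>))" for a :: "'s \<Rightarrow> real" and t \<omega>
  have Zf: "L2_field M (Z a)" for a
    unfolding Z_def[abs_def] by (rule linear_combination_field(1)[OF M X f L2])
  have ZC: "L2_field.C M (Z a) t = (\<Sum>i\<in>UNIV. \<Sum>j\<in>UNIV. a i * a j * cv i j t)" for a t
    unfolding Z_def[abs_def] cv_def by (rule linear_combination_field(2)[OF M X f L2])
  have ZCi: "integrable lborel (L2_field.C M (Z a))" for a
    unfolding ZC using C by (auto simp: cv_def)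
  have cvi: "integrable lborel (cv i j)" for i j using C by (simp add: cv_def[abs_def])
  have Zint: "(\<integral>t. L2_field.C M (Z a) t \<partial>lborel) = (\<Sum>i\<in>UNIV. \<Sum>j\<in>UNIV. a i * a j * c i j)" for a
    unfolding ZC c_def using cvi by simp
  define single :: "'s \<Rightarrow> 's \<Rightarrow> real" where "single i j = (if j = i then 1 else 0)" for i j
  have Zs: "Z (single i) t \<omega> = f i (X t \<omega>)" for i t \<omega>
  proof -
    have "Z (single i) t \<omega> = (\<Sum>j\<in>UNIV. if j = i then f j (X t \<omega>) else 0)"
      unfolding Z_def by (rule sum.cong) (auto simp: single_def)
    then show ?thesis by simp
  qed
  have Fi: "L2_field M (\<lambda>t \<omega>. f i (X t \<omega>))" for i using Zf[of "single i"] by (simp add: Zs[abs_def])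
  have FCi: "integrable lborel (L2_field.C M (\<lambda>t \<omega>. f i (X t \<omega>)))" for i
    using ZCi[of "single i"] by (simp add: Zs[abs_def])
  let ?S = "\<lambda>i n \<omega>. L2_field.S (\<lambda>t \<omega>. f i (X t \<omega>)) (W n) \<omega>"
  let ?\<mu> = "\<lambda>i. L2_field.\<mu> M (\<lambda>t \<omega>. f i (X t \<omega>))"
  define \<Lambda> where "\<Lambda> n = measure lborel (W n)" for n
  have \<Lambda>0: "0 < \<Lambda> n" for n using W by (simp add: \<Lambda>_def)
  define Y where "Y n \<omega> = (\<chi> i. (?S i n \<omega> - ?\<mu> i * \<Lambda> n) / sqrt (\<Lambda> n))" for n \<omega>
  have Y_eq: "Y = (\<lambda>n \<omega>. \<chi> i. ((LINT t:W n|lborel. f i (X t \<omega>))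
      - (LINT \<omega>'|M. f i (X 0 \<omega>')) * measure lborel (W n)) / sqrt (measure lborel (W n)))"
    unfolding Y_def[abs_def] L2_field.S_def[OF Fi] L2_field.\<mu>_def[OF Fi] \<Lambda>_def ..
  have Sm[measurable]: "?S i n \<in> borel_measurable M" for i n by (rule L2_field.S_measurable[OF Fi Wb(1)])
  have Ym: "Y n \<in> borel_measurable M" for n
    by (subst borel_measurable_euclidean_space) (auto simp: Y_def Basis_vec_def inner_axis)
  have AE_int: "AE \<omega> in M. set_integrable lborel (W n) (\<lambda>t. f i (X t \<omega>))" for n i
    by (rule L2_field.S_AE[OF Fi Wb])
  have sym: "c i j = c j i" for i j
  proof -
    have "cv i j t = cv j i (0 - t)" for t
    proof -
      have [measurable]: "(\<lambda>x. (f i (x 0) - ?\<mu> i) * (f j (x t) - ?\<mu> j)) \<in> borel_measurable (\<Pi>\<^sub>M s\<in>{0, t}. borel)"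
        by measurable
      show ?thesis
        using stationary_integral[OF X, of "{0, t}" "\<lambda>x. (f i (x 0) - ?\<mu> i) * (f j (x t) - ?\<mu> j)" "- t"]
        by (simp add: cv_def cov_def L2_field.mean[OF Fi] field_at_def mult.commute)
    qed
    then have "c i j = (\<integral>t. cv j i (0 - t) \<partial>lborel)" by (simp add: c_def)
    also have "\<dots> = c j i" unfolding c_def by (rule lborel_integral_reflect) (use C in \<open>simp add: cv_def\<close>)
    finally show ?thesis .
  qed
  have psd: "0 \<le> (\<Sum>i\<in>UNIV. \<Sum>j\<in>UNIV. a i * (\<chi> i j. c i j) $ i $ j * a j)" for a
  proof -
    have "0 \<le> (\<integral>t. L2_field.C M (Z a) t \<partial>lborel)"
      by (rule LIMSEQ_le_const[OF L2_field.block_variance_lim[OF Zf ZCi]])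
         (simp add: L2_field.block_variance_def[OF Zf])
    then show ?thesis unfolding Zint by (simp add: mult_ac)
  qed
  obtain A :: "real^'s^'s" where A: "A ** transpose A = (\<chi> i j. c i j)"
    using psd_factorization[of "\<chi> i j. c i j", OF _ psd] sym by auto
  define N where "N = distr std_normal_vec borel (\<lambda>z. A *v z)"
  have normal: "is_centered_normal (\<chi> i j. c i j) N"
    unfolding is_centered_normal_def N_def using A by blast
  have charN: "(\<integral>x. iexp (b \<bullet> x) \<partial>N) = of_real (exp (- ((\<Sum>i\<in>UNIV. \<Sum>j\<in>UNIV. b $ i * b $ j * c i j) / 2)))" for b
  proof -
    have "b \<bullet> ((\<chi> i j. c i j) *v b) = (\<Sum>i\<in>UNIV. \<Sum>j\<in>UNIV. b $ i * b $ j * c i j)"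
      by (simp add: inner_vec_def matrix_vector_mult_def sum_distrib_left algebra_simps)
    then show ?thesis unfolding N_def char_normal_vec A by simp
  qed
  have charY: "(\<lambda>n. expectation (\<lambda>\<omega>. iexp (b \<bullet> Y n \<omega>))) \<longlonglongrightarrow> (\<integral>x. iexp (b \<bullet> x) \<partial>N)" for b
  proof -
    let ?a = "\<lambda>i. b $ i"
    interpret Z: L2_field M "Z ?a" by (rule Zf)
    obtain \<theta> where \<theta>: "\<theta> \<longlonglongrightarrow> 0" "Z.mixing \<theta>" using mix[of ?a] by (auto simp: Z_def[abs_def])
    have "Z.\<mu> = (\<Sum>i\<in>UNIV. b $ i * ?\<mu> i)"
      unfolding Z.\<mu>_def L2_field.\<mu>_def[OF Fi] Z_def
      using L2_field.integrable_Z[OF Fi] by simp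
    note mu = this
    have "expectation (\<lambda>\<omega>. iexp ((Z.S (W n) \<omega> - Z.\<mu> * \<Lambda> n) / sqrt (\<Lambda> n))) = expectation (\<lambda>\<omega>. iexp (b \<bullet> Y n \<omega>))" for n
    proof (rule integral_cong_AE)
      have "AE \<omega> in M. \<forall>i. set_integrable lborel (W n) (\<lambda>t. f i (X t \<omega>))"
        using AE_int[of n] by (simp add: AE_all_countable)
      then have "AE \<omega> in M. (Z.S (W n) \<omega> - Z.\<mu> * \<Lambda> n) / sqrt (\<Lambda> n) = b \<bullet> Y n \<omega>"
      proof eventually_elim
        case (elim \<omega>)
        have "Z.S (W n) \<omega> = (\<Sum>i\<in>UNIV. b $ i * ?S i n \<omega>)"
          unfolding Z.S_def L2_field.S_def[OF Fi] Z_def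
          using elim by (simp add: set_lebesgue_integral_def set_integrable_def sum_distrib_left mult.left_commute)
        then show ?case
          by (simp add: Y_def inner_vec_def mu sum_divide_distrib[symmetric] sum_subtractf[symmetric] sum_distrib_right
               right_diff_distrib mult.assoc)
      qed
      then show "AE \<omega> in M. iexp ((Z.S (W n) \<omega> - Z.\<mu> * \<Lambda> n) / sqrt (\<Lambda> n)) = iexp (b \<bullet> Y n \<omega>)"
        by eventually_elim simp
    qed (use Z.S_measurable[OF Wb(1)[of n]] Ym[of n] in measurable)
    then show ?thesis
      using Z.mixing_CLT[OF ZCi \<theta>(2,1) VH] unfolding charN Zint by (simp add: \<Lambda>_def)
  qed
  define K where "K = (\<Sum>i\<in>UNIV. \<integral>u. \<bar>L2_field.C M (\<lambda>t \<omega>. f i (X t \<omega>)) u\<bar> \<partial>lborel)"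
  have YL2: "integrable M (\<lambda>\<omega>. (Y n \<omega> $ i)\<^sup>2)" "expectation (\<lambda>\<omega>. (Y n \<omega> $ i)\<^sup>2) \<le> K" for n i
  proof -
    interpret F: L2_field M "\<lambda>t \<omega>. f i (X t \<omega>)" by (rule Fi)
    have sq: "(Y n \<omega> $ i)\<^sup>2 = (F.S (W n) \<omega> - F.\<mu> * \<Lambda> n)\<^sup>2 / \<Lambda> n" for \<omega>
      using \<Lambda>0[of n] by (simp add: Y_def power_divide)
    show "integrable M (\<lambda>\<omega>. (Y n \<omega> $ i)\<^sup>2)"
      unfolding sq using L2_diff[OF _ _ F.S_L2[OF Wb], of n "\<lambda>_. F.\<mu> * \<Lambda> n"] Wb by simp
    have "expectation (\<lambda>\<omega>. (Y n \<omega> $ i)\<^sup>2) = expectation (\<lambda>\<omega>. (F.S (W n) \<omega> - F.\<mu> * \<Lambda> n)\<^sup>2) / \<Lambda> n"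
      unfolding sq by simp
    also have "\<dots> \<le> (\<Lambda> n * (\<integral>u. \<bar>F.C u\<bar> \<partial>lborel)) / \<Lambda> n"
      using F.S_variance_le[OF Wb FCi, of n] \<Lambda>0[of n] unfolding \<Lambda>_def by (intro divide_right_mono) auto
    also have "\<dots> = (\<integral>u. \<bar>F.C u\<bar> \<partial>lborel)" using \<Lambda>0[of n] by simp
    also have "\<dots> \<le> K" unfolding K_def
      by (rule member_le_sum[of i UNIV "\<lambda>i. \<integral>u. \<bar>L2_field.C M (\<lambda>t \<omega>. f i (X t \<omega>)) u\<bar> \<partial>lborel"]) auto
    finally show "expectation (\<lambda>\<omega>. (Y n \<omega> $ i)\<^sup>2) \<le> K" .
  qed
  have "converges_in_distribution M Y N"
    by (rule converges_of_char[OF M _ _ Ym YL2 charY]) (simp_all add: N_def prob_space_normal_vec)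
  then show ?thesis
    using L2 AE_int C normal unfolding Y_eq c_def cv_def by blast
qed

lemma lipschitz_combination:
  fixes f :: "'s::finite \<Rightarrow> real \<Rightarrow> real"
  assumes "\<And>i x y. \<bar>f i x - f i y\<bar> \<le> Lf i * \<bar>x - y\<bar>"
  shows "\<bar>(\<Sum>i\<in>UNIV. a i * f i x) - (\<Sum>i\<in>UNIV. a i * f i y)\<bar> \<le> (\<Sum>i\<in>UNIV. \<bar>a i\<bar> * Lf i) * \<bar>x - y\<bar>"
proof -
  have "\<bar>(\<Sum>i\<in>UNIV. a i * f i x) - (\<Sum>i\<in>UNIV. a i * f i y)\<bar> = \<bar>\<Sum>i\<in>UNIV. a i * (f i x - f i y)\<bar>"
    by (simp add: sum_subtractf right_diff_distrib)
  also have "\<dots> \<le> (\<Sum>i\<in>UNIV. \<bar>a i * (f i x - f i y)\<bar>)" by (rule sum_abs)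
  also have "\<dots> \<le> (\<Sum>i\<in>UNIV. \<bar>a i\<bar> * (Lf i * \<bar>x - y\<bar>))"
    by (intro sum_mono) (simp add: abs_mult mult_left_mono assms)
  finally show ?thesis by (simp add: sum_distrib_right mult.assoc)
qed

theorem corollary11:
  fixes M :: "'w measure"
    and X :: "real^'d \<Rightarrow> 'w \<Rightarrow> real"
    and f :: "'s::finite \<Rightarrow> real \<Rightarrow> real"
    and W :: "nat \<Rightarrow> (real^'d) set"
  assumes "prob_space M"
    and "measurable_field M X"
    and "stationary_field M X"
    and "VH_growing W"
    and "(\<exists>\<theta> :: nat \<Rightarrow> real.
            antimono_on {1..} \<theta> \<and> \<theta> \<longlonglongrightarrow> 0 \<and> BL_dependent M X \<theta> \<and>
            (\<forall>i. \<exists>L. L-lipschitz_on UNIV (f i)) \<and>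
            (\<forall>i. integrable M (\<lambda>\<omega>. (f i (X 0 \<omega>))\<^sup>2)) \<and>
            (\<forall>i j. integrable lborel
               (\<lambda>t. \<bar>cov M (\<lambda>\<omega>. f i (X 0 \<omega>)) (\<lambda>\<omega>. f j (X t \<omega>))\<bar>)))
       \<or> (QA M X \<and>
          (\<exists>c>0. \<exists>\<epsilon>>0. \<forall>t. t \<noteq> 0 \<longrightarrow>
             cov M (X 0) (X t) \<le> c * infnorm t powr (- real CARD('d) - \<epsilon>)) \<and>
          (\<forall>i. \<exists>L. L-lipschitz_on UNIV (f i)))
       \<or> (PA M X \<and> integrable M (\<lambda>\<omega>. (X 0 \<omega>)\<^sup>2) \<and>
          (\<forall>i. locally_bv (f i)) \<and>
          (\<forall>i. integrable M (\<lambda>\<omega>. (h_fun (f i) (X 0 \<omega>))\<^sup>2)) \<and>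
          (\<exists>c>0. \<exists>\<epsilon>>0. \<forall>t i j. t \<noteq> 0 \<longrightarrow>
             cov M (\<lambda>\<omega>. h_fun (f i) (X 0 \<omega>)) (\<lambda>\<omega>. h_fun (f j) (X t \<omega>))
               \<le> c * infnorm t powr (- real CARD('d) - \<epsilon>)))"
  shows "(\<forall>i. integrable M (\<lambda>\<omega>. (f i (X 0 \<omega>))\<^sup>2)) \<and>
         (\<forall>n i. AE \<omega> in M. set_integrable lborel (W n) (\<lambda>t. f i (X t \<omega>))) \<and>
         (\<forall>i j. integrable lborel (\<lambda>t. cov M (\<lambda>\<omega>. f i (X 0 \<omega>)) (\<lambda>\<omega>. f j (X t \<omega>)))) \<and>
         (\<exists>N. is_centered_normal
                (\<chi> i j. LINT t|lborel. cov M (\<lambda>\<omega>. f i (X 0 \<omega>)) (\<lambda>\<omega>. f j (X t \<omega>))) N \<and>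
              converges_in_distribution M
                (\<lambda>n \<omega>. \<chi> i.
                   ((LINT t:W n|lborel. f i (X t \<omega>))
                      - (LINT \<omega>'|M. f i (X 0 \<omega>')) * measure lborel (W n))
                   / sqrt (measure lborel (W n))) N)"
proof -
  note M = assms(1) and X = assms(2,3) and VH = assms(4)
  interpret prob_space M by (rule M)
  have lip: "\<exists>Lf. (\<forall>i x y. \<bar>f i x - f i y\<bar> \<le> Lf i * \<bar>x - y\<bar>) \<and> (\<forall>i. f i \<in> borel_measurable borel)"
    if ex: "\<forall>i. \<exists>L. L-lipschitz_on UNIV (f i)"
  proof -
    obtain Lf where Lf: "\<And>i. (Lf i)-lipschitz_on UNIV (f i)" using choice[OF ex] by blast
    have "\<bar>f i x - f i y\<bar> \<le> Lf i * \<bar>x - y\<bar>" for i x y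
      using lipschitz_onD[OF Lf[of i], of x y] by (simp add: dist_real_def)
    moreover have "f i \<in> borel_measurable borel" for i
      using Lf[of i] by (intro borel_measurable_continuous_onI lipschitz_on_continuous_on)
    ultimately show ?thesis by blast
  qed
  have cov_measurable: "(\<lambda>t. cov M (\<lambda>\<omega>. g (X 0 \<omega>)) (\<lambda>\<omega>. h (X t \<omega>))) \<in> borel_measurable borel"
    if [measurable]: "g \<in> borel_measurable borel" "h \<in> borel_measurable borel" for g h
  proof -
    note [measurable (raw)] = measurable_field_eval[OF X(1)]
    show ?thesis unfolding cov_def by measurable
  qed
  have Xm[measurable]: "X t \<in> borel_measurable M" for t by (rule measurable_field_at[OF X(1)])
  from assms(5) consider (BL) \<theta> where "antimono_on {1..} \<theta>" "\<theta> \<longlonglongrightarrow> 0" "BL_dependent M X \<theta>"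
        "\<forall>i. \<exists>L. L-lipschitz_on UNIV (f i)" "\<forall>i. integrable M (\<lambda>\<omega>. (f i (X 0 \<omega>))\<^sup>2)"
        "\<forall>i j. integrable lborel (\<lambda>t. \<bar>cov M (\<lambda>\<omega>. f i (X 0 \<omega>)) (\<lambda>\<omega>. f j (X t \<omega>))\<bar>)"
    | (QA) c \<epsilon> where "QA M X" "0 < c" "0 < \<epsilon>"
        "\<forall>t. t \<noteq> 0 \<longrightarrow> cov M (X 0) (X t) \<le> c * infnorm t powr (- real CARD('d) - \<epsilon>)"
        "\<forall>i. \<exists>L. L-lipschitz_on UNIV (f i)"
    | (PA) c \<epsilon> where "PA M X" "\<forall>i. locally_bv (f i)" "\<forall>i. integrable M (\<lambda>\<omega>. (h_fun (f i) (X 0 \<omega>))\<^sup>2)"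
        "0 < c" "0 < \<epsilon>" "\<forall>t i j. t \<noteq> 0 \<longrightarrow> cov M (\<lambda>\<omega>. h_fun (f i) (X 0 \<omega>)) (\<lambda>\<omega>. h_fun (f j) (X t \<omega>))
               \<le> c * infnorm t powr (- real CARD('d) - \<epsilon>)"
    by blast
  then show ?thesis
  proof cases
    case BL
    obtain Lf where Lf: "\<And>i x y. \<bar>f i x - f i y\<bar> \<le> Lf i * \<bar>x - y\<bar>" and f: "\<And>i. f i \<in> borel_measurable borel"
      using lip[OF BL(4)] by blast
    have L2: "integrable M (\<lambda>\<omega>. (f i (X 0 \<omega>))\<^sup>2)" for i using BL(5) by simp
    show ?thesis
    proof (rule joint_CLT[OF M X VH f L2])
      show "integrable lborel (\<lambda>t. cov M (\<lambda>\<omega>. f i (X 0 \<omega>)) (\<lambda>\<omega>. f j (X t \<omega>)))" for i j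
        by (rule integrable_abs_cancel) (use BL(6) cov_measurable[OF f f] in auto)
      fix a :: "'s \<Rightarrow> real"
      let ?L = "\<Sum>i\<in>UNIV. \<bar>a i\<bar> * Lf i"
      have "L2_field.mixing M (\<lambda>t \<omega>. \<Sum>i\<in>UNIV. a i * f i (X t \<omega>)) (\<lambda>r. ?L\<^sup>2 * \<theta> r)"
        by (rule BL_mixing[OF _ BL(3,1,2), where g="\<lambda>x. \<Sum>i\<in>UNIV. a i * f i x"])
           (rule linear_combination_field(1)[OF M X f L2], rule lipschitz_combination[OF Lf])
      moreover have "(\<lambda>r. ?L\<^sup>2 * \<theta> r) \<longlonglongrightarrow> 0" using tendsto_mult_left[OF BL(2), of "?L\<^sup>2"] by simp
      ultimately show "\<exists>\<theta>. \<theta> \<longlonglongrightarrow> 0 \<and> L2_field.mixing M (\<lambda>t \<omega>. \<Sum>i\<in>UNIV. a i * f i (X t \<omega>)) \<theta>" by blast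
    qed
  next
    case QA
    obtain Lf where Lf: "\<And>i x y. \<bar>f i x - f i y\<bar> \<le> Lf i * \<bar>x - y\<bar>" and f[measurable]: "\<And>i. f i \<in> borel_measurable borel"
      using lip[OF QA(5)] by blast
    have X2: "integrable M (\<lambda>\<omega>. (X t \<omega>)\<^sup>2)" for t using QA(1) by (simp add: QA_def)
    have XF: "L2_field M X" by standard (use X X2 in auto)
    interpret X: L2_field M X by (rule XF)
    \<comment> \<open>near the origin the covariance is bounded by the variance, elsewhere by the assumed decay\<close>
    have XC: "integrable lborel X.C"
    proof (rule X.integrable_C_of_upper_bound)
      let ?g = "\<lambda>t::real^'d. if infnorm t \<le> 1 then X.C 0 else c * infnorm t powr (- real CARD('d) - \<epsilon>)"
      show "integrable lborel ?g" using QA(2,3) X.C0_nonneg by (intro integrable_power_decay) auto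
      show "X.C u \<le> ?g u" for u using QA(4) X.abs_C_le[of u] by (cases "u = 0") (auto simp: X.C_def infnorm_0 abs_le_iff)
      show "0 \<le> ?g u" for u using QA(2) X.C0_nonneg by simp
    qed
    have L2: "integrable M (\<lambda>\<omega>. (f i (X 0 \<omega>))\<^sup>2)" for i
    proof (rule L2_dominated[OF _ _ X2[of 0]])
      show "\<bar>f i (X 0 \<omega>)\<bar> \<le> \<bar>f i 0\<bar> + Lf i * \<bar>X 0 \<omega>\<bar>" for \<omega> using Lf[of i "X 0 \<omega>" 0] by simp
    qed auto
    show ?thesis
    proof (rule joint_CLT[OF M X VH f L2])
      show "integrable lborel (\<lambda>t. cov M (\<lambda>\<omega>. f i (X 0 \<omega>)) (\<lambda>\<omega>. f j (X t \<omega>)))" for i j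
      proof (rule Bochner_Integration.integrable_bound)
        show "integrable lborel (\<lambda>t. Lf i * Lf j * \<bar>X.C t\<bar>)" using XC by simp
        have "\<bar>cov M (\<lambda>\<omega>. f i (X 0 \<omega>)) (\<lambda>\<omega>. f j (X t \<omega>))\<bar> \<le> Lf i * Lf j * \<bar>X.C t\<bar>" for t
        proof -
          have Lnn: "0 \<le> Lf i" for i using Lf[of i 1 0] by simp
          have lF: "\<bar>f i (x s) - f i (y s)\<bar> \<le> Lf i * l1_dist {s} x y" for i s x y using Lf by (simp add: l1_dist_def)
          note b0 = lip_const_bounds(3)[of "{0::real^'d}" "\<lambda>x. f i (x 0)", OF _ _ lF] lip_const_bounds(3)[of "{t}" "\<lambda>x. f j (x t)", OF _ _ lF]
          have "\<bar>cov M (\<lambda>\<omega>. f i (field_at X {0} \<omega> 0)) (\<lambda>\<omega>. f j (field_at X {t} \<omega> t))\<bar>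
              \<le> (\<Sum>s\<in>{0}. \<Sum>u\<in>{t}. lip_coord {0} s (\<lambda>x. f i (x 0)) * lip_coord {t} u (\<lambda>x. f j (x t)) * \<bar>cov M (X s) (X u)\<bar>)"
            by (rule QA(1)[unfolded QA_def, THEN conjunct2, rule_format]) (use b0 in simp)
          also have "\<dots> = lip_coord {0::real^'d} 0 (\<lambda>x. f i (x 0)) * lip_coord {t} t (\<lambda>x. f j (x t)) * \<bar>X.C t\<bar>" by (simp add: X.C_def)
          also have "\<dots> \<le> Lf i * Lf j * \<bar>X.C t\<bar>"
            using lip_coord_bounds[of "{0::real^'d}" 0 "\<lambda>x. f i (x 0)", OF _ _ lF] lip_coord_bounds[of "{t}" t "\<lambda>x. f j (x t)", OF _ _ lF] Lnn
            by (intro mult_right_mono mult_mono) auto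
          finally show ?thesis by (simp add: field_at_def)
        qed
        then show "AE t in lborel. norm (cov M (\<lambda>\<omega>. f i (X 0 \<omega>)) (\<lambda>\<omega>. f j (X t \<omega>))) \<le> norm (Lf i * Lf j * \<bar>X.C t\<bar>)"
          by (intro AE_I2) (simp add: order_trans[OF _ abs_ge_self])
      qed (use cov_measurable[OF f f] in auto)
      fix a :: "'s \<Rightarrow> real"
      show "\<exists>\<theta>. \<theta> \<longlonglongrightarrow> 0 \<and> L2_field.mixing M (\<lambda>t \<omega>. \<Sum>i\<in>UNIV. a i * f i (X t \<omega>)) \<theta>"
        by (rule QA_mixing[OF _ XF QA(1) XC, where g="\<lambda>x. \<Sum>i\<in>UNIV. a i * f i x"])
           (rule linear_combination_field(1)[OF M X f L2], rule lipschitz_combination[OF Lf])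
    qed
  next
    case PA
    have bv: "locally_bv (f i)" for i using PA(2) by simp
    note f[measurable] = locally_bv_measurable(1)[OF bv] and hm[measurable] = locally_bv_measurable(2)[OF bv]
    note inc = h_fun_increment[OF bv]
    have H2: "integrable M (\<lambda>\<omega>. (h_fun (f i) (X 0 \<omega>))\<^sup>2)" for i using PA(3) by simp
    have L2: "integrable M (\<lambda>\<omega>. (f i (X 0 \<omega>))\<^sup>2)" for i
    proof (rule L2_dominated[OF _ _ H2[of i]])
      show "\<bar>f i (X 0 \<omega>)\<bar> \<le> (\<bar>f i 0\<bar> + \<bar>h_fun (f i) 0\<bar>) + 1 * \<bar>h_fun (f i) (X 0 \<omega>)\<bar>" for \<omega>
        using inc[of 0 "X 0 \<omega>" i] inc[of "X 0 \<omega>" 0 i] by (cases "0 \<le> X 0 \<omega>") linarith+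
    qed measurable
    have fF: "L2_field M (\<lambda>t \<omega>. f i (X t \<omega>))" and hF: "L2_field M (\<lambda>t \<omega>. h_fun (f i) (X t \<omega>))" for i
      by standard (use L2 H2 measurable_field_compose[OF X(1) f] stationary_field_compose[OF X f]
         measurable_field_compose[OF X(1) hm] stationary_field_compose[OF X hm] in auto)
    let ?hc = "\<lambda>i j t. cov M (\<lambda>\<omega>. h_fun (f i) (X 0 \<omega>)) (\<lambda>\<omega>. h_fun (f j) (X t \<omega>))"
    \<comment> \<open>single points suffice here; the bound also shows that the covariances of the \<open>h_fun\<close> are nonnegative\<close>
    have fh: "\<bar>cov M (\<lambda>\<omega>. f i (X 0 \<omega>)) (\<lambda>\<omega>. f j (X t \<omega>))\<bar> \<le> ?hc i j t" for i j t
    proof -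
      have "\<bar>cov M (\<lambda>\<omega>. f i (field_at X {0} \<omega> 0)) (\<lambda>\<omega>. f j (field_at X {t} \<omega> t))\<bar>
          \<le> cov M (\<lambda>\<omega>. h_fun (f i) (field_at X {0} \<omega> 0)) (\<lambda>\<omega>. h_fun (f j) (field_at X {t} \<omega> t))"
        by (rule PA_cov_bound[OF M PA(1) X(1), of "{0}" "{t}" "\<lambda>x. f i (x 0)" "\<lambda>x. h_fun (f i) (x 0)" "\<lambda>x. f j (x t)" "\<lambda>x. h_fun (f j) (x t)"])
           (use inc L2 H2 L2_field.L2[OF fF] L2_field.L2[OF hF] in \<open>auto simp: field_at_def\<close>)
      then show ?thesis by (simp add: field_at_def)
    qed
    define K where "K i j = sqrt (L2_field.C M (\<lambda>t \<omega>. h_fun (f i) (X t \<omega>)) 0) * sqrt (L2_field.C M (\<lambda>t \<omega>. h_fun (f j) (X t \<omega>)) 0)" for i j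
    have K: "?hc i j t \<le> K i j" "0 \<le> K i j" for i j t
    proof -
      have "\<bar>?hc i j t\<bar> \<le> sqrt (cov M (\<lambda>\<omega>. h_fun (f i) (X 0 \<omega>)) (\<lambda>\<omega>. h_fun (f i) (X 0 \<omega>)))
          * sqrt (cov M (\<lambda>\<omega>. h_fun (f j) (X t \<omega>)) (\<lambda>\<omega>. h_fun (f j) (X t \<omega>)))"
        by (rule cov_le_sqrt) (use L2_field.L2[OF hF] in auto)
      also have "\<dots> = K i j" by (simp add: K_def L2_field.cov_eq_C[OF hF])
      finally show "?hc i j t \<le> K i j" "0 \<le> K i j" by linarith+
    qed
    let ?g = "\<lambda>i j (t::real^'d). if infnorm t \<le> 1 then K i j else c * infnorm t powr (- real CARD('d) - \<epsilon>)"
    have gi: "integrable lborel (?g i j)" for i j using PA(4,5) K by (intro integrable_power_decay) auto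
    have hg: "?hc i j t \<le> ?g i j t" for i j t using PA(6) K(1)[of i j t] by (cases "t = 0") (auto simp: infnorm_0)
    have fc: "integrable lborel (\<lambda>t. cov M (\<lambda>\<omega>. f i (X 0 \<omega>)) (\<lambda>\<omega>. f j (X t \<omega>)))" for i j
    proof (rule Bochner_Integration.integrable_bound[OF gi[of i j]])
      show "AE t in lborel. norm (cov M (\<lambda>\<omega>. f i (X 0 \<omega>)) (\<lambda>\<omega>. f j (X t \<omega>))) \<le> norm (?g i j t)"
        using order_trans[OF fh[of i j] hg[of i j]] by (intro AE_I2) (metis real_norm_def abs_ge_self order_trans)
    qed (use cov_measurable[OF f f] in auto)
    have hc: "integrable lborel (?hc i j)" for i j
    proof (rule Bochner_Integration.integrable_bound[OF gi[of i j]])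
      have "\<bar>?hc i j t\<bar> \<le> ?g i j t" for t using fh[of i j t] hg[of i j t] by linarith
      then show "AE t in lborel. norm (?hc i j t) \<le> norm (?g i j t)"
        by (intro AE_I2) (metis real_norm_def abs_ge_self order_trans)
    qed (use cov_measurable[OF hm hm] in auto)
    show ?thesis
    proof (rule joint_CLT[OF M X VH f L2 fc])
      fix a :: "'s \<Rightarrow> real"
      let ?h = "\<lambda>x. \<Sum>i\<in>UNIV. \<bar>a i\<bar> * h_fun (f i) x"
      note lin = linear_combination_field[OF M X hm H2, of "\<lambda>i. \<bar>a i\<bar>"]
      show "\<exists>\<theta>. \<theta> \<longlonglongrightarrow> 0 \<and> L2_field.mixing M (\<lambda>t \<omega>. \<Sum>i\<in>UNIV. a i * f i (X t \<omega>)) \<theta>"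
      proof (rule PA_mixing[OF X(1) _ _ PA(1), where g="\<lambda>x. \<Sum>i\<in>UNIV. a i * f i x" and h="?h"])
        show "L2_field M (\<lambda>t \<omega>. \<Sum>i\<in>UNIV. a i * f i (X t \<omega>))" by (rule linear_combination_field(1)[OF M X f L2])
        show "L2_field M (\<lambda>t \<omega>. ?h (X t \<omega>))" by (rule lin(1))
        show "integrable lborel (L2_field.C M (\<lambda>t \<omega>. ?h (X t \<omega>)))"
          unfolding lin(2) using hc by auto
        fix x y :: real assume xy: "x \<le> y"
        have "\<bar>(\<Sum>i\<in>UNIV. a i * f i y) - (\<Sum>i\<in>UNIV. a i * f i x)\<bar> = \<bar>\<Sum>i\<in>UNIV. a i * (f i y - f i x)\<bar>"
          by (simp add: sum_subtractf right_diff_distrib)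
        also have "\<dots> \<le> (\<Sum>i\<in>UNIV. \<bar>a i * (f i y - f i x)\<bar>)" by (rule sum_abs)
        also have "\<dots> \<le> (\<Sum>i\<in>UNIV. \<bar>a i\<bar> * (h_fun (f i) y - h_fun (f i) x))"
          using inc[OF xy] by (intro sum_mono) (simp add: abs_mult mult_left_mono)
        also have "\<dots> = ?h y - ?h x" by (simp add: sum_subtractf right_diff_distrib)
        finally show "\<bar>(\<Sum>i\<in>UNIV. a i * f i y) - (\<Sum>i\<in>UNIV. a i * f i x)\<bar> \<le> ?h y - ?h x" .
      qed measurable
    qed
  qed
qed

end
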